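(* Let $\mathcal{G}$ be a graph with chromatic polynomial $\chi_{\mathcal{G}}$ and let $k\ge 1$ be an integer. Let $\mathcal{G}_k$ be the graph obtained from $\mathcal{G}$ by adding $k+1$ additional vertices (the boundary vertices), each attached by an edge to every vertex of $\mathcal{G}$, and assign to them distinct boundary values $x_0,\dots,x_k\in\mathbb{R}$. Let $m$ be the number of edges of $\mathcal{G}_k$, and let $\Delta_m$ be the simplex of tuples $(c_e)_e$ of positive conductances on the edges of $\mathcal{G}_k$ with $\sum_e c_e=1$. Then $$|\chi_{\mathcal{G}}(-k)|=\frac{1}{|\Delta_m|}\int_{\Delta_m}\ \prod_{e=uv}\frac{(h(u)-h(v))^2}{Z}\ d\mathrm{vol},$$ where the product is over all $m$ edges of $\mathcal{G}_k$, $h$ is the harmonic extension with conductances $(c_e)$ and boundary values $x_0,\dots,x_k$, $Z=\sum_{e=uv}c_e(h(u)-h(v))^2$ is the total Dirichlet energy of $h$, $d\mathrm{vol}$ is Lebesgue measure on $\Delta_m$, and $|\Delta_m|$ is the total volume of $\Delta_m$.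
   Context: Graphs are finite and simple. No edges are added between the new boundary vertices of $\mathcal{G}_k$; the interior vertices of $\mathcal{G}_k$ are the vertices of $\mathcal{G}$. For conductances $(c_e)$ the harmonic extension $h$ is the solution of the Dirichlet problem: $h$ is the real function on the vertices of $\mathcal{G}_k$ that equals $x_i$ at the $i$-th boundary vertex and satisfies $\sum_{v\sim u}c_{uv}(h(u)-h(v))=0$ at every interior vertex $u$. The simplex $\Delta_m$ of conductances on the $m$ edges, normalized to sum to 1, has dimension $m-1$, and the measure is the $(m-1)$-dimensional Lebesgue measure. *)

theory Defs
  imports "HOL-Analysis.Analysis" "HOL-Computational_Algebra.Polynomial"
begin

definition simple_graph :: "'a set \<Rightarrow> 'a set set \<Rightarrow> bool" where
  "simple_graph V E \<longleftrightarrow> finite V \<and> (\<forall>e\<in>E. e \<subseteq> V \<and> card e = 2)"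

definition proper_colourings :: "'a set \<Rightarrow> 'a set set \<Rightarrow> nat \<Rightarrow> ('a \<Rightarrow> nat) set" where
  "proper_colourings V E q =
     {f \<in> V \<rightarrow>\<^sub>E {..<q}. \<forall>u v. {u, v} \<in> E \<longrightarrow> f u \<noteq> f v}"

definition chromatic_poly :: "'a set \<Rightarrow> 'a set set \<Rightarrow> int poly" where
  "chromatic_poly V E =
     (THE p. \<forall>q::nat. poly p (int q) = int (card (proper_colourings V E q)))"

text \<open>In the extended graph, \<open>Inl v\<close> is the vertex \<open>v\<close> of the original graph (an interior
  vertex) and \<open>Inr i\<close> with \<open>i \<le> k\<close> is the \<open>i\<close>-th boundary vertex.\<close>

definition ext_verts :: "'a set \<Rightarrow> nat \<Rightarrow> ('a + nat) set" where
  "ext_verts V k = Inl ` V \<union> Inr ` {..k}"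

definition ext_edges :: "'a set \<Rightarrow> 'a set set \<Rightarrow> nat \<Rightarrow> ('a + nat) set set" where
  "ext_edges V E k = (\<lambda>e. Inl ` e) ` E \<union> {{Inl v, Inr i} | v i. v \<in> V \<and> i \<le> k}"

definition is_harmonic_extension ::
  "'a set \<Rightarrow> 'a set set \<Rightarrow> nat \<Rightarrow> (nat \<Rightarrow> real) \<Rightarrow> (('a + nat) set \<Rightarrow> real) \<Rightarrow> ('a + nat \<Rightarrow> real) \<Rightarrow> bool"
  where
  "is_harmonic_extension V E k x c h \<longleftrightarrow>
     (\<forall>i\<le>k. h (Inr i) = x i) \<and>
     (\<forall>u\<in>Inl ` V. (\<Sum>v | v \<in> ext_verts V k \<and> {u, v} \<in> ext_edges V E k.
                     c {u, v} * (h u - h v)) = 0)"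

text \<open>The Dirichlet problem determines \<open>h\<close> only on the vertices; requiring \<open>h\<close> to be
  \<open>undefined\<close> elsewhere makes the solution unique as a HOL function.\<close>

definition harmonic_extension ::
  "'a set \<Rightarrow> 'a set set \<Rightarrow> nat \<Rightarrow> (nat \<Rightarrow> real) \<Rightarrow> (('a + nat) set \<Rightarrow> real) \<Rightarrow> 'a + nat \<Rightarrow> real" where
  "harmonic_extension V E k x c =
     (THE h. h \<in> extensional (ext_verts V k) \<and> is_harmonic_extension V E k x c h)"

definition sq_diff :: "('v \<Rightarrow> real) \<Rightarrow> 'v set \<Rightarrow> real" where
  "sq_diff h e = (THE s. \<exists>u v. e = {u, v} \<and> s = (h u - h v)\<^sup>2)"

lemma sq_diff_edge: "sq_diff h {u, v} = (h u - h v)\<^sup>2"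
  unfolding sq_diff_def
  by (rule the_equality) (auto simp: doubleton_eq_iff power2_commute)

definition dirichlet_energy :: "'v set set \<Rightarrow> ('v set \<Rightarrow> real) \<Rightarrow> ('v \<Rightarrow> real) \<Rightarrow> real" where
  "dirichlet_energy Es c h = (\<Sum>e\<in>Es. c e * sq_diff h e)"

definition open_simplex :: "'i set \<Rightarrow> ('i \<Rightarrow> real) set" where
  "open_simplex I = {c \<in> I \<rightarrow>\<^sub>E {0<..}. (\<Sum>i\<in>I. c i) = 1}"

text \<open>Lebesgue measure, of dimension \<open>card I - 1\<close>, on the affine hyperplane where the
  coordinates indexed by \<open>I\<close> sum to 1. The hyperplane is the graph of
  \<open>c \<mapsto> 1 - (\<Sum>j\<in>I - {i}. c j)\<close> over the other coordinates; every partial derivative of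
  this function is \<open>-1\<close>, so the area element is \<open>sqrt (1 + (card I - 1)) = sqrt (card I)\<close>
  times Lebesgue measure in those coordinates.\<close>

definition hyperplane_lebesgue_chart :: "'i set \<Rightarrow> 'i \<Rightarrow> ('i \<Rightarrow> real) measure" where
  "hyperplane_lebesgue_chart I i =
     scale_measure (ennreal (sqrt (real (card I))))
       (distr (Pi\<^sub>M (I - {i}) (\<lambda>_. lborel)) (Pi\<^sub>M I (\<lambda>_. lborel))
          (\<lambda>c. c(i := 1 - (\<Sum>j\<in>I - {i}. c j))))"

definition hyperplane_lebesgue :: "'i set \<Rightarrow> ('i \<Rightarrow> real) measure" where
  "hyperplane_lebesgue I = hyperplane_lebesgue_chart I (SOME i. i \<in> I)"

lemma chart_measurable:
  assumes "finite I" "i \<in> I"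
  shows "(\<lambda>c. c(i := 1 - (\<Sum>j\<in>I - {i}. c j)))
           \<in> measurable (Pi\<^sub>M (I - {i}) (\<lambda>_. lborel)) (Pi\<^sub>M I (\<lambda>_. lborel :: real measure))"
proof -
  have I: "I = insert i (I - {i})" using assms by auto
  have "(\<lambda>c. c(i := 1 - (\<Sum>j\<in>I - {i}. c j)))
           \<in> measurable (Pi\<^sub>M (I - {i}) (\<lambda>_. lborel))
               (Pi\<^sub>M (insert i (I - {i})) (\<lambda>_. lborel :: real measure))"
    by (rule measurable_fun_upd[where J = "I - {i}"]) auto
  then show ?thesis using I by simp
qed

lemma chart_emeasure:
  assumes I: "finite I" "i \<in> I" "j \<in> I" "i \<noteq> j" and A: "A \<in> sets (Pi\<^sub>M I (\<lambda>_. lborel))"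
  shows "emeasure (distr (Pi\<^sub>M (I - {i}) (\<lambda>_. lborel)) (Pi\<^sub>M I (\<lambda>_. lborel))
           (\<lambda>c. c(i := 1 - (\<Sum>j\<in>I - {i}. c j)))) A =
         (\<integral>\<^sup>+ y. (\<integral>\<^sup>+ t. indicator A (y(j := t, i := 1 - (\<Sum>l\<in>I - {i, j}. y l) - t)) \<partial>lborel)
            \<partial>Pi\<^sub>M (I - {i, j}) (\<lambda>_. lborel :: real measure))"
proof -
  interpret product_sigma_finite "\<lambda>_. lborel :: real measure" by standard
  let ?T = "\<lambda>c. c(i := 1 - (\<Sum>j\<in>I - {i}. c j) :: real)"
  note m = chart_measurable[OF I(1,2)]
  have J: "I - {i} = insert j (I - {i, j})" using I by auto
  have ind: "(\<lambda>c. indicator A (?T c) :: ennreal) \<in> borel_measurable (Pi\<^sub>M (I - {i}) (\<lambda>_. lborel))"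
    by (rule measurable_compose[OF m]) (use A in auto)
  have "emeasure (distr (Pi\<^sub>M (I - {i}) (\<lambda>_. lborel)) (Pi\<^sub>M I (\<lambda>_. lborel)) ?T) A
      = (\<integral>\<^sup>+ c. indicator A c \<partial>distr (Pi\<^sub>M (I - {i}) (\<lambda>_. lborel)) (Pi\<^sub>M I (\<lambda>_. lborel)) ?T)"
    using A by simp
  also have "\<dots> = (\<integral>\<^sup>+ c. indicator A (?T c) \<partial>Pi\<^sub>M (I - {i}) (\<lambda>_. lborel))"
    by (rule nn_integral_distr[OF m]) (use A in auto)
  also have "\<dots> = (\<integral>\<^sup>+ c. indicator A (?T c) \<partial>Pi\<^sub>M (insert j (I - {i, j})) (\<lambda>_. lborel))"
    using J by simp
  also have "\<dots> = (\<integral>\<^sup>+ y. (\<integral>\<^sup>+ t. indicator A (?T (y(j := t))) \<partial>lborel) \<partial>Pi\<^sub>M (I - {i, j}) (\<lambda>_. lborel))"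
    by (rule product_nn_integral_insert) (use I ind J in auto)
  also have "\<And>y t. (\<Sum>l\<in>I - {i}. (y(j := t)) l) = t + (\<Sum>l\<in>I - {i, j}. y l :: real)"
    unfolding J using I by (subst sum.insert) (auto intro!: sum.cong)
  then have "(\<integral>\<^sup>+ y. (\<integral>\<^sup>+ t. indicator A (?T (y(j := t))) \<partial>lborel) \<partial>Pi\<^sub>M (I - {i, j}) (\<lambda>_. lborel))
      = (\<integral>\<^sup>+ y. (\<integral>\<^sup>+ t. indicator A (y(j := t, i := 1 - (\<Sum>l\<in>I - {i, j}. y l) - t)) \<partial>lborel)
            \<partial>Pi\<^sub>M (I - {i, j}) (\<lambda>_. lborel :: real measure))"
    by (simp add: algebra_simps)
  finally show ?thesis .
qed

lemma hyperplane_lebesgue_chart_indep: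
  assumes I: "finite I" "i \<in> I" "j \<in> I"
  shows "hyperplane_lebesgue_chart I i = hyperplane_lebesgue_chart I j"
proof (cases "i = j")
  case False
  have "distr (Pi\<^sub>M (I - {i}) (\<lambda>_. lborel)) (Pi\<^sub>M I (\<lambda>_. lborel)) (\<lambda>c. c(i := 1 - (\<Sum>j\<in>I - {i}. c j)))
      = distr (Pi\<^sub>M (I - {j}) (\<lambda>_. lborel)) (Pi\<^sub>M I (\<lambda>_. lborel :: real measure))
          (\<lambda>c. c(j := 1 - (\<Sum>l\<in>I - {j}. c l)))" (is "?M = ?N")
  proof (rule measure_eqI)
    fix A assume "A \<in> sets ?M"
    then have A: "A \<in> sets (Pi\<^sub>M I (\<lambda>_. lborel :: real measure))" by simp
    let ?s = "\<lambda>y. 1 - (\<Sum>l\<in>I - {i, j}. y l) :: real"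
    have "(\<integral>\<^sup>+ t. indicator A (y(j := t, i := ?s y - t)) \<partial>lborel)
        = (\<integral>\<^sup>+ t. indicator A (y(i := t, j := ?s y - t)) \<partial>lborel)"
      if y: "y \<in> space (Pi\<^sub>M (I - {i, j}) (\<lambda>_. lborel :: real measure))" for y
    proof -
      have I': "I = insert i (I - {i})" "I - {i} = insert j (I - {i, j})"
        using I False by auto
      have "(\<lambda>t. y(j := t, i := ?s y - t))
            \<in> measurable lborel (Pi\<^sub>M (insert i (insert j (I - {i, j}))) (\<lambda>_. lborel :: real measure))"
        by (intro measurable_fun_upd[where J = "insert j (I - {i, j})"]
              measurable_fun_upd[where J = "I - {i, j}"]) (use y False in auto)
      then have "(\<lambda>t. y(j := t, i := ?s y - t)) \<in> measurable borel (Pi\<^sub>M I (\<lambda>_. lborel))"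
        using I' by simp
      then have "(\<lambda>t. indicator A (y(j := t, i := ?s y - t)) :: ennreal) \<in> borel_measurable borel"
        by (rule measurable_compose) (use A in auto)
      from nn_integral_real_affine[OF this, of "-1" "?s y"]
      show ?thesis
        using False by (simp add: fun_upd_twist[of i j])
    qed
    then have "emeasure ?M A = (\<integral>\<^sup>+ y. (\<integral>\<^sup>+ t. indicator A (y(i := t, j := ?s y - t)) \<partial>lborel)
        \<partial>Pi\<^sub>M (I - {i, j}) (\<lambda>_. lborel))"
      unfolding chart_emeasure[OF I(1,2,3) False A] by (rule nn_integral_cong)
    also have "\<dots> = emeasure ?N A"
      unfolding chart_emeasure[OF I(1,3,2) False[symmetric] A] insert_commute[of j i] ..
    finally show "emeasure ?M A = emeasure ?N A" .
  qed simp
  then show ?thesis by (simp add: hyperplane_lebesgue_chart_def)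
qed simp

lemma hyperplane_lebesgue_eq_chart:
  assumes "finite I" "i \<in> I"
  shows "hyperplane_lebesgue I = hyperplane_lebesgue_chart I i"
  unfolding hyperplane_lebesgue_def
  by (rule hyperplane_lebesgue_chart_indep) (use assms in \<open>auto intro: someI\<close>)

end

theory Submission
  imports Defs "HOL-Probability.Distributions"
begin

text \<open>
Write \<open>d\<^sub>e = h(u) - h(v)\<close> for the difference of the harmonic extension along an edge \<open>e = uv\<close>,
\<open>Q(c) = \<Prod>\<^sub>e d\<^sub>e\<^sup>2\<close> and \<open>Z(c) = \<Sum>\<^sub>e c\<^sub>e d\<^sub>e\<^sup>2\<close>. Scaling all conductances leaves \<open>h\<close> unchanged, so
\<open>Q\<close> is homogeneous of degree 0 and \<open>Z\<close> of degree 1. Integrating \<open>Q exp(-Z)\<close> along the rays of the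
positive orthant turns it into \<open>(m - 1)! Q / Z\<^sup>m\<close> on the simplex; for \<open>exp(- \<Sum>\<^sub>e c\<^sub>e)\<close>, whose integral
is 1, the same computation yields the volume of the simplex. The average in question is therefore
the integral of \<open>Q exp(-Z)\<close> over the orthant (\<open>simplex_average\<close>), and the point is to compute that
integral (\<open>energy_integral\<close>).

Up to sign, \<open>Q\<close> is the Jacobian determinant of the map from conductances to edge energies
\<open>y\<^sub>e = c\<^sub>e d\<^sub>e\<^sup>2\<close>, while \<open>Z = \<Sum>\<^sub>e y\<^sub>e\<close>. So the integral is the integral of \<open>exp(- \<Sum>\<^sub>e y\<^sub>e)\<close>, weighted by the
number of conductances with energies \<open>y\<close>. A potential \<open>h\<close> without ties along edges is harmonic for
the conductances \<open>y\<^sub>e / d\<^sub>e\<^sup>2\<close> iff \<open>\<Sum>\<^sub>u y\<^sub>u\<^sub>v / (h(v) - h(u)) = 0\<close> at each interior vertex \<open>v\<close>, that is,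
iff it is a critical point of \<open>\<Sum>\<^sub>e y\<^sub>e log |d\<^sub>e|\<close>. This function is strictly concave on every cell of
the arrangement of the hyperplanes \<open>h(u) = h(v)\<close> for \<open>uv\<close> an edge and \<open>h(v) = x\<^sub>i\<close>. It has one
critical point in each cell in which all values stay between the least and the greatest boundary
value, and none elsewhere. Hence the integral is the number of these cells. Deletion and contraction
of an edge, applied to cells and to colourings alike, identify this number with \<open>|\<chi>(-k)|\<close>
(\<open>num_types_reciprocity\<close>); this is Stanley's reciprocity theorem in geometric form.

The change of variables has to work in a dimension that is not fixed by a type. It is carried out
on functions on the vertex set, one coordinate at a time. Let \<open>b\<close> be the boundary vertex of least
value, and call the edge from an interior vertex to \<open>b\<close> a spoke. When the conductances of all other
edges are given, Kirchhoff's law expresses the spoke conductances through \<open>h\<close>; when the energies of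
all other edges are given, criticality expresses the spoke energies through \<open>h\<close>. Both maps have
one shape: edges carry the flow \<open>\<phi>(d\<^sub>e)\<close> times a weight, for the increasing function \<open>\<phi>(d) = d\<close>
or \<open>\<phi>(d) = -1/d\<close>, and the spoke weight balances the flow at its vertex. The difference of two values
of such a map is a strictly diagonally dominant M-matrix applied to the difference of the potentials
(up to row scaling). This makes the map injective and open even if only some of the coordinates
have been replaced, and the one-dimensional substitutions produce the pivots of Gaussian
elimination (\<open>secant_map.change_of_variables\<close>). For both maps the matrix at coinciding points is
the weighted Laplacian with conductances \<open>c\<^sub>e = y\<^sub>e / d\<^sub>e\<^sup>2\<close>, so going from conductances to potentials
and from potentials to energies the same pivots appear and cancel
(\<open>linear_change_of_variables\<close>, \<open>density_scaling\<close>, \<open>log_change_of_variables\<close>).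
\<close>

section \<open>Gaussian elimination for strict M-matrices\<close>

definition strict_M_matrix :: "'i set \<Rightarrow> ('i \<Rightarrow> 'i \<Rightarrow> real) \<Rightarrow> bool" where
  "strict_M_matrix V A \<longleftrightarrow>
     (\<forall>a\<in>V. (\<forall>b\<in>V. b \<noteq> a \<longrightarrow> A a b \<le> 0) \<and> 0 < (\<Sum>b\<in>V. A a b))"

text \<open>One step of Gaussian elimination: it also produces a row and a column with index \<open>u\<close>, which
  are meant to be dropped.\<close>

definition elim_row :: "('i \<Rightarrow> 'i \<Rightarrow> real) \<Rightarrow> 'i \<Rightarrow> 'i \<Rightarrow> 'i \<Rightarrow> real" where
  "elim_row A u = (\<lambda>a b. A a b - A a u * A u b / A u u)"

fun schur_complement :: "('i \<Rightarrow> 'i \<Rightarrow> real) \<Rightarrow> 'i list \<Rightarrow> 'i \<Rightarrow> 'i \<Rightarrow> real" where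
  "schur_complement A [] = A"
| "schur_complement A (u # us) = schur_complement (elim_row A u) us"

text \<open>The product of the pivots is the determinant of the matrix on the listed indices. Keeping it as
  a product is what the substitution of one coordinate after the other delivers.\<close>

fun pivot_prod :: "('i \<Rightarrow> 'i \<Rightarrow> real) \<Rightarrow> 'i list \<Rightarrow> real" where
  "pivot_prod A [] = 1"
| "pivot_prod A (u # us) = A u u * pivot_prod (elim_row A u) us"

text \<open>Back substitution. An explicit solution is preferred to Cramer's rule because positivity and
  measurable dependence on the matrix are then immediate by induction.\<close>

fun gauss_solve :: "'i list \<Rightarrow> ('i \<Rightarrow> 'i \<Rightarrow> real) \<Rightarrow> ('i \<Rightarrow> real) \<Rightarrow> 'i \<Rightarrow> real" where
  "gauss_solve [] A r = (\<lambda>_. undefined)"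
| "gauss_solve (u # us) A r =
     (let h = gauss_solve us (elim_row A u) (\<lambda>a. r a - A a u * r u / A u u)
      in h(u := (r u - (\<Sum>b\<in>set us. A u b * h b)) / A u u))"

lemma pivot_prod_snoc:
  "pivot_prod A (us @ [w]) = pivot_prod A us * schur_complement A us w w"
  by (induction us arbitrary: A) auto

lemma strict_M_matrix_diag_pos:
  assumes "strict_M_matrix V A" "finite V" "a \<in> V"
  shows "0 < A a a"
proof -
  have "0 < (\<Sum>b\<in>V. A a b)" using assms by (auto simp: strict_M_matrix_def)
  also have "\<dots> = A a a + (\<Sum>b\<in>V - {a}. A a b)" using assms by (simp add: sum.remove)
  also have "\<dots> \<le> A a a + 0"
    using assms by (intro add_left_mono sum_nonpos) (auto simp: strict_M_matrix_def)
  finally show ?thesis by simp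
qed

text \<open>Elimination adds a nonnegative multiple of the pivot row to each row, so off-diagonal entries
  can only decrease and row sums can only increase.\<close>

lemma strict_M_matrix_elim_row:
  assumes M: "strict_M_matrix V A" and fin: "finite V" and u: "u \<in> V"
  shows "strict_M_matrix (V - {u}) (elim_row A u)"
proof -
  note pos = strict_M_matrix_diag_pos[OF M fin u]
  have off: "A a b \<le> 0" if "a \<in> V" "b \<in> V" "b \<noteq> a" for a b
    using M that by (auto simp: strict_M_matrix_def)
  have rows: "0 < (\<Sum>b\<in>V. A a b)" if "a \<in> V" for a
    using M that by (auto simp: strict_M_matrix_def)
  have "elim_row A u a b \<le> 0" if "a \<in> V - {u}" "b \<in> V - {u}" "b \<noteq> a" for a b
  proof -
    have "0 \<le> A a u * A u b / A u u"
      using off[of a u] off[of u b] that u pos by (intro divide_nonneg_pos mult_nonpos_nonpos) auto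
    then show ?thesis using off[of a b] that by (simp add: elim_row_def)
  qed
  moreover have "0 < (\<Sum>b\<in>V - {u}. elim_row A u a b)" if a: "a \<in> V - {u}" for a
  proof -
    have rem: "(\<Sum>b\<in>V - {u}. A c b) = (\<Sum>b\<in>V. A c b) - A c u" for c
      using fin u by (simp add: sum.remove)
    have "(\<Sum>b\<in>V - {u}. elim_row A u a b)
        = (\<Sum>b\<in>V - {u}. A a b) - A a u / A u u * (\<Sum>b\<in>V - {u}. A u b)"
      by (simp add: elim_row_def sum_subtractf sum_distrib_left)
    also have "\<dots> = (\<Sum>b\<in>V. A a b) - A a u / A u u * (\<Sum>b\<in>V. A u b)"
      using pos by (simp add: rem field_simps)
    also have "\<dots> > 0"
    proof -
      have "A a u / A u u * (\<Sum>b\<in>V. A u b) \<le> 0"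
        using off[of a u] a u pos rows[OF u]
        by (intro mult_nonpos_nonneg divide_nonpos_pos) auto
      then show ?thesis using rows[of a] a by simp
    qed
    finally show ?thesis .
  qed
  ultimately show ?thesis by (auto simp: strict_M_matrix_def)
qed

lemma strict_M_matrix_schur_complement:
  assumes "strict_M_matrix V A" "finite V" "distinct us" "set us \<subseteq> V"
  shows "strict_M_matrix (V - set us) (schur_complement A us)"
  using assms
proof (induction us arbitrary: A V)
  case (Cons u us)
  have "strict_M_matrix (V - {u} - set us) (schur_complement (elim_row A u) us)"
    using Cons.prems by (intro Cons.IH strict_M_matrix_elim_row) auto
  moreover have "V - {u} - set us = V - set (u # us)" by auto
  ultimately show ?case by simp
qed simp

text \<open>If the equations of the eliminated rows hold, the eliminated unknowns have been substituted by
  their solutions, and the remaining rows take the same value as before.\<close>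

lemma schur_complement_mult:
  assumes "finite V" "strict_M_matrix V A" "distinct us" "set us \<subseteq> V" "a \<in> V - set us"
    and zero: "\<And>u. u \<in> set us \<Longrightarrow> (\<Sum>b\<in>V. A u b * \<delta> b) = 0"
  shows "(\<Sum>b\<in>V. A a b * \<delta> b) = (\<Sum>b\<in>V - set us. schur_complement A us a b * \<delta> b)"
  using assms
proof (induction us arbitrary: A V)
  case (Cons u us)
  have u: "u \<in> V" using Cons.prems by auto
  note pos = strict_M_matrix_diag_pos[OF Cons.prems(2,1) u]
  have rem: "(\<Sum>b\<in>V. A c b * \<delta> b) = A c u * \<delta> u + (\<Sum>b\<in>V - {u}. A c b * \<delta> b)" for c
    using Cons.prems(1) u by (simp add: sum.remove)
  have "A u u * \<delta> u = - (\<Sum>b\<in>V - {u}. A u b * \<delta> b)"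
    using Cons.prems(6)[of u] rem[of u] by simp
  then have du: "\<delta> u = - (\<Sum>b\<in>V - {u}. A u b * \<delta> b) / A u u"
    using pos by (simp add: field_simps)
  have step: "(\<Sum>b\<in>V. A c b * \<delta> b) = (\<Sum>b\<in>V - {u}. elim_row A u c b * \<delta> b)" for c
    unfolding rem by (simp add: du elim_row_def left_diff_distrib sum_subtractf sum_distrib_left
        sum_divide_distrib mult.assoc sum_negf)
  have "(\<Sum>b\<in>V - {u}. elim_row A u a b * \<delta> b)
      = (\<Sum>b\<in>V - {u} - set us. schur_complement (elim_row A u) us a b * \<delta> b)"
  proof (rule Cons.IH)
    show "strict_M_matrix (V - {u}) (elim_row A u)"
      using Cons.prems u by (intro strict_M_matrix_elim_row) auto
    show "(\<Sum>b\<in>V - {u}. elim_row A u w b * \<delta> b) = 0" if "w \<in> set us" for w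
      using Cons.prems(6)[of w] that step[of w] by simp
  qed (use Cons.prems in auto)
  moreover have "V - {u} - set us = V - set (u # us)" by auto
  ultimately show ?case using step[of a] by simp
qed simp

text \<open>This computes a partial derivative under constraints: when one coordinate \<open>w\<close> moves, the
  coordinates in \<open>us\<close> adjust so that their rows vanish, and the others stay, then row \<open>w\<close> responds
  with the pivot.\<close>

lemma schur_complement_pivot:
  assumes "finite V" "strict_M_matrix V A" "distinct us" "set us \<subseteq> V" "w \<in> V - set us"
    and zero: "\<And>u. u \<in> set us \<Longrightarrow> (\<Sum>b\<in>V. A u b * \<delta> b) = 0"
    and supp: "\<And>u. u \<in> V - insert w (set us) \<Longrightarrow> \<delta> u = 0"
  shows "(\<Sum>b\<in>V. A w b * \<delta> b) = schur_complement A us w w * \<delta> w"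
proof -
  have "(\<Sum>b\<in>V. A w b * \<delta> b) = (\<Sum>b\<in>V - set us. schur_complement A us w b * \<delta> b)"
    using assms by (intro schur_complement_mult) auto
  also have "\<dots> = (\<Sum>b\<in>{w}. schur_complement A us w b * \<delta> b)"
    using assms by (intro sum.mono_neutral_right) auto
  finally show ?thesis by simp
qed

lemma schur_complement_pivot_pos:
  assumes "finite V" "strict_M_matrix V A" "distinct us" "set us \<subseteq> V" "w \<in> V - set us"
  shows "0 < schur_complement A us w w"
  using assms strict_M_matrix_schur_complement[of V A us]
  by (intro strict_M_matrix_diag_pos[of "V - set us"]) auto

lemma pivot_prod_pos:
  assumes "finite V" "strict_M_matrix V A" "distinct us" "set us \<subseteq> V"
  shows "0 < pivot_prod A us"
  using assms
proof (induction us arbitrary: A V)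
  case (Cons u us)
  have "0 < pivot_prod (elim_row A u) us"
    using Cons.prems by (intro Cons.IH[of "V - {u}"] strict_M_matrix_elim_row) auto
  moreover have "0 < A u u" using Cons.prems by (intro strict_M_matrix_diag_pos[of V]) auto
  ultimately show ?case by simp
qed simp

text \<open>Eliminating all indices but the last shows that the last entry vanishes, as its pivot is
  positive; then the previous one can be treated in the same way.\<close>

lemma strict_M_matrix_kernel:
  assumes "finite V" "strict_M_matrix V A" "distinct us" "set us \<subseteq> V"
    and "\<And>u. u \<in> set us \<Longrightarrow> (\<Sum>b\<in>V. A u b * \<delta> b) = 0"
    and "\<And>u. u \<in> V - set us \<Longrightarrow> \<delta> u = 0" and "v \<in> V"
  shows "\<delta> v = 0"
  using assms
proof (induction us arbitrary: v rule: rev_induct)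
  case (snoc w us)
  have "(\<Sum>b\<in>V. A w b * \<delta> b) = schur_complement A us w w * \<delta> w"
    using snoc.prems by (intro schur_complement_pivot) auto
  moreover have "0 < schur_complement A us w w"
    using snoc.prems by (intro schur_complement_pivot_pos) auto
  ultimately have dw: "\<delta> w = 0" using snoc.prems(5)[of w] by simp
  show ?case
  proof (rule snoc.IH)
    show "\<delta> u = 0" if "u \<in> V - set us" for u using that dw snoc.prems(6)[of u] by auto
  qed (use snoc.prems in auto)
qed auto

lemma gauss_solve_correct:
  assumes "strict_M_matrix (set us) A" "distinct us" "a \<in> set us"
  shows "(\<Sum>b\<in>set us. A a b * gauss_solve us A r b) = r a"
  using assms
proof (induction us arbitrary: A r a)
  case (Cons u us)
  define h where "h = gauss_solve us (elim_row A u) (\<lambda>a. r a - A a u * r u / A u u)"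
  define h' where "h' = h(u := (r u - (\<Sum>b\<in>set us. A u b * h b)) / A u u)"
  have pos: "0 < A u u" using Cons.prems by (intro strict_M_matrix_diag_pos) auto
  have M: "strict_M_matrix (set us) (elim_row A u)"
    using strict_M_matrix_elim_row[OF Cons.prems(1), of u] Cons.prems(2)
    by (simp add: Diff_insert_absorb)
  have u: "u \<notin> set us" using Cons.prems by simp
  have eq: "(\<Sum>b\<in>set us. A c b * h' b) = (\<Sum>b\<in>set us. A c b * h b)" for c
    using u by (intro sum.cong) (auto simp: h'_def)
  have row: "A u u * h' u + (\<Sum>b\<in>set us. A u b * h b) = r u"
    using pos by (simp add: h'_def)
  have "A a u * h' u + (\<Sum>b\<in>set us. A a b * h b) = r a"
  proof (cases "a = u")
    case False
    with Cons.prems have a: "a \<in> set us" by simp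
    have "(\<Sum>b\<in>set us. elim_row A u a b * h b) = r a - A a u * r u / A u u"
      unfolding h_def using Cons.IH[OF M _ a] Cons.prems by simp
    moreover have "(\<Sum>b\<in>set us. elim_row A u a b * h b)
        = (\<Sum>b\<in>set us. A a b * h b) - A a u / A u u * (\<Sum>b\<in>set us. A u b * h b)"
      by (simp add: elim_row_def left_diff_distrib sum_subtractf sum_distrib_left mult.assoc)
    moreover have "(\<Sum>b\<in>set us. A u b * h b) = r u - A u u * h' u" using row by simp
    moreover have "A a u / A u u * (r u - A u u * h' u) = A a u * r u / A u u - A a u * h' u"
      using pos by (simp add: right_diff_distrib)
    ultimately show ?thesis by simp
  qed (use row in simp)
  moreover have "gauss_solve (u # us) A r = h'" by (simp add: h'_def h_def Let_def)
  ultimately show ?case using u by (simp add: eq)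
qed simp

text \<open>A discrete maximum principle: elimination keeps the right-hand side positive because the
  off-diagonal entries are nonpositive.\<close>

lemma gauss_solve_pos:
  assumes "strict_M_matrix (set us) A" "distinct us" "\<And>a. a \<in> set us \<Longrightarrow> 0 < r a" "a \<in> set us"
  shows "0 < gauss_solve us A r a"
  using assms
proof (induction us arbitrary: A r a)
  case (Cons u us)
  define h where "h = gauss_solve us (elim_row A u) (\<lambda>a. r a - A a u * r u / A u u)"
  have pos: "0 < A u u" using Cons.prems by (intro strict_M_matrix_diag_pos) auto
  have M: "strict_M_matrix (set us) (elim_row A u)"
    using strict_M_matrix_elim_row[OF Cons.prems(1), of u] Cons.prems(2)
    by (simp add: Diff_insert_absorb)
  have off: "A c d \<le> 0" if "c \<in> set (u # us)" "d \<in> set (u # us)" "c \<noteq> d" for c d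
    using Cons.prems(1) that by (auto simp: strict_M_matrix_def)
  have u: "u \<notin> set us" using Cons.prems by simp
  have hpos: "0 < h c" if c: "c \<in> set us" for c
    unfolding h_def
  proof (rule Cons.IH[OF M])
    fix d assume d: "d \<in> set us"
    have "A d u * r u / A u u \<le> 0"
      using off[of d u] d u pos Cons.prems(3)[of u]
      by (intro divide_nonpos_pos mult_nonpos_nonneg) auto
    then show "0 < r d - A d u * r u / A u u" using Cons.prems(3)[of d] d by simp
  qed (use Cons.prems c in auto)
  have "(\<Sum>b\<in>set us. A u b * h b) \<le> 0"
    using off u hpos by (intro sum_nonpos mult_nonpos_nonneg) (auto intro: less_imp_le)
  then have "0 < (r u - (\<Sum>b\<in>set us. A u b * h b)) / A u u"
    using pos Cons.prems(3)[of u] by (intro divide_pos_pos) auto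
  then show ?case using Cons.prems(4) hpos by (auto simp: Let_def simp flip: h_def)
qed simp

lemma borel_measurable_pivot_prod:
  assumes "\<And>a b. a \<in> set us \<Longrightarrow> b \<in> set us \<Longrightarrow> (\<lambda>w. A w a b) \<in> borel_measurable M"
  shows "(\<lambda>w. pivot_prod (A w) us) \<in> borel_measurable M"
  using assms
proof (induction us arbitrary: A)
  case (Cons u us)
  have "(\<lambda>w. pivot_prod (elim_row (A w) u) us) \<in> borel_measurable M"
    by (rule Cons.IH) (auto simp: elim_row_def intro!: Cons.prems borel_measurable_diff
        borel_measurable_divide borel_measurable_times)
  then show ?case by (auto intro!: Cons.prems borel_measurable_times)
qed simp

lemma borel_measurable_gauss_solve:
  assumes "\<And>a b. a \<in> set us \<Longrightarrow> b \<in> set us \<Longrightarrow> (\<lambda>w. A w a b) \<in> borel_measurable M"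
    and "\<And>a. a \<in> set us \<Longrightarrow> (\<lambda>w. r w a) \<in> borel_measurable M"
  shows "(\<lambda>w. gauss_solve us (A w) (r w) v) \<in> borel_measurable M"
  using assms
proof (induction us arbitrary: A r v)
  case (Cons u us)
  have IH: "(\<lambda>w. gauss_solve us (elim_row (A w) u) (\<lambda>a. r w a - A w a u * r w u / A w u u) b)
      \<in> borel_measurable M" for b
    by (rule Cons.IH) (auto simp: elim_row_def intro!: Cons.prems borel_measurable_diff
        borel_measurable_divide borel_measurable_times)
  show ?case
    by (cases "v = u")
      (auto simp: Let_def intro!: IH Cons.prems borel_measurable_diff
        borel_measurable_divide borel_measurable_times borel_measurable_sum)
qed simp

lemma continuous_on_schur_complement:
  assumes "finite V" "\<And>w. w \<in> U \<Longrightarrow> strict_M_matrix V (A w)" "distinct us" "set us \<subseteq> V"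
    and "\<And>a b. a \<in> V \<Longrightarrow> b \<in> V \<Longrightarrow> continuous_on U (\<lambda>w. A w a b)"
    and "a \<in> V - set us" "b \<in> V - set us"
  shows "continuous_on U (\<lambda>w. schur_complement (A w) us a b)"
  using assms
proof (induction us arbitrary: A V)
  case (Cons u us)
  have "\<forall>w\<in>U. A w u u \<noteq> 0"
    using Cons.prems strict_M_matrix_diag_pos[of V _ u] by fastforce
  then have "continuous_on U (\<lambda>w. schur_complement (elim_row (A w) u) us a b)"
    using Cons.prems
    by (intro Cons.IH[of "V - {u}"] strict_M_matrix_elim_row)
      (auto simp: elim_row_def intro!: continuous_intros)
  then show ?case by simp
qed simp

section \<open>Topology and measure on real vectors indexed by a finite set\<close>

abbreviation vecs :: "'i set \<Rightarrow> ('i \<Rightarrow> real) set" where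
  "vecs V \<equiv> PiE V (\<lambda>_. UNIV)"

abbreviation leb :: "'i set \<Rightarrow> ('i \<Rightarrow> real) measure" where
  "leb V \<equiv> Pi\<^sub>M V (\<lambda>_. lborel)"

interpretation lborel_product: product_sigma_finite "\<lambda>_::'i. lborel :: real measure"
  by standard

lemma space_leb [simp]: "space (leb V) = vecs V"
  by (simp add: space_PiM)

text \<open>Vectors indexed by \<open>V\<close> are undefined outside \<open>V\<close>, so that open sets of vectors are open relative
  to \<open>vecs V\<close> in the topology of pointwise convergence. For finite \<open>V\<close> this is the Euclidean topology.\<close>

abbreviation rel_open :: "'i set \<Rightarrow> ('i \<Rightarrow> real) set \<Rightarrow> bool" where
  "rel_open V U \<equiv> openin (top_of_set (vecs V)) U"

lemma rel_open_iff_box: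
  assumes fin: "finite V"
  shows "rel_open V U \<longleftrightarrow> U \<subseteq> vecs V \<and>
    (\<forall>h\<in>U. \<exists>\<epsilon>>0. \<forall>h'\<in>vecs V. (\<forall>v\<in>V. \<bar>h' v - h v\<bar> < \<epsilon>) \<longrightarrow> h' \<in> U)"
    (is "?L \<longleftrightarrow> ?R")
proof
  assume L: ?L
  then obtain W where W: "open W" "U = vecs V \<inter> W" by (auto simp: openin_open)
  have "\<exists>\<epsilon>>0. \<forall>h'\<in>vecs V. (\<forall>v\<in>V. \<bar>h' v - h v\<bar> < \<epsilon>) \<longrightarrow> h' \<in> U" if h: "h \<in> U" for h
  proof -
    have "openin (product_topology (\<lambda>_. euclidean) UNIV) W" "h \<in> W"
      using W h by (auto simp: euclidean_product_topology)
    from product_topology_open_contains_basis[OF this]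
    obtain X where X: "h \<in> Pi\<^sub>E UNIV X" "\<And>i. open (X i)" "Pi\<^sub>E UNIV X \<subseteq> W" by auto
    have "\<exists>e>0. ball (h v) e \<subseteq> X v" for v
      using X(1) X(2)[of v] open_contains_ball[of "X v"] by auto
    then obtain e where e: "\<And>v. e v > 0" "\<And>v. ball (h v) (e v) \<subseteq> X v" by metis
    define \<epsilon> where "\<epsilon> = Min (insert 1 (e ` V))"
    have \<epsilon>: "\<epsilon> > 0" "\<And>v. v \<in> V \<Longrightarrow> \<epsilon> \<le> e v"
      using fin e(1) by (auto simp: \<epsilon>_def)
    have "h' \<in> U" if h': "h' \<in> vecs V" "\<forall>v\<in>V. \<bar>h' v - h v\<bar> < \<epsilon>" for h'
    proof -
      have "h' i \<in> X i" for i
      proof (cases "i \<in> V")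
        case True
        then have "h' i \<in> ball (h i) (e i)"
          using h'(2) \<epsilon>(2)[of i] by (force simp: dist_real_def abs_minus_commute)
        then show ?thesis using e(2)[of i] by auto
      next
        case False
        then have "h' i = h i" using h' h W(2) by (auto simp: PiE_def extensional_def)
        then show ?thesis using X(1) by auto
      qed
      then show ?thesis using X(3) W(2) h'(1) by auto
    qed
    then show ?thesis using \<epsilon>(1) by auto
  qed
  then show ?R using W by auto
next
  assume R: ?R
  show ?L
  proof (subst openin_subopen, intro ballI)
    fix h assume h: "h \<in> U"
    then obtain \<epsilon> where \<epsilon>: "\<epsilon> > 0"
      "\<And>h'. h' \<in> vecs V \<Longrightarrow> (\<forall>v\<in>V. \<bar>h' v - h v\<bar> < \<epsilon>) \<Longrightarrow> h' \<in> U"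
      using R by meson
    define W where "W = (\<Inter>v\<in>V. (\<lambda>f. f v) -` ball (h v) \<epsilon>)"
    have "open W"
      unfolding W_def using fin
      by (intro open_INT open_vimage ballI) auto
    moreover have "h \<in> W" using \<epsilon>(1) by (auto simp: W_def)
    moreover have "vecs V \<inter> W \<subseteq> U"
      using \<epsilon>(2) by (auto simp: W_def dist_real_def abs_minus_commute)
    ultimately show "\<exists>T. rel_open V T \<and> h \<in> T \<and> T \<subseteq> U"
      using h R by (intro exI[of _ "vecs V \<inter> W"]) (auto intro: openin_open_Int)
  qed
qed

text \<open>The index type may be uncountable, so the Borel sets of the function space are out of reach of
  the product measure. The relatively open sets are in reach: they are countable unions of rational
  boxes.\<close>

lemma rel_open_sets:
  assumes fin: "finite V" and U: "rel_open V U"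
  shows "U \<in> sets (leb V)"
proof -
  define bx :: "('a \<Rightarrow> real) \<times> nat \<Rightarrow> ('a \<Rightarrow> real) set"
    where "bx = (\<lambda>(q, n). Pi\<^sub>E V (\<lambda>v. ball (q v) (1 / real (Suc n))))"
  define \<Q> where "\<Q> = {qn \<in> Pi\<^sub>E V (\<lambda>_. \<rat> :: real set) \<times> (UNIV :: nat set). bx qn \<subseteq> U}"
  have "countable (Pi\<^sub>E V (\<lambda>_. \<rat> :: real set) \<times> (UNIV :: nat set))"
    using fin by (intro countable_SIGMA countable_PiE) (auto simp: countable_rat)
  then have "countable \<Q>" unfolding \<Q>_def by (rule countable_subset[rotated]) auto
  moreover have "bx qn \<in> sets (leb V)" for qn
    unfolding bx_def by (cases qn) (use fin in \<open>auto intro!: sets_PiM_I_finite\<close>)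
  ultimately have "(\<Union>qn\<in>\<Q>. bx qn) \<in> sets (leb V)"
    by (intro sets.countable_UN'') auto
  moreover have "(\<Union>qn\<in>\<Q>. bx qn) = U"
  proof (intro equalityI subsetI)
    fix h assume h: "h \<in> U"
    then have hV: "h \<in> vecs V" using U rel_open_iff_box[OF fin] by blast
    obtain \<epsilon> where \<epsilon>: "\<epsilon> > 0" "\<And>h'. h' \<in> vecs V \<Longrightarrow> (\<forall>v\<in>V. \<bar>h' v - h v\<bar> < \<epsilon>) \<Longrightarrow> h' \<in> U"
      using U h rel_open_iff_box[OF fin] by meson
    obtain n where n: "1 / real (Suc n) < \<epsilon> / 2"
      using nat_approx_posE[of "\<epsilon> / 2"] \<epsilon>(1) by auto
    have "\<exists>r\<in>\<rat>. \<bar>r - h v\<bar> < 1 / real (Suc n)" for v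
    proof -
      have "h v < h v + 1 / real (Suc n)" by simp
      from Rats_dense_in_real[OF this] obtain r where "r \<in> \<rat>" "h v < r" "r < h v + 1 / real (Suc n)"
        by blast
      then show ?thesis by (intro bexI[of _ r]) auto
    qed
    then obtain r where r: "\<And>v. r v \<in> \<rat>" "\<And>v. \<bar>r v - h v\<bar> < 1 / real (Suc n)" by metis
    define q where "q = restrict r V"
    have "h \<in> bx (q, n)"
      using hV r(2) by (auto simp: bx_def q_def PiE_iff dist_real_def)
    moreover have "bx (q, n) \<subseteq> U"
    proof
      fix h' assume h': "h' \<in> bx (q, n)"
      have "\<bar>h' v - h v\<bar> < \<epsilon>" if v: "v \<in> V" for v
      proof -
        have "\<bar>r v - h' v\<bar> < 1 / real (Suc n)"
          using h' v by (auto simp: bx_def q_def PiE_iff dist_real_def)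
        then show ?thesis using r(2)[of v] n by linarith
      qed
      moreover have "h' \<in> vecs V" using h' by (auto simp: bx_def PiE_iff)
      ultimately show "h' \<in> U" using \<epsilon>(2) by auto
    qed
    ultimately show "h \<in> (\<Union>qn\<in>\<Q>. bx qn)"
      using r(1) by (intro UN_I[of "(q, n)"]) (auto simp: \<Q>_def q_def)
  qed (auto simp: \<Q>_def)
  ultimately show ?thesis by simp
qed

lemma continuous_on_rel_open_measurable:
  fixes f :: "('i \<Rightarrow> real) \<Rightarrow> real"
  assumes fin: "finite V" and U: "rel_open V U" and f: "continuous_on U f"
  shows "(\<lambda>h. indicator U h * f h) \<in> borel_measurable (leb V)"
proof -
  have "f \<in> borel_measurable (restrict_space (leb V) U)"
  proof (rule borel_measurableI)
    fix S :: "real set" assume "open S"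
    then have "openin (top_of_set U) (U \<inter> f -` S)"
      using f by (rule continuous_openin_preimage_gen[rotated])
    then have "rel_open V (U \<inter> f -` S)" using U openin_trans by blast
    then have "U \<inter> f -` S \<in> sets (leb V)" by (rule rel_open_sets[OF fin])
    moreover have "f -` S \<inter> space (restrict_space (leb V) U) = U \<inter> f -` S"
      using U openin_imp_subset by (fastforce simp: space_restrict_space)
    ultimately show "f -` S \<inter> space (restrict_space (leb V) U) \<in> sets (restrict_space (leb V) U)"
      using rel_open_sets[OF fin U] sets.sets_into_space[OF rel_open_sets[OF fin U]]
      by (subst sets_restrict_space_iff) (auto simp: Int_absorb1 Int_absorb2)
  qed
  then show ?thesis
    using rel_open_sets[OF fin U] sets.sets_into_space[OF rel_open_sets[OF fin U]]
    by (subst (asm) borel_measurable_restrict_space_iff)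
      (auto simp: scaleR_conv_of_real Int_absorb1 Int_absorb2 mult.commute)
qed

text \<open>Substitution for nonnegative functions whose integral may be infinite. It follows from the
  version for absolutely integrable functions, since the two sides are integrable together.\<close>

lemma nn_integral_change_of_variables_real:
  fixes \<tau> f :: "real \<Rightarrow> real"
  assumes \<Omega>: "\<Omega> \<in> sets borel"
    and der: "\<And>s. s \<in> \<Omega> \<Longrightarrow> (\<tau> has_field_derivative \<tau>' s) (at s within \<Omega>)"
    and inj: "inj_on \<tau> \<Omega>"
    and f: "\<And>s. s \<in> \<Omega> \<Longrightarrow> 0 \<le> f (\<tau> s)"
    and mf: "(\<lambda>t. indicator (\<tau> ` \<Omega>) t * f t) \<in> borel_measurable borel"
    and mg: "(\<lambda>s. indicator \<Omega> s * (\<bar>\<tau>' s\<bar> * f (\<tau> s))) \<in> borel_measurable borel"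
  shows "(\<integral>\<^sup>+ s. ennreal (indicator \<Omega> s * (\<bar>\<tau>' s\<bar> * f (\<tau> s))) \<partial>lborel)
       = (\<integral>\<^sup>+ t. ennreal (indicator (\<tau> ` \<Omega>) t * f t) \<partial>lborel)"
    (is "?L = ?R")
proof -
  have key: "g absolutely_integrable_on S \<longleftrightarrow> (\<integral>\<^sup>+ s. ennreal (indicator S s * g s) \<partial>lborel) < \<infinity>"
    "g absolutely_integrable_on S \<Longrightarrow>
       (\<integral>\<^sup>+ s. ennreal (indicator S s * g s) \<partial>lborel) = ennreal (integral S g)"
    if m: "(\<lambda>s. indicator S s * g s) \<in> borel_measurable borel" and nn: "\<And>s. s \<in> S \<Longrightarrow> 0 \<le> g s"
    for g :: "real \<Rightarrow> real" and S
  proof -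
    have nn': "0 \<le> indicator S s * g s" for s using nn by (auto simp: indicator_def)
    have eq: "g absolutely_integrable_on S \<longleftrightarrow> integrable lborel (\<lambda>s. indicator S s * g s)"
      using m by (simp add: set_integrable_def integrable_completion)
    also have "\<dots> \<longleftrightarrow> (\<integral>\<^sup>+ s. ennreal (indicator S s * g s) \<partial>lborel) < \<infinity>"
      using m nn' by (simp add: integrable_iff_bounded)
    finally show "g absolutely_integrable_on S \<longleftrightarrow> (\<integral>\<^sup>+ s. ennreal (indicator S s * g s) \<partial>lborel) < \<infinity>" .
    assume a: "g absolutely_integrable_on S"
    then have "integral S g = (LINT s:S|lebesgue. g s)"
      by (simp add: set_lebesgue_integral_eq_integral)
    also have "\<dots> = (LINT s|lborel. indicator S s * g s)"
      using m by (simp add: set_lebesgue_integral_def integral_completion)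
    finally show "(\<integral>\<^sup>+ s. ennreal (indicator S s * g s) \<partial>lborel) = ennreal (integral S g)"
      using a nn' unfolding eq by (simp add: nn_integral_eq_integral)
  qed
  let ?g = "\<lambda>s. \<bar>\<tau>' s\<bar> * f (\<tau> s)"
  note L = key[of \<Omega> ?g, OF mg] and R = key[of "\<tau> ` \<Omega>" f, OF mf]
  have "\<Omega> \<in> sets lebesgue" using \<Omega> by simp
  note cov = has_absolute_integral_change_of_variables_1'[OF this der inj, of f]
  show ?thesis
  proof (cases "f absolutely_integrable_on \<tau> ` \<Omega>")
    case True
    then have "?g absolutely_integrable_on \<Omega>" "integral \<Omega> ?g = integral (\<tau> ` \<Omega>) f"
      using cov by blast+
    moreover have "0 \<le> \<bar>\<tau>' s\<bar> * f (\<tau> s)" if "s \<in> \<Omega>" for s using f[OF that] by simp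
    moreover have "0 \<le> f t" if "t \<in> \<tau> ` \<Omega>" for t using f that by auto
    ultimately show ?thesis using L(2) R(2) True by simp
  next
    case False
    then have "\<not> ?g absolutely_integrable_on \<Omega>" using cov by blast
    moreover have "0 \<le> \<bar>\<tau>' s\<bar> * f (\<tau> s)" if "s \<in> \<Omega>" for s using f[OF that] by simp
    ultimately have "?L = \<infinity>" using L(1) by (simp flip: less_top)
    moreover have "0 \<le> f t" if "t \<in> \<tau> ` \<Omega>" for t using f that by auto
    then have "?R = \<infinity>" using R(1) False by (simp flip: less_top)
    ultimately show ?thesis by simp
  qed
qed

section \<open>Change of variables for maps with M-matrix secants\<close>

lemma continuous_on_fun_upd_coordinate:
  fixes y :: "'i \<Rightarrow> real"
  shows "continuous_on X (\<lambda>s. y(w := s))"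
proof (rule continuous_on_coordinatewise_then_product)
  show "continuous_on X (\<lambda>s. (y(w := s)) i)" for i
    by (cases "i = w") auto
qed

text \<open>Maps \<open>T\<close> whose secants, and not only derivatives, are M-matrices up to a scaling \<open>g\<close> of the rows.
  Since the secant matrix of any two points of the domain is nonsingular, such maps are globally
  injective. The sign condition says that each row scaling
  keeps its sign over the domain.\<close>

locale secant_map =
  fixes V :: "'i set" and U :: "('i \<Rightarrow> real) set"
    and T g :: "('i \<Rightarrow> real) \<Rightarrow> 'i \<Rightarrow> real"
    and A :: "('i \<Rightarrow> real) \<Rightarrow> ('i \<Rightarrow> real) \<Rightarrow> 'i \<Rightarrow> 'i \<Rightarrow> real"
  assumes fin: "finite V" and open_U: "rel_open V U"
    and secant: "\<And>h h' v. h \<in> U \<Longrightarrow> h' \<in> U \<Longrightarrow> v \<in> V \<Longrightarrow>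
      T h' v - T h v = g h' v * (\<Sum>u\<in>V. A h' h v u * (h' u - h u))"
    and M_matrix: "\<And>h h'. h \<in> U \<Longrightarrow> h' \<in> U \<Longrightarrow> strict_M_matrix V (A h' h)"
    and g_sign: "\<And>h h' v. h \<in> U \<Longrightarrow> h' \<in> U \<Longrightarrow> v \<in> V \<Longrightarrow> 0 < g h v * g h' v"
    and cont_g: "\<And>v. v \<in> V \<Longrightarrow> continuous_on U (\<lambda>h. g h v)"
    and cont_A: "\<And>h u v. h \<in> U \<Longrightarrow> v \<in> V \<Longrightarrow> u \<in> V \<Longrightarrow> continuous_on U (\<lambda>h'. A h' h v u)"
    and cont_diag: "\<And>u v. v \<in> V \<Longrightarrow> u \<in> V \<Longrightarrow> continuous_on U (\<lambda>h. A h h v u)"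
begin

text \<open>The intermediate coordinate systems: those coordinates in \<open>S\<close> are already replaced by the
  values of \<open>T\<close>.\<close>

definition mixed :: "'i set \<Rightarrow> ('i \<Rightarrow> real) \<Rightarrow> 'i \<Rightarrow> real" where
  "mixed S h = (\<lambda>v\<in>V. if v \<in> S then T h v else h v)"

definition unmixed :: "'i set \<Rightarrow> ('i \<Rightarrow> real) \<Rightarrow> 'i \<Rightarrow> real" where
  "unmixed S = inv_into U (mixed S)"

text \<open>The absolute Jacobian determinant of \<open>T\<close> in the coordinates \<open>us\<close>: the derivative is the row
  scaling times the secant matrix at coinciding points.\<close>

definition jac :: "'i list \<Rightarrow> ('i \<Rightarrow> real) \<Rightarrow> real" where
  "jac us h = (\<Prod>u\<leftarrow>us. \<bar>g h u\<bar>) * pivot_prod (A h h) us"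

lemma U_subset: "U \<subseteq> vecs V"
  using open_U openin_imp_subset by blast

lemma mixed_vecs [simp]: "mixed S h \<in> vecs V"
  by (auto simp: mixed_def)

lemma g_nonzero: "h \<in> U \<Longrightarrow> v \<in> V \<Longrightarrow> g h v \<noteq> 0"
  using g_sign[of h h v] by auto

lemma cont_T: "v \<in> V \<Longrightarrow> continuous_on U (\<lambda>h. T h v)"
proof (cases "U = {}")
  case False
  assume v: "v \<in> V"
  from False obtain h where h: "h \<in> U" by auto
  have "continuous_on U (\<lambda>h'. T h v + g h' v * (\<Sum>u\<in>V. A h' h v u * (h' u - h u)))"
    using cont_g[OF v] cont_A[OF h v]
    by (intro continuous_intros) (auto intro: continuous_on_subset[OF continuous_on_product_coordinates])
  then show ?thesis
    by (rule continuous_on_eq) (use secant[OF h _ v] in \<open>simp add: algebra_simps\<close>)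
qed simp

lemma mixed_inj:
  assumes us: "distinct us" "set us \<subseteq> V"
  shows "inj_on (mixed (set us)) U"
proof (rule inj_onI)
  fix h' h assume h: "h' \<in> U" "h \<in> U" and eq: "mixed (set us) h' = mixed (set us) h"
  have eqv: "(if v \<in> set us then T h' v = T h v else h' v = h v)" if "v \<in> V" for v
    using fun_cong[OF eq, of v] that by (auto simp: mixed_def)
  have "h' v - h v = 0" if v: "v \<in> V" for v
  proof (rule strict_M_matrix_kernel[OF fin M_matrix[OF h(2,1)] us])
    fix u assume u: "u \<in> set us"
    then have "g h' u * (\<Sum>b\<in>V. A h' h u b * (h' b - h b)) = 0"
      using secant[OF h(2,1), of u] eqv[of u] us by auto
    then show "(\<Sum>b\<in>V. A h' h u b * (h' b - h b)) = 0"
      using g_nonzero[OF h(1)] u us by auto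
  qed (use eqv v in auto)
  then show "h' = h"
    using h U_subset by (intro extensionalityI[of _ V]) (auto simp: PiE_def)
qed

lemma unmixed_mixed:
  "distinct us \<Longrightarrow> set us \<subseteq> V \<Longrightarrow> h \<in> U \<Longrightarrow> unmixed (set us) (mixed (set us) h) = h"
  by (simp add: unmixed_def mixed_inj inv_into_f_f)

lemma mixed_unmixed: "z \<in> mixed S ` U \<Longrightarrow> mixed S (unmixed S z) = z"
  by (simp add: unmixed_def f_inv_into_f)

lemma unmixed_in: "z \<in> mixed S ` U \<Longrightarrow> unmixed S z \<in> U"
  by (simp add: unmixed_def inv_into_into)

text \<open>Between two points that differ in only one not yet replaced coordinate \<open>w\<close>, the map \<open>T\<close> has an
  exact difference quotient in direction \<open>w\<close>. Its limit is the derivative needed for the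
  substitution, although the potentials depend on \<open>w\<close> only implicitly.\<close>

lemma secant_along:
  assumes us: "distinct us" "set us \<subseteq> V" and w: "w \<in> V - set us"
    and z: "z \<in> mixed (set us) ` U" "z' \<in> mixed (set us) ` U"
    and diff: "\<And>u. u \<in> V - {w} \<Longrightarrow> z' u = z u"
  defines "h \<equiv> unmixed (set us) z" and "h' \<equiv> unmixed (set us) z'"
  shows "T h' w - T h w = g h' w * schur_complement (A h' h) us w w * (z' w - z w)"
proof -
  have hU: "h \<in> U" "h' \<in> U" using z by (auto simp: h_def h'_def unmixed_in)
  have hz: "mixed (set us) h = z" "mixed (set us) h' = z'"
    using z by (auto simp: h_def h'_def mixed_unmixed)
  have zv: "z v = (if v \<in> set us then T h v else h v)"
    "z' v = (if v \<in> set us then T h' v else h' v)" if "v \<in> V" for v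
    using that by (auto simp: hz[symmetric] mixed_def)
  have "(\<Sum>b\<in>V. A h' h w b * (h' b - h b)) = schur_complement (A h' h) us w w * (h' w - h w)"
  proof (rule schur_complement_pivot[OF fin M_matrix[OF hU] us w])
    fix u assume u: "u \<in> set us"
    then have uV: "u \<in> V" "u \<noteq> w" using us w by auto
    have "T h' u = T h u" using diff[of u] zv[of u] u uV by simp
    then have "g h' u * (\<Sum>b\<in>V. A h' h u b * (h' b - h b)) = 0"
      using secant[OF hU uV(1)] by simp
    then show "(\<Sum>b\<in>V. A h' h u b * (h' b - h b)) = 0"
      using g_nonzero[OF hU(2) uV(1)] by simp
  next
    fix u assume u: "u \<in> V - insert w (set us)"
    then show "h' u - h u = 0" using diff[of u] zv[of u] by simp
  qed
  then show ?thesis using secant[OF hU, of w] zv[of w] w by simp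
qed

lemma continuous_on_unmixed:
  fixes f :: "('i \<Rightarrow> real) \<Rightarrow> real"
  assumes us: "distinct us" "set us \<subseteq> V"
    and op: "\<And>W. rel_open V W \<Longrightarrow> W \<subseteq> U \<Longrightarrow> rel_open V (mixed (set us) ` W)"
    and f: "continuous_on U f"
  shows "continuous_on (mixed (set us) ` U) (\<lambda>z. f (unmixed (set us) z))"
  unfolding continuous_openin_preimage_eq
proof (intro allI impI)
  fix B :: "real set" assume "open B"
  then have "openin (top_of_set U) (U \<inter> f -` B)"
    using f by (rule continuous_openin_preimage_gen[rotated])
  then have "rel_open V (U \<inter> f -` B)" using open_U openin_trans by blast
  from op[OF this] have "rel_open V (mixed (set us) ` (U \<inter> f -` B))" by auto
  moreover have "mixed (set us) ` (U \<inter> f -` B)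
      = mixed (set us) ` U \<inter> (\<lambda>z. f (unmixed (set us) z)) -` B"
    using unmixed_mixed[OF us] by force
  ultimately show "openin (top_of_set (mixed (set us) ` U))
      (mixed (set us) ` U \<inter> (\<lambda>z. f (unmixed (set us) z)) -` B)"
    by (metis mixed_vecs image_subsetI inf_le1 openin_subset_trans)
qed

text \<open>By \<open>secant_along\<close>, the value of \<open>T\<close> at \<open>w\<close> is strictly monotone in the coordinate \<open>w\<close> if the other
  mixed coordinates are kept. So it lies strictly on both sides of its value at the given point for
  two nearby arguments, this persists under small changes of the other coordinates, and the
  intermediate value theorem solves for the coordinate \<open>w\<close>.\<close>

lemma mixed_open_step:
  assumes us: "distinct us" "set us \<subseteq> V" and w: "w \<in> V - set us"
    and op: "\<And>W. rel_open V W \<Longrightarrow> W \<subseteq> U \<Longrightarrow> rel_open V (mixed (set us) ` W)"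
    and W: "rel_open V W" "W \<subseteq> U"
  shows "rel_open V (mixed (insert w (set us)) ` W)"
  unfolding rel_open_iff_box[OF fin]
proof (intro conjI ballI)
  let ?S = "set us" and ?S' = "insert w (set us)"
  let ?\<tau> = "\<lambda>z. T (unmixed ?S z) w"
  show "mixed ?S' ` W \<subseteq> vecs V" by (rule image_subsetI) (rule mixed_vecs)
  fix z0 assume "z0 \<in> mixed ?S' ` W"
  then obtain h0 where h0: "h0 \<in> W" "z0 = mixed ?S' h0" by auto
  define y0 where "y0 = mixed ?S h0"
  have wV: "w \<in> V" "w \<notin> ?S" using w by auto
  have y0: "y0 \<in> mixed ?S ` W" "unmixed ?S y0 = h0"
    using h0 W(2) unmixed_mixed[OF us] by (auto simp: y0_def)
  have y0z0: "y0 u = z0 u" if "u \<in> V - {w}" for u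
    using that by (auto simp: y0_def h0 mixed_def)
  have z0w: "z0 w = T h0 w" using wV by (simp add: h0 mixed_def)
  have sub: "mixed ?S ` W \<subseteq> mixed ?S ` U" using W(2) by auto
  obtain \<epsilon> where \<epsilon>: "\<epsilon> > 0"
    "\<And>z. z \<in> vecs V \<Longrightarrow> (\<forall>v\<in>V. \<bar>z v - y0 v\<bar> < \<epsilon>) \<Longrightarrow> z \<in> mixed ?S ` W"
    using op[OF W] y0(1) unfolding rel_open_iff_box[OF fin] by meson
  define p where "p s = y0(w := s)" for s
  have pin: "p s \<in> mixed ?S ` W" if "\<bar>s - y0 w\<bar> < \<epsilon>" for s
    using that \<epsilon>(1) wV by (intro \<epsilon>(2)) (auto simp: p_def y0_def PiE_iff extensional_def mixed_def)
  have cont: "continuous_on (mixed ?S ` U) ?\<tau>"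
    by (rule continuous_on_unmixed[OF us op cont_T[OF wV(1)]])
  define a b where "a = y0 w - \<epsilon> / 2" and "b = y0 w + \<epsilon> / 2"
  have ab: "a < b" "a < y0 w" "y0 w < b" "p a \<in> mixed ?S ` W" "p b \<in> mixed ?S ` W"
    using \<epsilon>(1) by (auto simp: a_def b_def intro!: pin)
  have along: "\<exists>\<kappa>>0. ?\<tau> (p s) - z0 w = g (unmixed ?S (p s)) w * \<kappa> * (s - y0 w)"
    if s: "p s \<in> mixed ?S ` W" for s
  proof -
    have "?\<tau> (p s) - ?\<tau> y0 = g (unmixed ?S (p s)) w
        * schur_complement (A (unmixed ?S (p s)) (unmixed ?S y0)) us w w * (p s w - y0 w)"
      using y0(1) sub s by (intro secant_along[OF us w]) (auto simp: p_def)
    moreover have "0 < schur_complement (A (unmixed ?S (p s)) (unmixed ?S y0)) us w w"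
      using s sub y0(1) by (intro schur_complement_pivot_pos[OF fin M_matrix us w] unmixed_in) auto
    ultimately show ?thesis by (auto simp: z0w y0(2) p_def)
  qed
  define \<tau>a \<tau>b where "\<tau>a = ?\<tau> (p a)" and "\<tau>b = ?\<tau> (p b)"
  have opposite: "(\<tau>a - z0 w) * (\<tau>b - z0 w) < 0"
  proof -
    obtain \<kappa>a where \<kappa>a: "\<kappa>a > 0" "\<tau>a - z0 w = g (unmixed ?S (p a)) w * \<kappa>a * (a - y0 w)"
      using along[OF ab(4)] unfolding \<tau>a_def by blast
    obtain \<kappa>b where \<kappa>b: "\<kappa>b > 0" "\<tau>b - z0 w = g (unmixed ?S (p b)) w * \<kappa>b * (b - y0 w)"
      using along[OF ab(5)] unfolding \<tau>b_def by blast
    have "0 < g (unmixed ?S (p a)) w * g (unmixed ?S (p b)) w"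
      using ab sub by (intro g_sign unmixed_in wV(1)) auto
    then have "0 < (g (unmixed ?S (p a)) w * g (unmixed ?S (p b)) w) * (\<kappa>a * \<kappa>b) * ((y0 w - a) * (b - y0 w))"
      using \<kappa>a(1) \<kappa>b(1) ab(2,3)
      by (intro mult_pos_pos[of "_ * _" "_ * (_ :: real)"] mult_pos_pos[of "_ * _" "(_ - _) * (_ - _)"]
          mult_pos_pos[of \<kappa>a] mult_pos_pos[of "y0 w - a"]) auto
    moreover have "(\<tau>a - z0 w) * (\<tau>b - z0 w) =
        - ((g (unmixed ?S (p a)) w * g (unmixed ?S (p b)) w) * (\<kappa>a * \<kappa>b) * ((y0 w - a) * (b - y0 w)))"
      unfolding \<kappa>a(2) \<kappa>b(2) by (simp add: algebra_simps)
    ultimately show ?thesis by linarith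
  qed
  \<comment> \<open>Half the distance to both bracketing values: an \<open>\<eta>\<close>-change of the bracketing values and of the target keeps the target between them.\<close>
  define \<eta> where "\<eta> = min \<bar>\<tau>a - z0 w\<bar> \<bar>\<tau>b - z0 w\<bar> / 2"
  have \<eta>: "\<eta> > 0" using opposite by (auto simp: \<eta>_def)
  have near: "\<exists>\<epsilon>'>0. \<forall>z\<in>vecs V. (\<forall>v\<in>V. \<bar>z v - p s v\<bar> < \<epsilon>') \<longrightarrow> \<bar>?\<tau> z - ?\<tau> (p s)\<bar> < \<eta>"
    if s: "p s \<in> mixed ?S ` W" for s
  proof -
    let ?B = "mixed ?S ` U \<inter> ?\<tau> -` ball (?\<tau> (p s)) \<eta>"
    have "openin (top_of_set (mixed ?S ` U)) ?B"
      using cont by (rule continuous_openin_preimage_gen) simp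
    then have "rel_open V ?B" using op[OF open_U] openin_trans by blast
    moreover have "p s \<in> ?B" using s sub \<eta> by auto
    ultimately obtain \<epsilon>' where "\<epsilon>' > 0"
      "\<And>z. z \<in> vecs V \<Longrightarrow> (\<forall>v\<in>V. \<bar>z v - p s v\<bar> < \<epsilon>') \<Longrightarrow> z \<in> ?B"
      unfolding rel_open_iff_box[OF fin] by meson
    then show ?thesis by (intro exI[of _ \<epsilon>']) (auto simp: dist_real_def abs_minus_commute)
  qed
  obtain \<epsilon>a where \<epsilon>a: "\<epsilon>a > 0"
    "\<And>z. z \<in> vecs V \<Longrightarrow> (\<forall>v\<in>V. \<bar>z v - p a v\<bar> < \<epsilon>a) \<Longrightarrow> \<bar>?\<tau> z - \<tau>a\<bar> < \<eta>"
    using near[OF ab(4)] unfolding \<tau>a_def by meson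
  obtain \<epsilon>b where \<epsilon>b: "\<epsilon>b > 0"
    "\<And>z. z \<in> vecs V \<Longrightarrow> (\<forall>v\<in>V. \<bar>z v - p b v\<bar> < \<epsilon>b) \<Longrightarrow> \<bar>?\<tau> z - \<tau>b\<bar> < \<eta>"
    using near[OF ab(5)] unfolding \<tau>b_def by meson
  define \<epsilon>' where "\<epsilon>' = Min {\<epsilon>, \<epsilon>a, \<epsilon>b, \<eta>}"
  have \<epsilon>': "\<epsilon>' > 0" "\<epsilon>' \<le> \<epsilon>" "\<epsilon>' \<le> \<epsilon>a" "\<epsilon>' \<le> \<epsilon>b" "\<epsilon>' \<le> \<eta>"
    using \<epsilon>(1) \<epsilon>a(1) \<epsilon>b(1) \<eta> by (auto simp: \<epsilon>'_def)
  show "\<exists>\<epsilon>>0. \<forall>h'\<in>vecs V. (\<forall>v\<in>V. \<bar>h' v - z0 v\<bar> < \<epsilon>) \<longrightarrow> h' \<in> mixed ?S' ` W"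
  proof (intro exI[of _ \<epsilon>'] conjI ballI impI \<epsilon>'(1))
    fix z1 assume z1: "z1 \<in> vecs V" "\<forall>v\<in>V. \<bar>z1 v - z0 v\<bar> < \<epsilon>'"
    define z where "z s = z1(w := s)" for s
    have zV: "z s \<in> vecs V" for s using z1(1) wV by (auto simp: z_def PiE_iff extensional_def)
    have close: "\<bar>z1 u - y0 u\<bar> < \<epsilon>'" if "u \<in> V" "u \<noteq> w" for u
      using z1(2) y0z0[of u] that by auto
    have zin: "z s \<in> mixed ?S ` W" if "s \<in> {a..b}" for s
    proof (rule \<epsilon>(2)[OF zV], intro ballI)
      fix v assume v: "v \<in> V"
      show "\<bar>z s v - y0 v\<bar> < \<epsilon>"
      proof (cases "v = w")
        case True
        then show ?thesis using that \<epsilon>(1) by (auto simp: z_def a_def b_def abs_if field_simps)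
      next
        case False
        then show ?thesis using close[OF v False] \<epsilon>' by (simp add: z_def)
      qed
    qed
    have "\<bar>?\<tau> (z a) - \<tau>a\<bar> < \<eta>"
      using close \<epsilon>' \<epsilon>a(1) by (intro \<epsilon>a(2)[OF zV]) (force simp: z_def p_def)
    moreover have "\<bar>?\<tau> (z b) - \<tau>b\<bar> < \<eta>"
      using close \<epsilon>' \<epsilon>b(1) by (intro \<epsilon>b(2)[OF zV]) (force simp: z_def p_def)
    moreover have "\<bar>z1 w - z0 w\<bar> < \<eta>" using z1(2) wV \<epsilon>' by force
    moreover have "2 * \<eta> \<le> \<bar>\<tau>a - z0 w\<bar>" "2 * \<eta> \<le> \<bar>\<tau>b - z0 w\<bar>" by (auto simp: \<eta>_def)
    ultimately have between:
      "?\<tau> (z a) \<le> z1 w \<and> z1 w \<le> ?\<tau> (z b) \<or> ?\<tau> (z b) \<le> z1 w \<and> z1 w \<le> ?\<tau> (z a)"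
      using opposite by (smt (verit, best) mult_nonneg_nonneg mult_nonpos_nonpos)
    have "continuous_on {a..b} (\<lambda>s. ?\<tau> (z s))"
    proof (rule continuous_on_compose2[OF cont])
      show "continuous_on {a..b} z"
        unfolding z_def by (rule continuous_on_fun_upd_coordinate)
    qed (use zin sub in auto)
    then obtain s where s: "a \<le> s" "s \<le> b" "?\<tau> (z s) = z1 w"
      using between ab(1) IVT'[of "\<lambda>s. ?\<tau> (z s)" a "z1 w" b] IVT2'[of "\<lambda>s. ?\<tau> (z s)" b "z1 w" a]
      by auto
    obtain h where h: "h \<in> W" "mixed ?S h = z s" using zin[of s] s by auto
    have hs: "unmixed ?S (z s) = h" using unmixed_mixed[OF us, of h] h W(2) by auto
    have "mixed ?S' h = z1"
    proof (rule extensionalityI[of _ V])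
      fix v assume v: "v \<in> V"
      show "mixed ?S' h v = z1 v"
        using fun_cong[OF h(2), of v] s(3) v wV hs by (auto simp: mixed_def z_def split: if_splits)
    qed (use z1 in \<open>auto simp: mixed_def PiE_def\<close>)
    then show "z1 \<in> mixed ?S' ` W" using h(1) by auto
  qed
qed

lemma mixed_open:
  assumes "distinct us" "set us \<subseteq> V" "rel_open V W" "W \<subseteq> U"
  shows "rel_open V (mixed (set us) ` W)"
  using assms
proof (induction us arbitrary: W rule: rev_induct)
  case Nil
  have "mixed (set []) h = h" if "h \<in> W" for h
    using that Nil(4) U_subset by (auto simp: mixed_def PiE_def extensional_def fun_eq_iff)
  then show ?case using Nil by simp
next
  case (snoc w us)
  have "rel_open V (mixed (insert w (set us)) ` W)"
    by (rule mixed_open_step) (use snoc in auto)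
  then show ?case by simp
qed

lemma measurable_unmixed:
  assumes us: "distinct us" "set us \<subseteq> V"
    and G: "(\<lambda>h. indicator U h * G h) \<in> borel_measurable (leb V)"
  shows "(\<lambda>z. indicator (mixed (set us) ` U) z * G (unmixed (set us) z) :: real) \<in> borel_measurable (leb V)"
proof (cases "U = {}")
  case False
  then obtain h0 where h0: "h0 \<in> U" by auto
  let ?D = "mixed (set us) ` U"
  have open_D: "rel_open V ?D" using us open_U by (intro mixed_open) auto
  \<comment> \<open>Extended by the constant \<open>h0\<close> outside the image, the inverse becomes a total measurable map into \<open>U\<close>.\<close>
  define \<sigma> where "\<sigma> z = (if z \<in> ?D then unmixed (set us) z else h0)" for z
  have \<sigma>U: "\<sigma> z \<in> U" for z using h0 by (auto simp: \<sigma>_def unmixed_in)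
  have "(\<lambda>z v. \<sigma> z v) \<in> measurable (leb V) (leb V)"
  proof (rule measurable_PiM_single')
    fix v assume "v \<in> V"
    have "continuous_on ?D (\<lambda>z. unmixed (set us) z v)"
      by (rule continuous_on_unmixed[OF us mixed_open[OF us]])
        (auto intro: continuous_on_subset[OF continuous_on_product_coordinates])
    from continuous_on_rel_open_measurable[OF fin open_D this] rel_open_sets[OF fin open_D]
    have "(\<lambda>z. indicator ?D z * unmixed (set us) z v + (1 - indicator ?D z) * h0 v)
        \<in> borel_measurable (leb V)" by simp
    moreover have "(\<lambda>z. indicator ?D z * unmixed (set us) z v + (1 - indicator ?D z) * h0 v)
        = (\<lambda>z. \<sigma> z v)"
      by (auto simp: \<sigma>_def fun_eq_iff)
    ultimately show "(\<lambda>z. \<sigma> z v) \<in> measurable (leb V) lborel" by simp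
  qed (use \<sigma>U U_subset in auto)
  from measurable_compose[OF this G] rel_open_sets[OF fin open_D]
  have "(\<lambda>z. indicator ?D z * (indicator U (\<sigma> z) * G (\<sigma> z))) \<in> borel_measurable (leb V)"
    by simp
  moreover have "(\<lambda>z. indicator ?D z * (indicator U (\<sigma> z) * G (\<sigma> z)))
      = (\<lambda>z. indicator ?D z * G (unmixed (set us) z))"
    using \<sigma>U by (auto simp: \<sigma>_def fun_eq_iff indicator_def)
  ultimately show ?thesis by simp
qed simp

text \<open>Induction on the replaced coordinates: to replace \<open>w\<close>, integrate over \<open>w\<close> innermost and apply
  the one-dimensional substitution, whose derivative is the next pivot times the row scaling.\<close>

lemma change_of_variables_mixed:
  assumes "distinct us" "set us \<subseteq> V"
    and "(\<lambda>h. indicator U h * G h) \<in> borel_measurable (leb V)"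
    and "\<And>h. h \<in> U \<Longrightarrow> 0 \<le> G h"
  shows "(\<integral>\<^sup>+ h. ennreal (indicator U h * (G h * jac us h)) \<partial>leb V)
       = (\<integral>\<^sup>+ z. ennreal (indicator (mixed (set us) ` U) z * G (unmixed (set us) z)) \<partial>leb V)"
  using assms
proof (induction us arbitrary: G rule: rev_induct)
  case Nil
  have h: "mixed {} h = h" if "h \<in> U" for h
    using that U_subset by (auto simp: mixed_def PiE_def extensional_def fun_eq_iff)
  then have "mixed {} ` U = U" by simp
  moreover have "unmixed {} h = h" if "h \<in> U" for h
    using unmixed_mixed[of "[]" h] h[OF that] that by simp
  ultimately show ?case
    by (intro nn_integral_cong) (auto simp: jac_def indicator_def)
next
  case (snoc w us)
  let ?S = "set us" and ?S' = "insert w (set us)"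
  let ?D = "mixed ?S ` U" and ?D' = "mixed ?S' ` U"
  let ?V = "V - {w}"
  have us: "distinct us" "set us \<subseteq> V" and w: "w \<in> V - set us" and wV: "w \<in> V" "w \<notin> ?S"
    and us': "distinct (us @ [w])" "set (us @ [w]) \<subseteq> V"
    using snoc.prems by auto
  have S': "set (us @ [w]) = ?S'" by simp
  note hu' = unmixed_mixed[OF us', unfolded S']
  have VE: "V = insert w ?V" using wV by auto
  define \<kappa> where "\<kappa> h = \<bar>g h w\<bar> * schur_complement (A h h) us w w" for h
  define G' where "G' h = G h * \<kappa> h" for h
  have \<kappa>_pos: "0 < schur_complement (A h' h) us w w" if "h \<in> U" "h' \<in> U" for h h'
    using schur_complement_pivot_pos[OF fin M_matrix[OF that] us w] .
  have "continuous_on U \<kappa>"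
    unfolding \<kappa>_def using w us cont_g cont_diag M_matrix
    by (intro continuous_intros continuous_on_schur_complement[OF fin]) auto
  from borel_measurable_times[OF snoc.prems(3) continuous_on_rel_open_measurable[OF fin open_U this]]
  have "(\<lambda>h. (indicator U h * G h) * (indicator U h * \<kappa> h)) \<in> borel_measurable (leb V)" .
  moreover have "(\<lambda>h. (indicator U h * G h) * (indicator U h * \<kappa> h)) = (\<lambda>h. indicator U h * G' h)"
    by (auto simp: indicator_def G'_def)
  ultimately have G'm: "(\<lambda>h. indicator U h * G' h) \<in> borel_measurable (leb V)" by simp
  have G'nn: "0 \<le> G' h" if "h \<in> U" for h
    using snoc.prems(4)[OF that] \<kappa>_pos[OF that that] by (simp add: G'_def \<kappa>_def)
  have "(\<integral>\<^sup>+ h. ennreal (indicator U h * (G h * jac (us @ [w]) h)) \<partial>leb V)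
      = (\<integral>\<^sup>+ h. ennreal (indicator U h * (G' h * jac us h)) \<partial>leb V)"
    by (simp add: jac_def G'_def \<kappa>_def pivot_prod_snoc mult_ac)
  also have "\<dots> = (\<integral>\<^sup>+ z. ennreal (indicator ?D z * G' (unmixed ?S z)) \<partial>leb V)"
    by (rule snoc.IH[OF us G'm G'nn])
  also have "\<dots> = (\<integral>\<^sup>+ y. (\<integral>\<^sup>+ s. ennreal (indicator ?D (y(w := s)) * G' (unmixed ?S (y(w := s))))
      \<partial>lborel) \<partial>leb ?V)"
    using lborel_product.product_nn_integral_insert[of ?V w
        "\<lambda>z. ennreal (indicator ?D z * G' (unmixed ?S z))"]
      measurable_unmixed[OF us G'm] fin VE[symmetric] by simp
  also have "\<dots> = (\<integral>\<^sup>+ y. (\<integral>\<^sup>+ t. ennreal (indicator ?D' (y(w := t)) * G (unmixed ?S' (y(w := t))))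
      \<partial>lborel) \<partial>leb ?V)"
  proof (rule nn_integral_cong)
    fix y assume "y \<in> space (leb ?V)"
    then have y: "y \<in> vecs ?V" by simp
    have upd: "(\<lambda>s. y(w := s)) \<in> measurable borel (leb V)"
    proof -
      have "(\<lambda>s. y(w := s)) \<in> measurable lborel (leb (insert w ?V))"
        by (rule measurable_component_update) (use y in auto)
      then show ?thesis using VE by simp
    qed
    define \<Omega> where "\<Omega> = {s. y(w := s) \<in> ?D}"
    define \<tau> where "\<tau> s = T (unmixed ?S (y(w := s))) w" for s
    define \<tau>' where "\<tau>' s = (let h = unmixed ?S (y(w := s)) in g h w * schur_complement (A h h) us w w)" for s
    define f where "f t = G (unmixed ?S' (y(w := t)))" for t
    have solve: "mixed ?S' (unmixed ?S (y(w := s))) = y(w := \<tau> s)" "unmixed ?S' (y(w := \<tau> s)) = unmixed ?S (y(w := s))"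
      if s: "s \<in> \<Omega>" for s
    proof -
      have D: "y(w := s) \<in> ?D" using s by (simp add: \<Omega>_def)
      note e = mixed_unmixed[OF D]
      show 1: "mixed ?S' (unmixed ?S (y(w := s))) = y(w := \<tau> s)"
      proof (rule extensionalityI[of _ V])
        fix v assume v: "v \<in> V"
        show "mixed ?S' (unmixed ?S (y(w := s))) v = (y(w := \<tau> s)) v"
          using fun_cong[OF e, of v] v wV by (auto simp: mixed_def \<tau>_def split: if_splits)
      qed (use y wV in \<open>auto simp: mixed_def PiE_def extensional_def\<close>)
      show "unmixed ?S' (y(w := \<tau> s)) = unmixed ?S (y(w := s))"
        using hu'[OF unmixed_in[OF D]] 1 by simp
    qed
    have img: "\<tau> ` \<Omega> = {t. y(w := t) \<in> ?D'}"
    proof (intro equalityI subsetI)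
      fix t assume "t \<in> \<tau> ` \<Omega>"
      then obtain s where s: "s \<in> \<Omega>" "t = \<tau> s" by auto
      have "mixed ?S' (unmixed ?S (y(w := s))) \<in> ?D'" using s(1) by (auto simp: \<Omega>_def unmixed_in)
      then show "t \<in> {t. y(w := t) \<in> ?D'}" using solve(1)[OF s(1)] s(2) by simp
    next
      fix t assume "t \<in> {t. y(w := t) \<in> ?D'}"
      then obtain h where h: "h \<in> U" "mixed ?S' h = y(w := t)" by force
      have e: "mixed ?S h = y(w := h w)"
      proof (rule extensionalityI[of _ V])
        fix v assume v: "v \<in> V"
        show "mixed ?S h v = (y(w := h w)) v"
          using fun_cong[OF h(2), of v] v wV by (auto simp: mixed_def split: if_splits)
      qed (use y wV in \<open>auto simp: mixed_def PiE_def extensional_def\<close>)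
      have "h w \<in> \<Omega>" using h(1) e by (auto simp: \<Omega>_def intro!: image_eqI[of _ _ h])
      moreover have "\<tau> (h w) = t"
        using unmixed_mixed[OF us h(1), unfolded e] fun_cong[OF h(2), of w] wV
        by (simp add: \<tau>_def mixed_def)
      ultimately show "t \<in> \<tau> ` \<Omega>" by auto
    qed
    \<comment> \<open>The difference quotient of \<open>\<tau>\<close> between \<open>s\<close> and \<open>s'\<close>, continuous also for \<open>s = s'\<close>, where it is the derivative.\<close>
    define Q where "Q s s' = (let h = unmixed ?S (y(w := s)); h' = unmixed ?S (y(w := s'))
        in g h' w * schur_complement (A h' h) us w w)" for s s'
    have incr: "\<tau> s' - \<tau> s = Q s s' * (s' - s)" if "s \<in> \<Omega>" "s' \<in> \<Omega>" for s s'
      using secant_along[OF us w, of "y(w := s)" "y(w := s')"] that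
      by (simp add: \<tau>_def Q_def \<Omega>_def Let_def)
    have Qnz: "Q s s' \<noteq> 0" if "s \<in> \<Omega>" "s' \<in> \<Omega>" for s s'
    proof -
      have "unmixed ?S (y(w := s)) \<in> U" "unmixed ?S (y(w := s')) \<in> U"
        using that by (auto simp: \<Omega>_def unmixed_in)
      then show ?thesis using \<kappa>_pos g_nonzero wV unfolding Q_def Let_def
        by (metis mult_eq_0_iff less_irrefl)
    qed
    have "(\<integral>\<^sup>+ s. ennreal (indicator \<Omega> s * (\<bar>\<tau>' s\<bar> * f (\<tau> s))) \<partial>lborel)
        = (\<integral>\<^sup>+ t. ennreal (indicator (\<tau> ` \<Omega>) t * f t) \<partial>lborel)"
    proof (rule nn_integral_change_of_variables_real)
      have "?D \<in> sets (leb V)" using us open_U fin by (intro rel_open_sets mixed_open) auto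
      from measurable_sets[OF upd this] show \<Omega>b: "\<Omega> \<in> sets borel"
        by (simp add: \<Omega>_def vimage_def)
      show "(\<tau> has_field_derivative \<tau>' s) (at s within \<Omega>)" if s: "s \<in> \<Omega>" for s
      proof -
        have hU: "unmixed ?S (y(w := s)) \<in> U" using s by (auto simp: \<Omega>_def unmixed_in)
        have "continuous_on U (\<lambda>h'. g h' w * schur_complement (A h' (unmixed ?S (y(w := s)))) us w w)"
          using w us cont_g cont_A[OF hU] M_matrix[OF hU]
          by (intro continuous_intros continuous_on_schur_complement[OF fin]) auto
        from continuous_on_unmixed[OF us mixed_open[OF us] this]
        have "continuous_on ?D (\<lambda>z. g (unmixed ?S z) w
            * schur_complement (A (unmixed ?S z) (unmixed ?S (y(w := s)))) us w w)" by simp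
        then have "continuous_on \<Omega> (Q s)"
          unfolding Q_def Let_def
        proof (rule continuous_on_compose2)
          show "continuous_on \<Omega> (\<lambda>s. y(w := s))"
            by (rule continuous_on_fun_upd_coordinate)
        qed (auto simp: \<Omega>_def)
        then have "(Q s \<longlongrightarrow> Q s s) (at s within \<Omega>)"
          using s by (auto simp: continuous_on_def)
        then have "((\<lambda>s'. (\<tau> s' - \<tau> s) / (s' - s)) \<longlongrightarrow> Q s s) (at s within \<Omega>)"
          by (rule Lim_transform_eventually)
            (auto simp: eventually_at_filter incr[OF s])
        then show ?thesis
          by (simp add: has_field_derivative_iff Q_def \<tau>'_def)
      qed
      show "inj_on \<tau> \<Omega>"
        using incr Qnz by (intro inj_onI) (metis eq_iff_diff_eq_0 mult_eq_0_iff)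
      show "0 \<le> f (\<tau> s)" if s: "s \<in> \<Omega>" for s
        using solve(2)[OF s] snoc.prems(4) unmixed_in s by (simp add: f_def \<Omega>_def)
      have "(\<lambda>t. indicator ?D' (y(w := t)) * G (unmixed ?S' (y(w := t)))) \<in> borel_measurable borel"
        using measurable_compose[OF upd measurable_unmixed[OF us' snoc.prems(3)]] by simp
      moreover have "indicator ?D' (y(w := t)) = (indicator (\<tau> ` \<Omega>) t :: real)" for t
        unfolding img by (simp add: indicator_def)
      ultimately show "(\<lambda>t. indicator (\<tau> ` \<Omega>) t * f t) \<in> borel_measurable borel"
        by (simp add: f_def)
      have "(\<lambda>s. indicator ?D (y(w := s)) * G' (unmixed ?S (y(w := s)))) \<in> borel_measurable borel"
        using measurable_compose[OF upd measurable_unmixed[OF us G'm]] by simp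
      moreover have "indicator ?D (y(w := s)) * G' (unmixed ?S (y(w := s)))
          = indicator \<Omega> s * (\<bar>\<tau>' s\<bar> * f (\<tau> s))" for s
        using \<kappa>_pos[of "unmixed ?S (y(w := s))" "unmixed ?S (y(w := s))"] unmixed_in[of "y(w := s)" ?S] solve(2)[of s]
        by (auto simp: \<Omega>_def indicator_def G'_def \<kappa>_def \<tau>'_def f_def Let_def abs_mult abs_of_pos)
      ultimately show "(\<lambda>s. indicator \<Omega> s * (\<bar>\<tau>' s\<bar> * f (\<tau> s))) \<in> borel_measurable borel"
        by simp
    qed
    moreover have "indicator ?D (y(w := s)) * G' (unmixed ?S (y(w := s)))
          = indicator \<Omega> s * (\<bar>\<tau>' s\<bar> * f (\<tau> s))" for s
      using \<kappa>_pos[of "unmixed ?S (y(w := s))" "unmixed ?S (y(w := s))"] unmixed_in[of "y(w := s)" ?S] solve(2)[of s]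
      by (auto simp: \<Omega>_def indicator_def G'_def \<kappa>_def \<tau>'_def f_def Let_def abs_mult abs_of_pos)
    moreover have "indicator ?D' (y(w := t)) = (indicator (\<tau> ` \<Omega>) t :: real)" for t
      unfolding img by (simp add: indicator_def)
    ultimately show "(\<integral>\<^sup>+ s. ennreal (indicator ?D (y(w := s)) * G' (unmixed ?S (y(w := s)))) \<partial>lborel)
        = (\<integral>\<^sup>+ t. ennreal (indicator ?D' (y(w := t)) * G (unmixed ?S' (y(w := t)))) \<partial>lborel)"
      by (simp add: f_def)
  qed
  also have "\<dots> = (\<integral>\<^sup>+ z. ennreal (indicator ?D' z * G (unmixed ?S' z)) \<partial>leb V)"
    using lborel_product.product_nn_integral_insert[of ?V w
        "\<lambda>z. ennreal (indicator ?D' z * G (unmixed ?S' z))"]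
      measurable_unmixed[OF us' snoc.prems(3)] fin VE[symmetric] by simp
  finally show ?case by simp
qed

theorem change_of_variables:
  assumes vs: "distinct vs" "set vs = V"
    and \<Gamma>: "\<Gamma> \<in> borel_measurable (leb V)" "\<And>z. 0 \<le> \<Gamma> z"
  shows "(\<integral>\<^sup>+ h. ennreal (indicator U h * (\<Gamma> (restrict (T h) V) * jac vs h)) \<partial>leb V)
       = (\<integral>\<^sup>+ z. ennreal (indicator ((\<lambda>h. restrict (T h) V) ` U) z * \<Gamma> z) \<partial>leb V)"
proof -
  have mixed: "mixed (set vs) = (\<lambda>h. restrict (T h) V)"
    by (auto simp: mixed_def vs fun_eq_iff restrict_def)
  have "(\<lambda>h. \<lambda>v\<in>V. indicator U h * T h v) \<in> measurable (leb V) (leb V)"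
    by (intro measurable_restrict)
      (auto intro!: continuous_on_rel_open_measurable[OF fin open_U] cont_T)
  from measurable_compose[OF this \<Gamma>(1)] rel_open_sets[OF fin open_U]
  have "(\<lambda>h. indicator U h * \<Gamma> (\<lambda>v\<in>V. indicator U h * T h v)) \<in> borel_measurable (leb V)"
    by simp
  moreover have "(\<lambda>h. indicator U h * \<Gamma> (\<lambda>v\<in>V. indicator U h * T h v))
      = (\<lambda>h. indicator U h * \<Gamma> (restrict (T h) V))"
    by (rule ext) (simp add: indicator_def)
  ultimately have "(\<lambda>h. indicator U h * \<Gamma> (mixed (set vs) h)) \<in> borel_measurable (leb V)"
    by (simp add: mixed)
  from change_of_variables_mixed[OF vs(1) _ this]
  have "(\<integral>\<^sup>+ h. ennreal (indicator U h * (\<Gamma> (mixed (set vs) h) * jac vs h)) \<partial>leb V)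
      = (\<integral>\<^sup>+ z. ennreal (indicator (mixed (set vs) ` U) z * \<Gamma> (mixed (set vs) (unmixed (set vs) z))) \<partial>leb V)"
    using vs(2) \<Gamma>(2) by simp
  also have "\<dots> = (\<integral>\<^sup>+ z. ennreal (indicator (mixed (set vs) ` U) z * \<Gamma> z) \<partial>leb V)"
    by (intro nn_integral_cong) (auto simp: indicator_def mixed_unmixed)
  finally show ?thesis by (simp add: mixed)
qed

end

section \<open>Flow maps of a network\<close>

text \<open>The index \<open>b\<close> of the least boundary value is singled out: the harmonic extension then
  exceeds \<open>x b\<close> at every interior vertex, so differences along edges to \<open>b\<close> have a known sign.\<close>

locale network =
  fixes V :: "'a set" and E :: "'a set set" and k :: nat and x :: "nat \<Rightarrow> real" and b :: nat
  assumes graph: "simple_graph V E" and k: "k \<ge> 1" and inj_x: "inj_on x {..k}"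
    and b: "b \<le> k" and b_min: "\<And>i. i \<le> k \<Longrightarrow> i \<noteq> b \<Longrightarrow> x b < x i"
begin

definition nbrs :: "'a \<Rightarrow> 'a set" where
  "nbrs v = {u \<in> V. {v, u} \<in> E}"

definition spoke :: "'a \<Rightarrow> ('a + nat) set" where
  "spoke v = {Inl v, Inr b}"

abbreviation "edges \<equiv> ext_edges V E k"

text \<open>The weights on these edges are kept as parameters, while those on the spokes become functions of
  the potential.\<close>

abbreviation "rest \<equiv> edges - spoke ` V"

lemma finite_V [simp, intro]: "finite V"
  using graph by (simp add: simple_graph_def)

lemma nbrs_subset: "nbrs v \<subseteq> V" and finite_nbrs [simp, intro]: "finite (nbrs v)"
  by (auto simp: nbrs_def intro: rev_finite_subset)

lemma not_nbrs_self: "v \<notin> nbrs v"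
  using graph by (force simp: nbrs_def simple_graph_def)

lemma nbrs_sym: "v \<in> V \<Longrightarrow> u \<in> nbrs v \<Longrightarrow> v \<in> nbrs u"
  by (simp add: nbrs_def insert_commute)

definition laplacian :: "('a \<Rightarrow> real) \<Rightarrow> ('a \<Rightarrow> 'a \<Rightarrow> real) \<Rightarrow> 'a \<Rightarrow> 'a \<Rightarrow> real" where
  "laplacian D c v u = (if u = v then D v else if u \<in> nbrs v then - c v u else 0)"

lemma sum_laplacian:
  assumes v: "v \<in> V"
  shows "(\<Sum>u\<in>V. laplacian D c v u * f u) = D v * f v - (\<Sum>u\<in>nbrs v. c v u * f u)"
proof -
  have "(\<Sum>u\<in>V. laplacian D c v u * f u)
      = D v * f v + (\<Sum>u\<in>V - {v}. laplacian D c v u * f u)"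
    using v by (subst sum.remove[of _ v]) (auto simp: laplacian_def)
  also have "(\<Sum>u\<in>V - {v}. laplacian D c v u * f u) = (\<Sum>u\<in>nbrs v. - c v u * f u)"
    using nbrs_subset not_nbrs_self
    by (intro sum.mono_neutral_cong_right) (auto simp: laplacian_def)
  finally show ?thesis by (simp add: sum_negf)
qed

lemma strict_M_matrix_laplacian:
  assumes "\<And>v u. v \<in> V \<Longrightarrow> u \<in> nbrs v \<Longrightarrow> 0 \<le> c v u"
    and "\<And>v. v \<in> V \<Longrightarrow> (\<Sum>u\<in>nbrs v. c v u) < D v"
  shows "strict_M_matrix V (laplacian D c)"
  unfolding strict_M_matrix_def
proof (intro ballI conjI impI)
  fix v assume v: "v \<in> V"
  show "0 < (\<Sum>u\<in>V. laplacian D c v u)"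
    using sum_laplacian[OF v, of D c "\<lambda>_. 1"] assms(2)[OF v] by simp
  show "laplacian D c v u \<le> 0" if "u \<in> V" "u \<noteq> v" for u
    using that assms(1)[OF v] by (auto simp: laplacian_def)
qed

text \<open>The flow out of \<open>v\<close> through all edges except its spoke.\<close>

definition outflow :: "(real \<Rightarrow> real) \<Rightarrow> (('a + nat) set \<Rightarrow> real) \<Rightarrow> ('a \<Rightarrow> real) \<Rightarrow> 'a \<Rightarrow> real" where
  "outflow \<phi> p h v = (\<Sum>u\<in>nbrs v. p {Inl v, Inl u} * \<phi> (h v - h u))
     + (\<Sum>i\<in>{..k} - {b}. p {Inl v, Inr i} * \<phi> (h v - x i))"

text \<open>The weight on the spoke of \<open>v\<close> for which the total flow out of \<open>v\<close> vanishes.\<close>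

definition spoke_weight :: "(real \<Rightarrow> real) \<Rightarrow> (('a + nat) set \<Rightarrow> real) \<Rightarrow> ('a \<Rightarrow> real) \<Rightarrow> 'a \<Rightarrow> real" where
  "spoke_weight \<phi> p h v = - outflow \<phi> p h v / \<phi> (h v - x b)"

lemma interior_edge_in_rest: "v \<in> V \<Longrightarrow> u \<in> nbrs v \<Longrightarrow> {Inl v, Inl u} \<in> rest"
proof -
  assume "v \<in> V" "u \<in> nbrs v"
  then have "Inl ` {v, u} \<in> edges" unfolding nbrs_def ext_edges_def by blast
  moreover have "{Inl v, Inl u} \<notin> spoke ` V" by (auto simp: spoke_def doubleton_eq_iff)
  ultimately show ?thesis by simp
qed

lemma boundary_edge_in_rest: "v \<in> V \<Longrightarrow> i \<in> {..k} - {b} \<Longrightarrow> {Inl v, Inr i} \<in> rest"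
  unfolding ext_edges_def spoke_def by (auto simp: doubleton_eq_iff)

lemma other_boundary_nonempty: "{..k} - {b} \<noteq> {}"
proof
  assume "{..k} - {b} = {}"
  then have "{..k} \<subseteq> {b}" by auto
  then have "card {..k} \<le> 1" using card_mono[of "{b}" "{..k}"] by simp
  then show False using k by simp
qed

end

text \<open>A common frame for \<open>\<phi>(d) = d\<close> and \<open>\<phi>(d) = -1/d\<close>. The function \<open>q\<close> is the slope of secants of \<open>\<phi>\<close>, and
  \<open>R\<close> tells which pairs of differences may be joined by a secant: for the reciprocal these are the pairs
  of equal sign, so \<open>C\<close> will be a cell on which no difference along an edge changes sign.\<close>

locale flow_map = network +
  fixes \<phi> :: "real \<Rightarrow> real" and q :: "real \<Rightarrow> real \<Rightarrow> real" and R :: "real \<Rightarrow> real \<Rightarrow> bool"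
    and C :: "('a \<Rightarrow> real) set" and p :: "('a + nat) set \<Rightarrow> real"
  assumes slope: "\<And>d d'. R d' d \<Longrightarrow> \<phi> d' - \<phi> d = q d' d * (d' - d)"
    and slope_pos: "\<And>d d'. R d' d \<Longrightarrow> 0 < q d' d"
    and cont_\<phi>: "continuous_on {d. R d d} \<phi>"
    and cont_q: "\<And>d. R d d \<Longrightarrow> continuous_on {d'. R d' d} (\<lambda>d'. q d' d)"
    and cont_q_diag: "continuous_on {d. R d d} (\<lambda>d. q d d)"
    and open_C: "rel_open V C"
    and R_interior: "\<And>h h' v u. h \<in> C \<Longrightarrow> h' \<in> C \<Longrightarrow> v \<in> V \<Longrightarrow> u \<in> nbrs v \<Longrightarrow>
      R (h' v - h' u) (h v - h u)"
    and R_boundary: "\<And>h h' v i. h \<in> C \<Longrightarrow> h' \<in> C \<Longrightarrow> v \<in> V \<Longrightarrow> i \<le> k \<Longrightarrow>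
      R (h' v - x i) (h v - x i)"
    and \<phi>_spoke: "\<And>h h' v. h \<in> C \<Longrightarrow> h' \<in> C \<Longrightarrow> v \<in> V \<Longrightarrow> 0 < \<phi> (h v - x b) * \<phi> (h' v - x b)"
    and p_pos: "\<And>e. e \<in> rest \<Longrightarrow> 0 < p e"
begin

abbreviation "T \<equiv> spoke_weight \<phi> p"

definition U :: "('a \<Rightarrow> real) set" where
  "U = {h \<in> C. \<forall>v\<in>V. 0 < T h v}"

text \<open>The difference of two potentials satisfies a linear network equation, in which an edge has as
  conductance its weight times the secant slope of \<open>\<phi>\<close>. The boundary edges add to the diagonal only.\<close>

definition secant_matrix :: "('a \<Rightarrow> real) \<Rightarrow> ('a \<Rightarrow> real) \<Rightarrow> 'a \<Rightarrow> 'a \<Rightarrow> real" where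
  "secant_matrix h' h = laplacian
     (\<lambda>v. (\<Sum>u\<in>nbrs v. p {Inl v, Inl u} * q (h' v - h' u) (h v - h u))
        + (\<Sum>i\<in>{..k} - {b}. p {Inl v, Inr i} * q (h' v - x i) (h v - x i))
        + T h v * q (h' v - x b) (h v - x b))
     (\<lambda>v u. p {Inl v, Inl u} * q (h' v - h' u) (h v - h u))"

lemma cont_coord: "continuous_on S (\<lambda>h. h v :: real)"
  by (rule continuous_on_subset[OF continuous_on_product_coordinates]) simp

lemma cont_T_C: "v \<in> V \<Longrightarrow> continuous_on C (\<lambda>h. T h v)"
  unfolding spoke_weight_def outflow_def using \<phi>_spoke[of _ _ v] b
  by (intro continuous_intros continuous_on_compose2[OF cont_\<phi>] cont_coord)
    (force intro: R_interior R_boundary)+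

lemma rel_open_U: "rel_open V U"
proof -
  have "rel_open V {h \<in> C. 0 < T h v}" if "v \<in> V" for v
  proof -
    have "openin (top_of_set C) (C \<inter> (\<lambda>h. T h v) -` {0<..})"
      by (rule continuous_openin_preimage_gen[OF cont_T_C[OF that]]) simp
    moreover have "C \<inter> (\<lambda>h. T h v) -` {0<..} = {h \<in> C. 0 < T h v}" by auto
    ultimately show ?thesis using open_C openin_trans by metis
  qed
  then have "rel_open V ((\<Inter>v\<in>V. {h \<in> C. 0 < T h v}) \<inter> topspace (top_of_set (vecs V)))"
    by (intro openin_INT) auto
  from openin_Int[OF this open_C]
  show ?thesis
    by (rule back_subst[of "rel_open V"]) (use open_C openin_imp_subset in \<open>fastforce simp: U_def\<close>)
qed

lemma secant_identity:
  assumes h: "h \<in> C" "h' \<in> C" and v: "v \<in> V"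
  shows "T h' v - T h v
    = - 1 / \<phi> (h' v - x b) * (\<Sum>u\<in>V. secant_matrix h' h v u * (h' u - h u))"
proof -
  let ?P = "\<lambda>u. p {Inl v, Inl u}" and ?P' = "\<lambda>i. p {Inl v, Inr i}"
  have nz: "\<phi> (h v - x b) \<noteq> 0" "\<phi> (h' v - x b) \<noteq> 0"
    using \<phi>_spoke[OF h v] by auto
  have a: "\<phi> (h' v - h' u) - \<phi> (h v - h u)
      = q (h' v - h' u) (h v - h u) * ((h' v - h v) - (h' u - h u))" if "u \<in> nbrs v" for u
    using slope[OF R_interior[OF h v that]] by (simp add: algebra_simps)
  have c: "\<phi> (h' v - x i) - \<phi> (h v - x i) = q (h' v - x i) (h v - x i) * (h' v - h v)" if "i \<le> k" for i
    using slope[OF R_boundary[OF h v that]] by simp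
  have "outflow \<phi> p h' v - outflow \<phi> p h v
      = (\<Sum>u\<in>nbrs v. ?P u * (\<phi> (h' v - h' u) - \<phi> (h v - h u)))
      + (\<Sum>i\<in>{..k} - {b}. ?P' i * (\<phi> (h' v - x i) - \<phi> (h v - x i)))"
    by (simp add: outflow_def right_diff_distrib sum_subtractf)
  also have "\<dots> = (\<Sum>u\<in>nbrs v. ?P u * (q (h' v - h' u) (h v - h u) * ((h' v - h v) - (h' u - h u))))
      + (\<Sum>i\<in>{..k} - {b}. ?P' i * (q (h' v - x i) (h v - x i) * (h' v - h v)))"
    using a c by simp
  finally have out: "outflow \<phi> p h' v - outflow \<phi> p h v = \<dots>" .
  have "(\<Sum>u\<in>V. secant_matrix h' h v u * (h' u - h u))
      = (outflow \<phi> p h' v - outflow \<phi> p h v) + T h v * (\<phi> (h' v - x b) - \<phi> (h v - x b))"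
    unfolding secant_matrix_def sum_laplacian[OF v] out c[OF b]
    by (simp add: right_diff_distrib left_diff_distrib distrib_right distrib_left sum_subtractf sum.distrib
        sum_distrib_right sum_distrib_left mult.assoc)
  also have "\<dots> = - \<phi> (h' v - x b) * (T h' v - T h v)"
  proof -
    have "T h v * \<phi> (h v - x b) = - outflow \<phi> p h v" "T h' v * \<phi> (h' v - x b) = - outflow \<phi> p h' v"
      using nz by (simp_all add: spoke_weight_def)
    then show ?thesis by (simp add: algebra_simps)
  qed
  finally show ?thesis using nz by simp
qed

text \<open>Row sums collect the conductances to the boundary. They are positive because the spoke weights
  are positive on \<open>U\<close> and there are further boundary edges.\<close>

lemma secant_matrix_strict_M:
  assumes h: "h \<in> U" "h' \<in> U"
  shows "strict_M_matrix V (secant_matrix h' h)"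
  unfolding secant_matrix_def
proof (rule strict_M_matrix_laplacian)
  fix v assume v: "v \<in> V"
  have hC: "h \<in> C" "h' \<in> C" using h by (auto simp: U_def)
  show "0 \<le> p {Inl v, Inl u} * q (h' v - h' u) (h v - h u)" if "u \<in> nbrs v" for u
    using p_pos[OF interior_edge_in_rest[OF v that]] slope_pos[OF R_interior[OF hC v that]] by simp
  have "0 < (\<Sum>i\<in>{..k} - {b}. p {Inl v, Inr i} * q (h' v - x i) (h v - x i))"
    using other_boundary_nonempty v
    by (intro sum_pos mult_pos_pos p_pos boundary_edge_in_rest slope_pos R_boundary hC) auto
  moreover have "0 < T h v * q (h' v - x b) (h v - x b)"
    using h(1) v by (intro mult_pos_pos slope_pos R_boundary hC b) (auto simp: U_def)
  ultimately show "(\<Sum>u\<in>nbrs v. p {Inl v, Inl u} * q (h' v - h' u) (h v - h u))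
    < (\<Sum>u\<in>nbrs v. p {Inl v, Inl u} * q (h' v - h' u) (h v - h u))
      + (\<Sum>i\<in>{..k} - {b}. p {Inl v, Inr i} * q (h' v - x i) (h v - x i))
      + T h v * q (h' v - x b) (h v - x b)" by linarith
qed

lemma cont_laplacian:
  assumes "v \<in> V" "continuous_on S (\<lambda>h. D h v)"
    "\<And>u. u \<in> nbrs v \<Longrightarrow> continuous_on S (\<lambda>h. c h v u)"
  shows "continuous_on S (\<lambda>h. laplacian (D h) (c h) v u)"
  using assms unfolding laplacian_def
  by (cases "u = v"; cases "u \<in> nbrs v") (auto intro!: continuous_intros)

sublocale secant_map V U T "\<lambda>h v. - 1 / \<phi> (h v - x b)" secant_matrix
proof
  show "rel_open V U" by (rule rel_open_U)
  have UC: "h \<in> C" if "h \<in> U" for h using that by (auto simp: U_def)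
  show "T h' v - T h v = - 1 / \<phi> (h' v - x b) * (\<Sum>u\<in>V. secant_matrix h' h v u * (h' u - h u))"
    if "h \<in> U" "h' \<in> U" "v \<in> V" for h h' v
    using that by (intro secant_identity UC)
  show "strict_M_matrix V (secant_matrix h' h)" if "h \<in> U" "h' \<in> U" for h h'
    using that by (rule secant_matrix_strict_M)
  show "0 < - 1 / \<phi> (h v - x b) * (- 1 / \<phi> (h' v - x b))" if "h \<in> U" "h' \<in> U" "v \<in> V" for h h' v
    using \<phi>_spoke[OF UC UC, OF that] by (simp add: zero_less_divide_iff)
  show "continuous_on U (\<lambda>h. - 1 / \<phi> (h v - x b))" if v: "v \<in> V" for v
  proof (intro continuous_intros continuous_on_compose2[OF cont_\<phi>] cont_coord)
    show "\<forall>h\<in>U. \<phi> (h v - x b) \<noteq> 0" using \<phi>_spoke[OF UC UC v] by force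
  qed (use UC v b in \<open>auto intro: R_boundary\<close>)
  show "continuous_on U (\<lambda>h'. secant_matrix h' h v u)" if h: "h \<in> U" and v: "v \<in> V" and "u \<in> V" for h u v
    unfolding secant_matrix_def
    by (intro cont_laplacian v continuous_intros continuous_on_compose2[OF cont_q] cont_coord)
      (use UC h v b in \<open>auto intro: R_boundary R_interior\<close>)
  show "continuous_on U (\<lambda>h. secant_matrix h h v u)" if v: "v \<in> V" and "u \<in> V" for u v
    unfolding secant_matrix_def
    by (intro cont_laplacian v continuous_intros continuous_on_compose2[OF cont_q_diag] cont_coord
        continuous_on_subset[OF cont_T_C])
      (use UC v b in \<open>auto intro: R_boundary R_interior\<close>)
qed auto

end

context network begin

abbreviation positive_vecs :: "('a \<Rightarrow> real) set" where
  "positive_vecs \<equiv> {z \<in> vecs V. \<forall>v\<in>V. 0 < z v}"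

definition join :: "(('a + nat) set \<Rightarrow> real) \<Rightarrow> ('a \<Rightarrow> real) \<Rightarrow> ('a + nat) set \<Rightarrow> real" where
  "join p z = (\<lambda>e\<in>edges. if e \<in> spoke ` V then z (the_inv_into V spoke e) else p e)"

lemma inj_spoke: "inj_on spoke S"
  by (auto simp: inj_on_def spoke_def doubleton_eq_iff)

lemma spoke_edge: "v \<in> V \<Longrightarrow> spoke v \<in> edges"
  using b unfolding spoke_def ext_edges_def by blast

lemma join_spoke [simp]: "v \<in> V \<Longrightarrow> join p z (spoke v) = z v"
  using spoke_edge by (simp add: join_def the_inv_into_f_f[OF inj_spoke])

lemma join_rest [simp]: "e \<in> rest \<Longrightarrow> join p z e = p e"
  by (simp add: join_def)

lemma join_pos:
  assumes "\<And>e. e \<in> rest \<Longrightarrow> 0 < p e" "\<And>v. v \<in> V \<Longrightarrow> 0 < z v" "e \<in> edges"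
  shows "0 < join p z e"
  using assms by (cases "e \<in> spoke ` V") auto

lemma boundary_edge: "v \<in> V \<Longrightarrow> i \<le> k \<Longrightarrow> {Inl v, Inr i} \<in> edges"
  unfolding ext_edges_def by blast

lemma interior_edge: "v \<in> V \<Longrightarrow> u \<in> nbrs v \<Longrightarrow> {Inl v, Inl u} \<in> edges"
  using interior_edge_in_rest by blast

lemma outflow_cong:
  assumes "v \<in> V" "\<And>e. e \<in> rest \<Longrightarrow> p e = p' e"
  shows "outflow \<phi> p h v = outflow \<phi> p' h v"
  unfolding outflow_def using assms interior_edge_in_rest boundary_edge_in_rest
  by (auto intro!: arg_cong2[of _ _ _ _ "(+)"] sum.cong)

lemma split_spoke: "(\<Sum>i\<le>k. f i) = (\<Sum>i\<in>{..k} - {b}. f i) + (f b :: real)"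
  using b by (subst sum.remove[of _ b]) auto

section \<open>The Dirichlet problem\<close>

definition dirichlet_matrix :: "(('a + nat) set \<Rightarrow> real) \<Rightarrow> 'a \<Rightarrow> 'a \<Rightarrow> real" where
  "dirichlet_matrix c = laplacian
     (\<lambda>v. (\<Sum>u\<in>nbrs v. c {Inl v, Inl u}) + (\<Sum>i\<le>k. c {Inl v, Inr i})) (\<lambda>v u. c {Inl v, Inl u})"

definition boundary_source :: "(('a + nat) set \<Rightarrow> real) \<Rightarrow> 'a \<Rightarrow> real" where
  "boundary_source c v = (\<Sum>i\<in>{..k} - {b}. c {Inl v, Inr i} * (x i - x b))"

definition vlist :: "'a list" where
  "vlist = (SOME vs. distinct vs \<and> set vs = V)"

lemma vlist: "distinct vlist" "set vlist = V"
  using someI_ex[of "\<lambda>vs. distinct vs \<and> set vs = V"] finite_distinct_list[OF finite_V]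
  by (auto simp: vlist_def)

definition dirichlet_solution :: "(('a + nat) set \<Rightarrow> real) \<Rightarrow> 'a \<Rightarrow> real" where
  "dirichlet_solution c = (\<lambda>v\<in>V. x b + gauss_solve vlist (dirichlet_matrix c) (boundary_source c) v)"

lemma strict_M_dirichlet_matrix:
  assumes c: "\<And>e. e \<in> edges \<Longrightarrow> 0 < c e"
  shows "strict_M_matrix V (dirichlet_matrix c)"
  unfolding dirichlet_matrix_def
proof (rule strict_M_matrix_laplacian)
  fix v assume v: "v \<in> V"
  show "0 \<le> c {Inl v, Inl u}" if "u \<in> nbrs v" for u
    using c[OF interior_edge[OF v that]] by simp
  have "0 < (\<Sum>i\<le>k. c {Inl v, Inr i})"
    using v by (intro sum_pos c boundary_edge) auto
  then show "(\<Sum>u\<in>nbrs v. c {Inl v, Inl u}) < (\<Sum>u\<in>nbrs v. c {Inl v, Inl u}) + (\<Sum>i\<le>k. c {Inl v, Inr i})"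
    by simp
qed

lemma net_flow_eq_matrix:
  assumes v: "v \<in> V"
  shows "outflow (\<lambda>d. d) c h v + c (spoke v) * (h v - x b)
    = (\<Sum>u\<in>V. dirichlet_matrix c v u * (h u - x b)) - boundary_source c v"
  unfolding dirichlet_matrix_def sum_laplacian[OF v] boundary_source_def outflow_def split_spoke spoke_def
  by (simp add: algebra_simps sum_subtractf sum_distrib_left sum.distrib)

text \<open>Subtracting \<open>x b\<close> from all values makes the right-hand side of the Dirichlet problem positive.\<close>

lemma dirichlet_solution:
  assumes c: "\<And>e. e \<in> edges \<Longrightarrow> 0 < c e"
  shows "dirichlet_solution c \<in> vecs V"
    and "v \<in> V \<Longrightarrow> x b < dirichlet_solution c v"
    and "v \<in> V \<Longrightarrow> outflow (\<lambda>d. d) c (dirichlet_solution c) v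
           + c (spoke v) * (dirichlet_solution c v - x b) = 0"
proof -
  have M: "strict_M_matrix (set vlist) (dirichlet_matrix c)"
    using strict_M_dirichlet_matrix[OF c] by (simp add: vlist)
  show "dirichlet_solution c \<in> vecs V" by (simp add: dirichlet_solution_def)
  have "0 < boundary_source c v" if v: "v \<in> V" for v
    unfolding boundary_source_def using other_boundary_nonempty v b_min
    by (intro sum_pos mult_pos_pos c boundary_edge) auto
  then show "x b < dirichlet_solution c v" if "v \<in> V"
    using gauss_solve_pos[OF M vlist(1), of "boundary_source c" v] that
    by (simp add: dirichlet_solution_def vlist)
  show "outflow (\<lambda>d. d) c (dirichlet_solution c) v
           + c (spoke v) * (dirichlet_solution c v - x b) = 0" if v: "v \<in> V"
    unfolding net_flow_eq_matrix[OF v]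
    using gauss_solve_correct[OF M vlist(1), of v "boundary_source c"] v
    by (simp add: dirichlet_solution_def vlist cong: sum.cong)
qed

lemma dirichlet_unique:
  assumes c: "\<And>e. e \<in> edges \<Longrightarrow> 0 < c e" and h: "h \<in> vecs V"
    and flow: "\<And>v. v \<in> V \<Longrightarrow> outflow (\<lambda>d. d) c h v + c (spoke v) * (h v - x b) = 0"
  shows "h = dirichlet_solution c"
proof (rule extensionalityI[of _ V])
  let ?s = "dirichlet_solution c"
  fix v assume v: "v \<in> V"
  have "h v - ?s v = 0"
  proof (rule strict_M_matrix_kernel[OF finite_V strict_M_dirichlet_matrix[OF c] vlist(1)])
    fix u assume "u \<in> set vlist"
    then have u: "u \<in> V" by (simp add: vlist)
    have "(\<Sum>b'\<in>V. dirichlet_matrix c u b' * (h b' - x b)) = (\<Sum>b'\<in>V. dirichlet_matrix c u b' * (?s b' - x b))"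
      using flow[OF u] dirichlet_solution(3)[of c, OF c u] unfolding net_flow_eq_matrix[OF u] by simp
    then show "(\<Sum>b'\<in>V. dirichlet_matrix c u b' * (h b' - ?s b')) = 0"
      by (simp add: right_diff_distrib sum_subtractf)
  qed (use v vlist in auto)
  then show "h v = ?s v" by simp
qed (use h dirichlet_solution(1)[OF c] in \<open>auto simp: PiE_def\<close>)

lemma measurable_dirichlet_matrix:
  assumes m: "\<And>e. e \<in> edges \<Longrightarrow> (\<lambda>w. c w e) \<in> borel_measurable M" and "a \<in> V"
  shows "(\<lambda>w. dirichlet_matrix (c w) a u) \<in> borel_measurable M"
  using \<open>a \<in> V\<close> unfolding dirichlet_matrix_def laplacian_def
  by (cases "u = a"; cases "u \<in> nbrs a")
    (auto intro!: borel_measurable_add borel_measurable_sum borel_measurable_uminus m interior_edge boundary_edge)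

lemma measurable_dirichlet_solution:
  assumes m: "\<And>e. e \<in> edges \<Longrightarrow> (\<lambda>w. c w e) \<in> borel_measurable M" and v: "v \<in> V"
  shows "(\<lambda>w. dirichlet_solution (c w) v) \<in> borel_measurable M"
proof -
  have "(\<lambda>w. gauss_solve vlist (dirichlet_matrix (c w)) (boundary_source (c w)) v) \<in> borel_measurable M"
  proof (rule borel_measurable_gauss_solve; unfold vlist)
    show "(\<lambda>w. dirichlet_matrix (c w) a u) \<in> borel_measurable M" if "a \<in> V" for a u
      by (rule measurable_dirichlet_matrix[OF m that])
    show "(\<lambda>w. boundary_source (c w) a) \<in> borel_measurable M" if "a \<in> V" for a
      using that unfolding boundary_source_def
      by (auto intro!: borel_measurable_sum borel_measurable_times m boundary_edge)
  qed
  then show ?thesis using v by (simp add: dirichlet_solution_def)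
qed

section \<open>Prescribed conductances: linear flow\<close>

definition above_min :: "('a \<Rightarrow> real) set" where
  "above_min = {h \<in> vecs V. \<forall>v\<in>V. x b < h v}"

lemma open_Collect_finite_less:
  fixes f g :: "'j \<Rightarrow> ('a \<Rightarrow> real) \<Rightarrow> real"
  assumes "finite S" "\<And>j. j \<in> S \<Longrightarrow> continuous_on UNIV (f j)" "\<And>j. j \<in> S \<Longrightarrow> continuous_on UNIV (g j)"
  shows "open {h. \<forall>j\<in>S. f j h < g j h}"
proof -
  have "{h. \<forall>j\<in>S. f j h < g j h} = (\<Inter>j\<in>S. {h. f j h < g j h})" by auto
  then show ?thesis using assms by (auto intro!: open_INT open_Collect_less)
qed

lemma rel_open_above_min: "rel_open V above_min"
proof -
  have "open {h. \<forall>v\<in>V. x b < (h v :: real)}"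
    by (rule open_Collect_finite_less) (auto intro!: continuous_intros)
  moreover have "above_min = vecs V \<inter> {h. \<forall>v\<in>V. x b < h v}" by (auto simp: above_min_def)
  ultimately show ?thesis by (auto intro: openin_open_Int)
qed

lemma flow_map_linear:
  assumes "\<And>e. e \<in> rest \<Longrightarrow> 0 < p e"
  shows "flow_map V E k x b (\<lambda>d. d) (\<lambda>_ _. 1) (\<lambda>_ _. True) above_min p"
  by unfold_locales (use assms rel_open_above_min in \<open>auto simp: above_min_def\<close>)

section \<open>Prescribed energies: cells and reciprocal flow\<close>

definition generic :: "('a \<Rightarrow> real) \<Rightarrow> bool" where
  "generic h \<longleftrightarrow> h \<in> vecs V \<and> (\<forall>v\<in>V. (\<forall>u\<in>nbrs v. h v \<noteq> h u) \<and> (\<forall>i\<le>k. h v \<noteq> x i))"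

text \<open>Together with the absence of ties, this records all signs of differences along edges.\<close>

definition pattern :: "('a \<Rightarrow> real) \<Rightarrow> ('a \<times> 'a) set \<times> ('a \<times> nat) set" where
  "pattern h = ({(v, u). v \<in> V \<and> u \<in> nbrs v \<and> h u < h v}, {(v, i). v \<in> V \<and> i \<le> k \<and> x i < h v})"

definition cell :: "('a \<times> 'a) set \<times> ('a \<times> nat) set \<Rightarrow> ('a \<Rightarrow> real) set" where
  "cell \<sigma> = {h. generic h \<and> pattern h = \<sigma>}"

text \<open>The cells whose potentials stay strictly between the least and the greatest boundary value.\<close>

definition bounded_patterns :: "(('a \<times> 'a) set \<times> ('a \<times> nat) set) set" where
  "bounded_patterns = pattern ` {h. generic h \<and> (\<forall>v\<in>V. x b < h v \<and> (\<exists>i\<le>k. h v < x i))}"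

lemma cell_iff:
  assumes "h0 \<in> cell \<sigma>"
  shows "h \<in> cell \<sigma> \<longleftrightarrow> h \<in> vecs V \<and> (\<forall>v\<in>V. (\<forall>u\<in>nbrs v. 0 < (h v - h u) * (h0 v - h0 u)) \<and>
    (\<forall>i\<le>k. 0 < (h v - x i) * (h0 v - x i)))" (is "_ \<longleftrightarrow> ?R")
proof
  assume h: "h \<in> cell \<sigma>"
  have "pattern h = pattern h0" using h assms by (simp add: cell_def)
  then have eq: "v \<in> V \<Longrightarrow> u \<in> nbrs v \<Longrightarrow> h u < h v \<longleftrightarrow> h0 u < h0 v"
    "v \<in> V \<Longrightarrow> i \<le> k \<Longrightarrow> x i < h v \<longleftrightarrow> x i < h0 v" for u v i
    by (auto simp: pattern_def set_eq_iff)
  have g: "generic h" "generic h0" using h assms by (auto simp: cell_def)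
  show ?R
  proof (intro conjI ballI allI impI)
    show "h \<in> vecs V" using g by (simp add: generic_def)
    fix v assume v: "v \<in> V"
    show "0 < (h v - h u) * (h0 v - h0 u)" if u: "u \<in> nbrs v" for u
      using eq(1)[OF v u] g v u unfolding zero_less_mult_iff generic_def by force
    show "0 < (h v - x i) * (h0 v - x i)" if i: "i \<le> k" for i
      using eq(2)[OF v i] g v i unfolding zero_less_mult_iff generic_def by force
  qed
next
  assume R: ?R
  have g0: "generic h0" using assms by (simp add: cell_def)
  have eq: "v \<in> V \<Longrightarrow> u \<in> nbrs v \<Longrightarrow> h u < h v \<longleftrightarrow> h0 u < h0 v"
    "v \<in> V \<Longrightarrow> i \<le> k \<Longrightarrow> x i < h v \<longleftrightarrow> x i < h0 v" for u v i
    using R by (fastforce simp: zero_less_mult_iff)+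
  have "pattern h = pattern h0" using eq by (auto simp: pattern_def)
  moreover have "generic h" using R by (force simp: generic_def zero_less_mult_iff)
  ultimately show "h \<in> cell \<sigma>" using assms by (simp add: cell_def)
qed

lemma rel_open_cell: "rel_open V (cell \<sigma>)"
proof (cases "cell \<sigma> = {}")
  case False
  then obtain h0 where h0: "h0 \<in> cell \<sigma>" by auto
  have "open ({h. \<forall>(v, u)\<in>Sigma V nbrs. 0 < (h v - h u) * (h0 v - h0 u)} \<inter>
    {h. \<forall>(v, i)\<in>V \<times> {..k}. 0 < (h v - x i) * (h0 v - x i)})"
    unfolding case_prod_beta by (intro open_Int open_Collect_finite_less) (auto intro!: continuous_intros)
  moreover have "cell \<sigma> = vecs V \<inter> ({h. \<forall>(v, u)\<in>Sigma V nbrs. 0 < (h v - h u) * (h0 v - h0 u)} \<inter>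
    {h. \<forall>(v, i)\<in>V \<times> {..k}. 0 < (h v - x i) * (h0 v - x i)})"
    using cell_iff[OF h0] by auto
  ultimately show ?thesis by (auto intro: openin_open_Int)
qed simp

lemma bounded_cell:
  assumes "\<sigma> \<in> bounded_patterns" "h \<in> cell \<sigma>" "v \<in> V"
  shows "x b < h v" "\<exists>i\<le>k. h v < x i"
proof -
  obtain h0 where h0: "h0 \<in> cell \<sigma>" "x b < h0 v" "\<exists>i\<le>k. h0 v < x i"
    using assms(1,3) by (auto simp: bounded_patterns_def cell_def)
  then show "x b < h v" "\<exists>i\<le>k. h v < x i"
    using cell_iff[OF h0(1), of h] assms b by (fastforce simp: zero_less_mult_iff)+
qed

lemma flow_map_log:
  assumes "\<And>e. e \<in> rest \<Longrightarrow> 0 < p e" and \<sigma>: "\<sigma> \<in> bounded_patterns"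
  shows "flow_map V E k x b (\<lambda>d. - 1 / d) (\<lambda>d' d. 1 / (d' * d)) (\<lambda>d' d. 0 < d' * d) (cell \<sigma>) p"
proof unfold_locales
  show "- 1 / d' - - 1 / d = 1 / (d' * d) * (d' - d)" if "0 < d' * d" for d d' :: real
  proof -
    have "d \<noteq> 0" "d' \<noteq> 0" using that by auto
    then show ?thesis by (simp add: divide_simps)
  qed
  show "continuous_on {d. 0 < d * d} (\<lambda>d::real. - 1 / d)"
    "continuous_on {d'. 0 < d' * d} (\<lambda>d'::real. 1 / (d' * d))"
    "continuous_on {d. 0 < d * d} (\<lambda>d::real. 1 / (d * d))" for d
    by (auto intro!: continuous_intros)
  show "0 < - 1 / (h v - x b) * (- 1 / (h' v - x b))"
    if "h \<in> cell \<sigma>" "h' \<in> cell \<sigma>" "v \<in> V" for h h' v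
    using bounded_cell(1)[OF \<sigma>] that by (simp add: zero_less_mult_iff)
  show "0 < (h' v - h' u) * (h v - h u)" if "h \<in> cell \<sigma>" "h' \<in> cell \<sigma>" "v \<in> V" "u \<in> nbrs v" for h h' v u
    using cell_iff[OF that(1), of h'] that by blast
  show "0 < (h' v - x i) * (h v - x i)" if "h \<in> cell \<sigma>" "h' \<in> cell \<sigma>" "v \<in> V" "i \<le> k" for h h' v i
    using cell_iff[OF that(1), of h'] that by blast
qed (use assms rel_open_cell in auto)

lemma linear_kirchhoff_iff:
  assumes "v \<in> V" "x b < h v"
  shows "outflow (\<lambda>d. d) p h v + w * (h v - x b) = 0 \<longleftrightarrow> spoke_weight (\<lambda>d. d) p h v = w"
proof -
  have "h v - x b \<noteq> 0" using assms by simp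
  then show ?thesis by (auto simp: spoke_weight_def field_simps)
qed

lemma dirichlet_solution_join:
  assumes p: "\<And>e. e \<in> rest \<Longrightarrow> 0 < p e" and h: "h \<in> above_min"
    and pos: "\<And>v. v \<in> V \<Longrightarrow> 0 < spoke_weight (\<lambda>d. d) p h v"
    and z: "\<And>v. v \<in> V \<Longrightarrow> z v = spoke_weight (\<lambda>d. d) p h v"
  shows "dirichlet_solution (join p z) = h"
proof (rule dirichlet_unique[symmetric])
  show "0 < join p z e" if "e \<in> edges" for e
    using p pos z that by (intro join_pos) auto
  show "h \<in> vecs V" using h by (simp add: above_min_def)
  fix v assume v: "v \<in> V"
  have "outflow (\<lambda>d. d) (join p z) h v = outflow (\<lambda>d. d) p h v"
    by (rule outflow_cong[OF v]) (rule join_rest)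
  then show "outflow (\<lambda>d. d) (join p z) h v + join p z (spoke v) * (h v - x b) = 0"
    using linear_kirchhoff_iff[OF v, of h p "z v"] h z[OF v] v by (simp add: above_min_def)
qed

lemma linear_image:
  assumes p: "\<And>e. e \<in> rest \<Longrightarrow> 0 < p e"
  shows "(\<lambda>h. restrict (spoke_weight (\<lambda>d. d) p h) V) `
    {h \<in> above_min. \<forall>v\<in>V. 0 < spoke_weight (\<lambda>d. d) p h v} = positive_vecs"
proof (intro equalityI subsetI)
  fix z assume z: "z \<in> positive_vecs"
  define h where "h = dirichlet_solution (join p z)"
  have c: "\<And>e. e \<in> edges \<Longrightarrow> 0 < join p z e" using p z by (intro join_pos) auto
  have h: "h \<in> above_min" using dirichlet_solution(1,2)[of "join p z", OF c] by (simp add: above_min_def h_def)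
  have T: "spoke_weight (\<lambda>d. d) p h v = z v" if v: "v \<in> V" for v
  proof -
    have "outflow (\<lambda>d. d) (join p z) h v = outflow (\<lambda>d. d) p h v"
      by (rule outflow_cong[OF v]) (rule join_rest)
    then show ?thesis
      using dirichlet_solution(3)[of "join p z", OF c v] linear_kirchhoff_iff[OF v, of h p "z v"] h v
      by (simp add: above_min_def h_def)
  qed
  have "z = restrict (spoke_weight (\<lambda>d. d) p h) V"
    using T z by (intro extensionalityI[of _ V]) (auto simp: PiE_def)
  then show "z \<in> (\<lambda>h. restrict (spoke_weight (\<lambda>d. d) p h) V) `
    {h \<in> above_min. \<forall>v\<in>V. 0 < spoke_weight (\<lambda>d. d) p h v}"
    using h T z by (intro image_eqI[of _ _ h]) auto
qed auto

section \<open>Existence of a critical point in each bounded cell\<close>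

abbreviation vals :: "('a \<Rightarrow> real) \<Rightarrow> 'a + nat \<Rightarrow> real" where
  "vals h \<equiv> case_sum h x"

lemma edge_cases:
  assumes "e \<in> edges"
  obtains v u where "v \<in> V" "u \<in> nbrs v" "e = {Inl v, Inl u}"
  | v i where "v \<in> V" "i \<le> k" "e = {Inl v, Inr i}"
proof -
  consider e' where "e' \<in> E" "e = Inl ` e'" | v i where "v \<in> V" "i \<le> k" "e = {Inl v, Inr i}"
    using assms by (auto simp: ext_edges_def)
  then show ?thesis
  proof cases
    case (1 e')
    then have "e' \<subseteq> V" "card e' = 2" using graph by (auto simp: simple_graph_def)
    then obtain v u where vu: "e' = {v, u}" "v \<noteq> u" by (auto simp: card_2_iff)
    then have "v \<in> V" "u \<in> nbrs v" "e = {Inl v, Inl u}"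
      using 1 \<open>e' \<subseteq> V\<close> by (auto simp: nbrs_def)
    then show ?thesis by (rule that(1))
  qed (rule that(2))
qed

lemma finite_edges [simp, intro]: "finite edges"
proof -
  have "edges \<subseteq> Pow (ext_verts V k)"
    by (rule subsetI, erule edge_cases) (auto simp: ext_verts_def nbrs_def)
  moreover have "finite (ext_verts V k)" by (simp add: ext_verts_def)
  ultimately show ?thesis by (rule finite_subset[OF _ finite_Pow_iff[THEN iffD2]])
qed

lemma sq_diff_nonneg: "e \<in> edges \<Longrightarrow> 0 \<le> sq_diff (vals h) e"
  by (erule edge_cases) (auto simp: sq_diff_edge)

lemma generic_iff_sq_diff:
  "generic h \<longleftrightarrow> h \<in> vecs V \<and> (\<forall>e\<in>edges. 0 < sq_diff (vals h) e)"
proof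
  assume "generic h"
  then show "h \<in> vecs V \<and> (\<forall>e\<in>edges. 0 < sq_diff (vals h) e)"
    by (auto simp: generic_def sq_diff_edge elim!: edge_cases)
next
  assume R: "h \<in> vecs V \<and> (\<forall>e\<in>edges. 0 < sq_diff (vals h) e)"
  have "h v \<noteq> h u" if "v \<in> V" "u \<in> nbrs v" for v u
    using R interior_edge[OF that] by (force simp: sq_diff_edge)
  moreover have "h v \<noteq> x i" if "v \<in> V" "i \<le> k" for v i
    using R boundary_edge[OF that] by (force simp: sq_diff_edge)
  ultimately show "generic h" using R by (simp add: generic_def)
qed

lemma continuous_on_sq_diff:
  assumes "e \<in> edges"
  shows "continuous_on S (\<lambda>h. sq_diff (vals h) e)"
  using assms
  by (rule edge_cases)
    (auto simp: sq_diff_edge intro!: continuous_intros continuous_on_subset[OF continuous_on_product_coordinates])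

lemma compact_box_vecs:
  fixes lo hi :: "'a \<Rightarrow> real"
  shows "compact (PiE V (\<lambda>v. {lo v..hi v}))"
proof -
  have "compactin (product_topology (\<lambda>_. euclidean :: real topology) UNIV)
      (PiE UNIV (\<lambda>v. if v \<in> V then {lo v..hi v} else {undefined}))"
    unfolding compactin_PiE by auto
  moreover have "PiE UNIV (\<lambda>v. if v \<in> V then {lo v..hi v} else {undefined}) = PiE V (\<lambda>v. {lo v..hi v})"
    by (auto simp: PiE_iff extensional_def split: if_splits)
  ultimately show ?thesis by (simp add: euclidean_product_topology)
qed

lemma edges_at_vertex:
  assumes v: "v \<in> V"
  shows "(\<Sum>e\<in>{e \<in> edges. Inl v \<in> e}. f e)
    = (\<Sum>u\<in>nbrs v. f {Inl v, Inl u}) + (\<Sum>i\<le>k. f {Inl v, Inr i} :: real)"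
proof -
  have eq: "{e \<in> edges. Inl v \<in> e} = (\<lambda>u. {Inl v, Inl u}) ` nbrs v \<union> (\<lambda>i. {Inl v, Inr i}) ` {..k}"
  proof (intro equalityI subsetI)
    fix e assume "e \<in> {e \<in> edges. Inl v \<in> e}"
    then have e: "e \<in> edges" "Inl v \<in> e" by auto
    from e(1) show "e \<in> (\<lambda>u. {Inl v, Inl u}) ` nbrs v \<union> (\<lambda>i. {Inl v, Inr i}) ` {..k}"
    proof (rule edge_cases)
      fix v' u assume a: "v' \<in> V" "u \<in> nbrs v'" "e = {Inl v', Inl u}"
      then have "v = v' \<or> v = u" using e(2) by auto
      then show ?thesis using a nbrs_sym[OF a(1,2)] by (auto simp: insert_commute)
    qed (use e(2) in auto)
  qed (use v interior_edge boundary_edge in auto)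
  have "(\<lambda>u. {Inl v, Inl u}) ` nbrs v \<inter> (\<lambda>i. {Inl v, Inr i}) ` {..k} = {}"
    by (auto simp: doubleton_eq_iff)
  moreover have "inj_on (\<lambda>u. {Inl v, Inl u :: 'a + nat}) (nbrs v)" "inj_on (\<lambda>i. {Inl v, Inr i}) {..k}"
    by (auto simp: inj_on_def doubleton_eq_iff)
  ultimately show ?thesis
    unfolding eq by (subst sum.union_disjoint) (auto simp: sum.reindex)
qed

text \<open>On the compact closure of the cell the product of the powers \<open>(d\<^sub>e\<^sup>2)\<^sup>y\<close> attains its maximum; as the
  product vanishes where some difference does, the maximum lies in the open cell. Differences enter
  squared, which only doubles the logarithmic potential.\<close>

lemma log_potential_maximum:
  assumes y: "\<And>e. e \<in> edges \<Longrightarrow> 0 < y e" and \<sigma>: "\<sigma> \<in> bounded_patterns"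
  shows "\<exists>h\<in>cell \<sigma>. \<forall>h'\<in>cell \<sigma>.
    (\<Sum>e\<in>edges. y e * ln (sq_diff (vals h') e)) \<le> (\<Sum>e\<in>edges. y e * ln (sq_diff (vals h) e))"
proof -
  obtain h0 where h0: "h0 \<in> cell \<sigma>" using \<sigma> by (auto simp: bounded_patterns_def cell_def)
  define M where "M = Max (x ` {..k})"
  have M: "x i \<le> M" if "i \<le> k" for i using that by (auto simp: M_def)
  define K where "K = PiE V (\<lambda>_. {x b..M}) \<inter>
    ((\<Inter>v\<in>V. \<Inter>u\<in>nbrs v. {h. 0 \<le> (h v - h u) * (h0 v - h0 u)}) \<inter>
     (\<Inter>v\<in>V. \<Inter>i\<in>{..k}. {h. 0 \<le> (h v - x i) * (h0 v - x i)}))"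
  have cellK: "cell \<sigma> \<subseteq> K"
  proof
    fix h assume h: "h \<in> cell \<sigma>"
    have bounds: "h v \<in> {x b..M}" if v: "v \<in> V" for v
    proof -
      obtain i where "i \<le> k" "h v < x i" using bounded_cell(2)[OF \<sigma> h v] by auto
      then show ?thesis using bounded_cell(1)[OF \<sigma> h v] M[of i] by simp
    qed
    have signs: "h \<in> vecs V" "\<And>v u. v \<in> V \<Longrightarrow> u \<in> nbrs v \<Longrightarrow> 0 < (h v - h u) * (h0 v - h0 u)"
      "\<And>v i. v \<in> V \<Longrightarrow> i \<le> k \<Longrightarrow> 0 < (h v - x i) * (h0 v - x i)"
      using cell_iff[OF h0, of h] h by blast+
    show "h \<in> K"
      unfolding K_def
    proof (intro IntI INT_I CollectI)
      show "h \<in> PiE V (\<lambda>_. {x b..M})" using bounds signs(1) by (simp add: PiE_iff)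
    qed (use signs in \<open>auto intro!: less_imp_le\<close>)
  qed
  have "compact K"
    unfolding K_def
    by (intro compact_Int_closed compact_box_vecs closed_Int closed_INT ballI closed_Collect_le
        continuous_intros continuous_on_subset[OF continuous_on_product_coordinates] subset_UNIV)
  moreover have "K \<noteq> {}" using h0 cellK by auto
  moreover
  define P where "P h = (\<Prod>e\<in>edges. sq_diff (vals h) e powr y e)" for h
  have "continuous_on K P"
    unfolding P_def
    by (intro continuous_on_prod continuous_on_powr' continuous_on_sq_diff continuous_on_const)
      (auto simp: sq_diff_nonneg y)
  ultimately obtain h where h: "h \<in> K" "\<And>h'. h' \<in> K \<Longrightarrow> P h' \<le> P h"
    using continuous_attains_sup by metis
  have Ppos: "0 < P h'" if "h' \<in> cell \<sigma>" for h'
    unfolding P_def using that by (intro prod_pos) (auto simp: cell_def generic_iff_sq_diff)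
  have "0 < P h" using Ppos[OF h0] h(2)[of h0] h0 cellK by auto
  then have "P h \<noteq> 0" by simp
  then have "sq_diff (vals h) e \<noteq> 0" if "e \<in> edges" for e
    using that unfolding P_def prod_zero_iff[OF finite_edges] by auto
  then have "generic h"
    unfolding generic_iff_sq_diff using h(1) sq_diff_nonneg by (simp add: K_def PiE_iff less_le)
  moreover have g0: "generic h0" using h0 by (simp add: cell_def)
  moreover have "(h v - h u) * (h0 v - h0 u) \<noteq> 0" if "v \<in> V" "u \<in> nbrs v" for v u
    using \<open>generic h\<close> g0 that by (simp add: generic_def)
  moreover have "(h v - x i) * (h0 v - x i) \<noteq> 0" if "v \<in> V" "i \<le> k" for v i
    using \<open>generic h\<close> g0 that by (simp add: generic_def)
  moreover have "h \<in> vecs V" using \<open>generic h\<close> by (simp add: generic_def)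
  moreover have "0 \<le> (h v - h u) * (h0 v - h0 u)" if "v \<in> V" "u \<in> nbrs v" for v u
    using h(1) that unfolding K_def by blast
  moreover have "0 \<le> (h v - x i) * (h0 v - x i)" if "v \<in> V" "i \<le> k" for v i
    using h(1) that unfolding K_def by blast
  ultimately have hc: "h \<in> cell \<sigma>"
    unfolding cell_iff[OF h0] by (simp add: less_le)
  have lnP: "ln (P h') = (\<Sum>e\<in>edges. y e * ln (sq_diff (vals h') e))" if "h' \<in> cell \<sigma>" for h'
    unfolding P_def using that by (subst ln_prod) (auto simp: cell_def generic_iff_sq_diff ln_powr)
  show ?thesis
  proof (intro bexI[of _ h] ballI hc)
    fix h' assume h': "h' \<in> cell \<sigma>"
    have "ln (P h') \<le> ln (P h)" using Ppos[OF h'] Ppos[OF hc] h(2)[of h'] h' cellK by auto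
    then show "(\<Sum>e\<in>edges. y e * ln (sq_diff (vals h') e)) \<le> (\<Sum>e\<in>edges. y e * ln (sq_diff (vals h) e))"
      by (simp add: lnP h' hc)
  qed
qed

lemma log_potential_critical:
  assumes y: "\<And>e. e \<in> edges \<Longrightarrow> 0 < y e" and \<sigma>: "\<sigma> \<in> bounded_patterns"
  shows "\<exists>h\<in>cell \<sigma>. \<forall>v\<in>V.
    (\<Sum>u\<in>nbrs v. y {Inl v, Inl u} / (h v - h u)) + (\<Sum>i\<le>k. y {Inl v, Inr i} / (h v - x i)) = 0"
proof -
  obtain h where h: "h \<in> cell \<sigma>"
    "\<And>h'. h' \<in> cell \<sigma> \<Longrightarrow> (\<Sum>e\<in>edges. y e * ln (sq_diff (vals h') e)) \<le> (\<Sum>e\<in>edges. y e * ln (sq_diff (vals h) e))"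
    using log_potential_maximum[of y, OF y \<sigma>] by blast
  have g: "generic h" using h(1) by (simp add: cell_def)
  show ?thesis
  proof (intro bexI[of _ h] ballI h(1))
    fix v assume v: "v \<in> V"
    define L where "L s = (\<Sum>u\<in>nbrs v. y {Inl v, Inl u} * ln ((s - h u)\<^sup>2))
      + (\<Sum>i\<le>k. y {Inl v, Inr i} * ln ((s - x i)\<^sup>2))" for s
    \<comment> \<open>Only the edges at \<open>v\<close> see the moving value \<open>s\<close>.\<close>
    have split: "(\<Sum>e\<in>edges. y e * ln (sq_diff (vals (h(v := s))) e))
        = L s + (\<Sum>e\<in>{e \<in> edges. Inl v \<notin> e}. y e * ln (sq_diff (vals h) e))" for s
    proof -
      have "(\<Sum>e\<in>edges. y e * ln (sq_diff (vals (h(v := s))) e))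
          = (\<Sum>e\<in>{e \<in> edges. Inl v \<in> e}. y e * ln (sq_diff (vals (h(v := s))) e))
          + (\<Sum>e\<in>{e \<in> edges. Inl v \<notin> e}. y e * ln (sq_diff (vals (h(v := s))) e))"
        by (subst sum.union_disjoint[symmetric]) (auto intro!: sum.cong)
      also have "(\<Sum>e\<in>{e \<in> edges. Inl v \<in> e}. y e * ln (sq_diff (vals (h(v := s))) e)) = L s"
        unfolding edges_at_vertex[OF v] L_def using not_nbrs_self[of v]
        by (auto simp: sq_diff_edge intro!: arg_cong2[of _ _ _ _ "(+)"] sum.cong)
      also have "(\<Sum>e\<in>{e \<in> edges. Inl v \<notin> e}. y e * ln (sq_diff (vals (h(v := s))) e))
          = (\<Sum>e\<in>{e \<in> edges. Inl v \<notin> e}. y e * ln (sq_diff (vals h) e))"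
      proof (rule sum.cong[OF refl])
        fix e assume "e \<in> {e \<in> edges. Inl v \<notin> e}"
        then have e: "e \<in> edges" "Inl v \<notin> e" by auto
        from e(1) have "sq_diff (vals (h(v := s))) e = sq_diff (vals h) e"
          by (rule edge_cases) (use e(2) in \<open>auto simp: sq_diff_edge\<close>)
        then show "y e * ln (sq_diff (vals (h(v := s))) e) = y e * ln (sq_diff (vals h) e)" by simp
      qed
      finally show ?thesis .
    qed
    obtain \<epsilon> where \<epsilon>: "\<epsilon> > 0"
      "\<And>h'. h' \<in> vecs V \<Longrightarrow> (\<forall>u\<in>V. \<bar>h' u - h u\<bar> < \<epsilon>) \<Longrightarrow> h' \<in> cell \<sigma>"
      using rel_open_cell[of \<sigma>] h(1) unfolding rel_open_iff_box[OF finite_V] by meson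
    have "L s \<le> L (h v)" if s: "\<bar>h v - s\<bar> < \<epsilon>" for s
    proof -
      have "h(v := s) \<in> cell \<sigma>"
        using s \<epsilon>(1) g v by (intro \<epsilon>(2)) (auto simp: generic_def PiE_iff extensional_def)
      from h(2)[OF this] split[of s] split[of "h v"] show ?thesis by simp
    qed
    moreover have "(L has_real_derivative (\<Sum>u\<in>nbrs v. 2 * (y {Inl v, Inl u} / (h v - h u)))
        + (\<Sum>i\<le>k. 2 * (y {Inl v, Inr i} / (h v - x i)))) (at (h v))"
    proof -
      have log_term: "((\<lambda>s. c * ln ((s - a)\<^sup>2)) has_real_derivative 2 * (c / (t - a))) (at t)"
        if "t \<noteq> a" for c a t :: real
      proof -
        have d: "t - a \<noteq> 0" using that by simp
        have "((\<lambda>s. c * ln ((s - a)\<^sup>2)) has_real_derivative c * (1 / (t - a)\<^sup>2 * (2 * (t - a)))) (at t)"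
          using d by (auto intro!: derivative_eq_intros)
        moreover have "c * (1 / w\<^sup>2 * (2 * w)) = 2 * (c / w)" for w :: real
          by (simp add: power2_eq_square)
        ultimately show ?thesis by (rule back_subst)
      qed
      show ?thesis
        unfolding L_def using g v by (intro DERIV_add DERIV_sum log_term) (auto simp: generic_def)
    qed
    ultimately have "(\<Sum>u\<in>nbrs v. 2 * (y {Inl v, Inl u} / (h v - h u)))
        + (\<Sum>i\<le>k. 2 * (y {Inl v, Inr i} / (h v - x i))) = 0"
      using \<epsilon>(1) by (intro DERIV_local_max) auto
    then show "(\<Sum>u\<in>nbrs v. y {Inl v, Inl u} / (h v - h u)) + (\<Sum>i\<le>k. y {Inl v, Inr i} / (h v - x i)) = 0"
      unfolding sum_distrib_left[symmetric] by linarith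
  qed
qed

text \<open>Every choice of positive spoke energies is attained on the cell: by criticality at the maximum,
  these energies balance the reciprocal flow.\<close>

lemma log_image:
  assumes p: "\<And>e. e \<in> rest \<Longrightarrow> 0 < p e" and \<sigma>: "\<sigma> \<in> bounded_patterns"
  shows "(\<lambda>h. restrict (spoke_weight (\<lambda>d. - 1 / d) p h) V) `
    {h \<in> cell \<sigma>. \<forall>v\<in>V. 0 < spoke_weight (\<lambda>d. - 1 / d) p h v} = positive_vecs"
proof (intro equalityI subsetI)
  fix z assume z: "z \<in> positive_vecs"
  have y: "\<And>e. e \<in> edges \<Longrightarrow> 0 < join p z e" using p z by (intro join_pos) auto
  obtain h where h: "h \<in> cell \<sigma>" "\<And>v. v \<in> V \<Longrightarrow>
      (\<Sum>u\<in>nbrs v. join p z {Inl v, Inl u} / (h v - h u)) + (\<Sum>i\<le>k. join p z {Inl v, Inr i} / (h v - x i)) = 0"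
    using log_potential_critical[of "join p z", OF y \<sigma>] by blast
  have T: "spoke_weight (\<lambda>d. - 1 / d) p h v = z v" if v: "v \<in> V" for v
  proof -
    have "outflow (\<lambda>d. - 1 / d) p h v = outflow (\<lambda>d. - 1 / d) (join p z) h v"
      by (rule outflow_cong[OF v]) simp
    also have "\<dots> = z v / (h v - x b)"
      using h(2)[OF v] v unfolding split_spoke
      by (simp add: outflow_def sum_negf spoke_def[symmetric])
    finally show ?thesis using bounded_cell(1)[OF \<sigma> h(1) v] by (simp add: spoke_weight_def)
  qed
  have "z = restrict (spoke_weight (\<lambda>d. - 1 / d) p h) V"
    using T z by (intro extensionalityI[of _ V]) (auto simp: PiE_def)
  then show "z \<in> (\<lambda>h. restrict (spoke_weight (\<lambda>d. - 1 / d) p h) V) `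
    {h \<in> cell \<sigma>. \<forall>v\<in>V. 0 < spoke_weight (\<lambda>d. - 1 / d) p h v}"
    using h(1) T z by (intro image_eqI[of _ _ h]) auto
qed auto

end

section \<open>Counting cells by deletion and contraction\<close>

text \<open>Proper colourings and potentials in general position are both instances, so one contraction
  lemma serves for both.\<close>

definition proper_maps :: "'b set \<Rightarrow> 'a set \<Rightarrow> 'a set set \<Rightarrow> ('a \<Rightarrow> 'b) set" where
  "proper_maps X V E = {f \<in> V \<rightarrow>\<^sub>E X. \<forall>u v. {u, v} \<in> E \<longrightarrow> f u \<noteq> f v}"

lemma proper_colourings_eq: "proper_colourings V E q = proper_maps {..<q} V E"
  by (simp add: proper_colourings_def proper_maps_def)

lemma proper_maps_extensional: "f \<in> proper_maps X V E \<Longrightarrow> f \<in> extensional V"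
  unfolding proper_maps_def PiE_def by blast

lemma proper_maps_edge: "f \<in> proper_maps X V E \<Longrightarrow> {u, v} \<in> E \<Longrightarrow> f u \<noteq> f v"
  unfolding proper_maps_def mem_Collect_eq by (drule conjunct2, drule spec[of _ u], drule spec[of _ v], erule mp)

lemma proper_maps_range: "f \<in> proper_maps X V E \<Longrightarrow> v \<in> V \<Longrightarrow> f v \<in> X"
  unfolding proper_maps_def by blast

lemma proper_mapsI:
  assumes "f \<in> extensional V" "\<And>v. v \<in> V \<Longrightarrow> f v \<in> X" "\<And>u v. {u, v} \<in> E \<Longrightarrow> f u \<noteq> f v"
  shows "f \<in> proper_maps X V E"
  unfolding proper_maps_def PiE_iff by (intro CollectI conjI ballI allI impI assms)

lemma proper_maps_insert_edge:
  assumes "{a, c} \<in> E"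
  shows "proper_maps X V E = {f \<in> proper_maps X V (E - {{a, c}}). f a \<noteq> f c}"
proof (intro equalityI subsetI)
  fix f assume f: "f \<in> proper_maps X V E"
  have "f \<in> proper_maps X V (E - {{a, c}})"
    using proper_maps_extensional[OF f] proper_maps_range[OF f] proper_maps_edge[OF f]
    by (intro proper_mapsI) auto
  then show "f \<in> {f \<in> proper_maps X V (E - {{a, c}}). f a \<noteq> f c}"
    using proper_maps_edge[OF f assms] by simp
next
  fix f assume "f \<in> {f \<in> proper_maps X V (E - {{a, c}}). f a \<noteq> f c}"
  then have f: "f \<in> proper_maps X V (E - {{a, c}})" "f a \<noteq> f c" by simp_all
  show "f \<in> proper_maps X V E"
  proof (rule proper_mapsI)
    show "f u \<noteq> f v" if "{u, v} \<in> E" for u v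
      using f(2) proper_maps_edge[OF f(1), of u v] that
      by (cases "{u, v} = {a, c}") (auto simp: doubleton_eq_iff)
  qed (use proper_maps_extensional[OF f(1)] proper_maps_range[OF f(1)] in auto)
qed

definition merge_vertex :: "'a \<Rightarrow> 'a \<Rightarrow> 'a \<Rightarrow> 'a" where
  "merge_vertex a c = (\<lambda>w. if w = c then a else w)"

definition contract :: "'a \<Rightarrow> 'a \<Rightarrow> 'a set set \<Rightarrow> 'a set set" where
  "contract a c E = (\<lambda>d. merge_vertex a c ` d) ` (E - {{a, c}})"

lemma simple_graph_edge:
  assumes "simple_graph V E" "{u, v} \<in> E"
  shows "u \<in> V" "v \<in> V" "u \<noteq> v"
proof -
  have "\<forall>e\<in>E. e \<subseteq> V \<and> card e = 2" using assms(1) by (simp add: simple_graph_def)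
  from bspec[OF this assms(2)] show "u \<in> V" "v \<in> V" "u \<noteq> v" by auto
qed

lemma simple_graph_edge_obtain:
  assumes "simple_graph V E" "e \<in> E"
  obtains u v where "e = {u, v}" "u \<noteq> v" "u \<in> V" "v \<in> V"
proof -
  have e: "card e = 2" "e \<subseteq> V" using assms by (auto simp: simple_graph_def)
  then obtain u v where "e = {u, v}" "u \<noteq> v" by (auto simp: card_2_iff)
  then show ?thesis using that[of u v] e(2) by simp
qed

lemma simple_graph_finite: "simple_graph V E \<Longrightarrow> finite E"
  by (rule finite_subset[of _ "Pow V"]) (auto simp: simple_graph_def)

lemma contract_edge_iff:
  assumes g: "simple_graph V E"
  shows "{u, v} \<in> contract a c E \<longleftrightarrow>
     (\<exists>p q. {p, q} \<in> E - {{a, c}} \<and> u = merge_vertex a c p \<and> v = merge_vertex a c q)"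
proof
  assume "{u, v} \<in> contract a c E"
  then obtain d where d: "d \<in> E - {{a, c}}" "{u, v} = merge_vertex a c ` d"
    unfolding contract_def by (elim imageE)
  obtain p q where pq: "d = {p, q}" using simple_graph_edge_obtain[OF g DiffD1[OF d(1)]] by metis
  then have "u = merge_vertex a c p \<and> v = merge_vertex a c q \<or> u = merge_vertex a c q \<and> v = merge_vertex a c p"
    using d(2) unfolding pq image_insert image_empty doubleton_eq_iff by simp
  moreover have "{q, p} \<in> E - {{a, c}}" "{p, q} \<in> E - {{a, c}}" using d(1) pq by (simp_all add: insert_commute)
  ultimately show "\<exists>p q. {p, q} \<in> E - {{a, c}} \<and> u = merge_vertex a c p \<and> v = merge_vertex a c q"
    by blast
next
  assume "\<exists>p q. {p, q} \<in> E - {{a, c}} \<and> u = merge_vertex a c p \<and> v = merge_vertex a c q"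
  then obtain p q where pq: "{p, q} \<in> E - {{a, c}}" "u = merge_vertex a c p" "v = merge_vertex a c q"
    by blast
  have "{u, v} = merge_vertex a c ` {p, q}" unfolding pq(2,3) by simp
  then show "{u, v} \<in> contract a c E" unfolding contract_def using pq(1) by (rule image_eqI)
qed

lemma simple_graph_contract:
  assumes g: "simple_graph V E" and ac: "{a, c} \<in> E"
  shows "simple_graph (V - {c}) (contract a c E)"
  unfolding simple_graph_def
proof (intro conjI ballI)
  show "finite (V - {c})" using g by (simp add: simple_graph_def)
  fix e assume "e \<in> contract a c E"
  then obtain d where d: "d \<in> E" "d \<noteq> {a, c}" "e = merge_vertex a c ` d"
    unfolding contract_def by blast
  obtain p q where pq: "d = {p, q}" "p \<noteq> q" "p \<in> V" "q \<in> V"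
    using simple_graph_edge_obtain[OF g d(1)] .
  note a = simple_graph_edge[OF g ac]
  have "{p, q} \<noteq> {a, c}" using pq(1) d(2) by simp
  then have "merge_vertex a c p \<noteq> merge_vertex a c q"
    using pq(2) by (auto simp: merge_vertex_def doubleton_eq_iff)
  then show "card e = 2" using d(3) pq(1) by simp
  show "e \<subseteq> V - {c}" unfolding d(3) pq(1) image_insert image_empty using a pq(3,4) by (simp add: merge_vertex_def)
qed

lemma card_contract_less:
  assumes "simple_graph V E" "{a, c} \<in> E"
  shows "card (contract a c E) < card E"
proof -
  have "card (contract a c E) \<le> card (E - {{a, c}})"
    unfolding contract_def using simple_graph_finite[OF assms(1)] by (intro card_image_le) auto
  also have "\<dots> < card E"
    using simple_graph_finite[OF assms(1)] assms(2) by (intro psubset_card_mono) auto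
  finally show ?thesis .
qed

text \<open>Maps that agree at both ends of an edge, but are proper elsewhere, are the proper maps of the
  contracted graph. Edges that become parallel under contraction impose the same condition.\<close>

lemma bij_betw_contract:
  fixes X :: "'b set"
  assumes g: "simple_graph V E" and ac: "{a, c} \<in> E"
  shows "bij_betw (\<lambda>f. restrict f (V - {c}))
    {f \<in> proper_maps X V (E - {{a, c}}). f a = f c} (proper_maps X (V - {c}) (contract a c E))"
proof -
  let ?m = "merge_vertex a c"
  note acV = simple_graph_edge[OF g ac]
  have m: "?m w \<in> V - {c}" if "w \<in> V" for w using that acV by (auto simp: merge_vertex_def)
  have edge: "p \<in> V" "q \<in> V" if "{p, q} \<in> E" for p q using simple_graph_edge[OF g that] by auto
  show ?thesis
  proof (rule bij_betwI[where g = "\<lambda>f. \<lambda>w\<in>V. f (?m w)"])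
    show "(\<lambda>f. restrict f (V - {c})) \<in> {f \<in> proper_maps X V (E - {{a, c}}). f a = f c}
        \<rightarrow> proper_maps X (V - {c}) (contract a c E)"
    proof
      fix f assume f: "f \<in> {f \<in> proper_maps X V (E - {{a, c}}). f a = f c}"
      have fm: "f (?m w) = f w" for w using f by (simp add: merge_vertex_def)
      have "restrict f (V - {c}) u \<noteq> restrict f (V - {c}) v" if uv: "{u, v} \<in> contract a c E" for u v
      proof -
        obtain p q where pq: "{p, q} \<in> E - {{a, c}}" "u = ?m p" "v = ?m q"
          using uv unfolding contract_edge_iff[OF g] by blast
        then have "f p \<noteq> f q" using proper_maps_edge[of f X V "E - {{a, c}}"] f by simp
        moreover have "p \<in> V" "q \<in> V" using edge[of p q] pq(1) by simp_all
        ultimately show ?thesis using pq m fm by simp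
      qed
      then show "restrict f (V - {c}) \<in> proper_maps X (V - {c}) (contract a c E)"
        using f proper_maps_range[of f X V "E - {{a, c}}"] by (intro proper_mapsI) auto
    qed
    show "(\<lambda>f. \<lambda>w\<in>V. f (?m w)) \<in> proper_maps X (V - {c}) (contract a c E)
        \<rightarrow> {f \<in> proper_maps X V (E - {{a, c}}). f a = f c}"
    proof
      fix f assume f: "f \<in> proper_maps X (V - {c}) (contract a c E)"
      have "f (?m p) \<noteq> f (?m q)" if "{p, q} \<in> E - {{a, c}}" for p q
        using proper_maps_edge[OF f] contract_edge_iff[OF g] that by metis
      then have "(\<lambda>w\<in>V. f (?m w)) p \<noteq> (\<lambda>w\<in>V. f (?m w)) q" if "{p, q} \<in> E - {{a, c}}" for p q
        using that edge[of p q] by simp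
      then have "(\<lambda>w\<in>V. f (?m w)) \<in> proper_maps X V (E - {{a, c}})"
        using proper_maps_range[OF f] m by (intro proper_mapsI) auto
      moreover have "(\<lambda>w\<in>V. f (?m w)) a = (\<lambda>w\<in>V. f (?m w)) c"
        using acV by (simp add: merge_vertex_def)
      ultimately show "(\<lambda>w\<in>V. f (?m w)) \<in> {f \<in> proper_maps X V (E - {{a, c}}). f a = f c}"
        by simp
    qed
    show "(\<lambda>w\<in>V. restrict f (V - {c}) (?m w)) = f"
      if "f \<in> {f \<in> proper_maps X V (E - {{a, c}}). f a = f c}" for f
    proof (rule extensionalityI[of _ V])
      fix w assume "w \<in> V"
      then show "(\<lambda>w\<in>V. restrict f (V - {c}) (?m w)) w = f w"
        using that m by (simp add: merge_vertex_def)
    qed (use proper_maps_extensional that in auto)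
    show "restrict (\<lambda>w\<in>V. f (?m w)) (V - {c}) = f"
      if "f \<in> proper_maps X (V - {c}) (contract a c E)" for f
    proof (rule extensionalityI[of _ "V - {c}"])
      show "f \<in> extensional (V - {c})" using that by (rule proper_maps_extensional)
    qed (auto simp: merge_vertex_def)
  qed
qed

lemma card_image_same_kernel:
  assumes "\<And>s t. s \<in> S \<Longrightarrow> t \<in> S \<Longrightarrow> f s = f t \<longleftrightarrow> g s = g t"
  shows "card (f ` S) = card (g ` S)"
proof -
  have inv: "inv_into S f (f s) \<in> S" "f (inv_into S f (f s)) = f s" if "s \<in> S" for s
    using that by (simp_all add: inv_into_into f_inv_into_f)
  have g_inv: "g (inv_into S f (f s)) = g s" if "s \<in> S" for s
    using assms[OF inv(1)[OF that] that] inv(2)[OF that] by simp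
  have "inj_on (\<lambda>y. g (inv_into S f y)) (f ` S)"
  proof (rule inj_onI)
    fix y z assume "y \<in> f ` S" "z \<in> f ` S" and eq: "g (inv_into S f y) = g (inv_into S f z)"
    then obtain s t where st: "s \<in> S" "t \<in> S" "y = f s" "z = f t" by blast
    then have "g s = g t" using eq g_inv by simp
    then show "y = z" using assms[OF st(1,2)] st by simp
  qed
  moreover have "(\<lambda>y. g (inv_into S f y)) ` (f ` S) = g ` S"
    unfolding image_image using g_inv by (rule image_cong[OF refl])
  ultimately show ?thesis by (metis card_image)
qed

text \<open>The real values are split into finitely many open intervals, named by \<open>L\<close>. The number of
  intervals plays the part of the number of colours.\<close>

locale level_sets =
  fixes X :: "real set" and L :: "real \<Rightarrow> 'l"
  assumes level_convex: "\<And>s t r. s \<in> X \<Longrightarrow> t \<in> X \<Longrightarrow> L s = L t \<Longrightarrow> s \<le> r \<Longrightarrow> r \<le> t \<Longrightarrow> r \<in> X \<and> L r = L s"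
    and level_open: "\<And>s. s \<in> X \<Longrightarrow> \<exists>\<epsilon>>0. \<forall>r. \<bar>r - s\<bar> < \<epsilon> \<longrightarrow> r \<in> X \<and> L r = L s"
    and finite_levels: "finite (L ` X)"
begin

text \<open>An order type is an orientation of the edges by increasing values, which is acyclic, together with
  a compatible assignment of intervals: these are the pairs counted in Stanley's theorem.\<close>

definition order_type :: "'a set \<Rightarrow> 'a set set \<Rightarrow> ('a \<Rightarrow> real) \<Rightarrow> ('a \<times> 'a) set \<times> ('a \<Rightarrow> 'l)" where
  "order_type V E h = ({(u, v). {u, v} \<in> E \<and> h u < h v}, \<lambda>v\<in>V. L (h v))"

lemma order_type_eq_iff:
  "order_type V E h = order_type V E h' \<longleftrightarrow>
     (\<forall>u v. {u, v} \<in> E \<longrightarrow> (h u < h v \<longleftrightarrow> h' u < h' v)) \<and> (\<forall>v\<in>V. L (h v) = L (h' v))"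
  by (auto simp: order_type_def set_eq_iff fun_eq_iff restrict_def)

definition num_types :: "'a set \<Rightarrow> 'a set set \<Rightarrow> nat" where
  "num_types V E = card (order_type V E ` proper_maps X V E)"

lemma finite_order_types:
  assumes g: "simple_graph V E"
  shows "finite (order_type V E ` proper_maps X V E)"
proof (rule finite_subset)
  have "finite V" using g by (simp add: simple_graph_def)
  then show "finite (Pow (V \<times> V) \<times> (V \<rightarrow>\<^sub>E L ` X))"
    using finite_levels by (intro finite_cartesian_product finite_PiE) auto
  show "order_type V E ` proper_maps X V E \<subseteq> Pow (V \<times> V) \<times> (V \<rightarrow>\<^sub>E L ` X)"
  proof (rule image_subsetI)
    fix h assume h: "h \<in> proper_maps X V E"
    have "(\<lambda>v\<in>V. L (h v)) \<in> V \<rightarrow>\<^sub>E L ` X" using proper_maps_range[OF h] by auto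
    moreover have "{(u, v). {u, v} \<in> E \<and> h u < h v} \<subseteq> V \<times> V"
      using simple_graph_edge[OF g] by blast
    ultimately show "order_type V E h \<in> Pow (V \<times> V) \<times> (V \<rightarrow>\<^sub>E L ` X)"
      by (simp add: order_type_def)
  qed
qed

lemma num_types_no_edges:
  fixes V :: "'v set"
  assumes "finite V"
  shows "num_types V {} = card (L ` X) ^ card V"
proof -
  have "order_type V {} ` proper_maps X V {} = Pair {} ` (V \<rightarrow>\<^sub>E L ` X)"
  proof (intro equalityI subsetI)
    fix \<sigma> :: "('v \<times> 'v) set \<times> ('v \<Rightarrow> 'l)" assume "\<sigma> \<in> Pair {} ` (V \<rightarrow>\<^sub>E L ` X)"
    then obtain f where f: "f \<in> V \<rightarrow>\<^sub>E L ` X" "\<sigma> = ({}, f)" by auto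
    then have "\<forall>v\<in>V. \<exists>s\<in>X. f v = L s" by (auto simp: PiE_iff)
    then obtain h where h: "\<And>v. v \<in> V \<Longrightarrow> h v \<in> X \<and> f v = L (h v)" by metis
    have "(\<lambda>v\<in>V. L (restrict h V v)) = f"
      by (rule extensionalityI[of _ V]) (use f h in \<open>auto simp: PiE_def\<close>)
    then show "\<sigma> \<in> order_type V {} ` proper_maps X V {}"
      using h f(2) by (intro image_eqI[of _ _ "restrict h V"] proper_mapsI) (auto simp: order_type_def)
  next
    fix \<sigma> :: "('v \<times> 'v) set \<times> ('v \<Rightarrow> 'l)" assume "\<sigma> \<in> order_type V {} ` proper_maps X V {}"
    then obtain h where "h \<in> proper_maps X V {}" "\<sigma> = order_type V {} h" by blast
    then show "\<sigma> \<in> Pair {} ` (V \<rightarrow>\<^sub>E L ` X)"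
      using proper_maps_range[of h X V "{}"] by (auto simp: order_type_def)
  qed
  then show ?thesis
    using assms by (simp add: num_types_def card_image inj_on_def card_PiE)
qed

text \<open>A potential with a tie at \<open>ac\<close> only: moving the value at \<open>a\<close> slightly either way breaks the tie and
  changes no other comparison.\<close>

lemma order_type_perturb:
  assumes g: "simple_graph V E" and ac: "{a, c} \<in> E" and h: "h \<in> proper_maps X V (E - {{a, c}})"
  shows "\<exists>\<epsilon>>0. \<forall>r. \<bar>r\<bar> < \<epsilon> \<longrightarrow> h(a := h a + r) \<in> proper_maps X V (E - {{a, c}}) \<and>
    order_type V (E - {{a, c}}) (h(a := h a + r)) = order_type V (E - {{a, c}}) h"
proof -
  note acV = simple_graph_edge[OF g ac]
  obtain \<epsilon>1 where \<epsilon>1: "\<epsilon>1 > 0" "\<And>r. \<bar>r - h a\<bar> < \<epsilon>1 \<Longrightarrow> r \<in> X \<and> L r = L (h a)"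
    using level_open[OF proper_maps_range[OF h acV(1)]] by blast
  define \<epsilon> where "\<epsilon> = Min (insert \<epsilon>1 ((\<lambda>w. \<bar>h w - h a\<bar>) ` {w \<in> V. {a, w} \<in> E - {{a, c}}}))"
  have finV: "finite V" using g by (simp add: simple_graph_def)
  have ne: "h u \<noteq> h v" if "{u, v} \<in> E - {{a, c}}" for u v
    using proper_maps_edge that h by metis
  have "0 < \<bar>h w - h a\<bar>" if "w \<in> {w \<in> V. {a, w} \<in> E - {{a, c}}}" for w
    using ne[of a w] that by simp
  then have "\<forall>y\<in>insert \<epsilon>1 ((\<lambda>w. \<bar>h w - h a\<bar>) ` {w \<in> V. {a, w} \<in> E - {{a, c}}}). 0 < y"
    using \<epsilon>1(1) by blast
  then have "\<epsilon> > 0" unfolding \<epsilon>_def using finV by (subst Min_gr_iff) simp_all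
  moreover have "h(a := h a + r) \<in> proper_maps X V (E - {{a, c}}) \<and>
    order_type V (E - {{a, c}}) (h(a := h a + r)) = order_type V (E - {{a, c}}) h" if r: "\<bar>r\<bar> < \<epsilon>" for r
  proof -
    let ?h = "h(a := h a + r)"
    have "\<epsilon> \<le> \<epsilon>1" unfolding \<epsilon>_def using finV by (intro Min_le) auto
    then have lev: "h a + r \<in> X" "L (h a + r) = L (h a)" using \<epsilon>1(2)[of "h a + r"] r by auto
    have far: "\<bar>r\<bar> < \<bar>h w - h a\<bar>" if "{a, w} \<in> E - {{a, c}}" for w
    proof -
      have "w \<in> V" using simple_graph_edge[OF g, of a w] that by blast
      then have "\<epsilon> \<le> \<bar>h w - h a\<bar>" unfolding \<epsilon>_def using finV that by (intro Min_le) auto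
      then show ?thesis using r by simp
    qed
    have signs: "?h u \<noteq> ?h v \<and> (?h u < ?h v \<longleftrightarrow> h u < h v)" if uv: "{u, v} \<in> E - {{a, c}}" for u v
    proof -
      have "u \<noteq> v" using simple_graph_edge[OF g, of u v] uv by blast
      then show ?thesis
        using far[of v] far[of u] uv ne[OF uv] by (cases "u = a"; cases "v = a") (auto simp: insert_commute)
    qed
    show ?thesis
    proof
      show "?h \<in> proper_maps X V (E - {{a, c}})"
      proof (rule proper_mapsI)
        show "?h \<in> extensional V" using proper_maps_extensional[OF h] acV(1) by (auto simp: extensional_def)
        show "?h v \<in> X" if "v \<in> V" for v using lev(1) proper_maps_range[OF h that] by simp
        show "?h u \<noteq> ?h v" if "{u, v} \<in> E - {{a, c}}" for u v using signs[OF that] by blast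
      qed
      show "order_type V (E - {{a, c}}) ?h = order_type V (E - {{a, c}}) h"
        unfolding order_type_eq_iff using signs lev(2) by simp
    qed
  qed
  ultimately show ?thesis by blast
qed

text \<open>Order types are convex. On the segment between two potentials of equal type that order \<open>a\<close> and \<open>c\<close>
  differently there is one with a tie.\<close>

lemma order_type_interpolate:
  assumes g: "simple_graph V E" and ac: "{a, c} \<in> E"
    and h: "h \<in> proper_maps X V (E - {{a, c}})" "h' \<in> proper_maps X V (E - {{a, c}})"
    and eq: "order_type V (E - {{a, c}}) h = order_type V (E - {{a, c}}) h'"
    and less: "h a < h c" "h' c < h' a"
  shows "\<exists>h''\<in>proper_maps X V (E - {{a, c}}). h'' a = h'' c \<and>
    order_type V (E - {{a, c}}) h'' = order_type V (E - {{a, c}}) h"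
proof -
  note acV = simple_graph_edge[OF g ac]
  \<comment> \<open>The time at which the difference of the values at \<open>a\<close> and \<open>c\<close>, affine along the segment, vanishes.\<close>
  define t where "t = (h c - h a) / ((h c - h a) + (h' a - h' c))"
  have "0 < h c - h a" "h c - h a < (h c - h a) + (h' a - h' c)" using less by simp_all
  then have t: "0 < t" "t < 1" unfolding t_def by simp_all
  define h'' where "h'' = (\<lambda>v\<in>V. (1 - t) * h v + t * h' v)"
  have edge: "u \<in> V" "v \<in> V" if "{u, v} \<in> E - {{a, c}}" for u v
    using simple_graph_edge[OF g DiffD1[OF that]] by simp_all
  note eq' = eq[unfolded order_type_eq_iff]
  have E: "h u < h v \<longleftrightarrow> h' u < h' v" if "{u, v} \<in> E - {{a, c}}" for u v
    by (rule conjunct1[OF eq', rule_format, OF that])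
  have Lev: "L (h v) = L (h' v)" if "v \<in> V" for v
    by (rule conjunct2[OF eq', rule_format, OF that])
  have less'': "h'' u < h'' v" if "{u, v} \<in> E - {{a, c}}" "h u < h v" for u v
  proof -
    have "h' u < h' v" using E[OF that(1)] that(2) by simp
    then have "(1 - t) * h u < (1 - t) * h v" "t * h' u < t * h' v"
      using that(2) t by simp_all
    then show ?thesis using edge[OF that(1)] by (simp add: h''_def)
  qed
  have ne: "h u \<noteq> h v" if "{u, v} \<in> E - {{a, c}}" for u v
    using proper_maps_edge[OF h(1) that] .
  have signs: "h'' u \<noteq> h'' v \<and> (h'' u < h'' v \<longleftrightarrow> h u < h v)" if "{u, v} \<in> E - {{a, c}}" for u v
  proof (cases "h u < h v")
    case True
    then show ?thesis using less''[OF that] by simp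
  next
    case False
    have "{v, u} \<in> E - {{a, c}}" using that by (simp add: insert_commute)
    then have "h'' v < h'' u" using less''[of v u] False ne[OF that] by simp
    then show ?thesis using False by simp
  qed
  have lev: "h'' v \<in> X \<and> L (h'' v) = L (h v)" if v: "v \<in> V" for v
  proof -
    have hX: "h v \<in> X" "h' v \<in> X" using h v proper_maps_range by metis+
    define d where "d = h' v - h v"
    have hv: "h' v = h v + d" by (simp add: d_def)
    have e: "h'' v = h v + t * d" using v by (simp add: h''_def d_def algebra_simps)
    show ?thesis
    proof (cases "0 \<le> d")
      case True
      have "0 \<le> t * d" "t * d \<le> d" using True t by (simp_all add: mult_left_le_one_le)
      then have "h v \<le> h'' v" "h'' v \<le> h' v" unfolding e hv by simp_all
      then show ?thesis using level_convex[OF hX Lev[OF v]] by blast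
    next
      case False
      then have "0 \<le> t * (- d)" "t * (- d) \<le> - d" using t by (simp_all add: mult_left_le_one_le mult_nonneg_nonpos)
      then have "h' v \<le> h'' v" "h'' v \<le> h v" unfolding e hv by simp_all
      from level_convex[OF hX(2,1) Lev[OF v, symmetric] this] show ?thesis using Lev[OF v] by simp
    qed
  qed
  have "(h c - h a) + (h' a - h' c) \<noteq> 0" using less by simp
  then have "t * ((h c - h a) + (h' a - h' c)) = h c - h a" by (simp add: t_def)
  then have "h'' a = h'' c" using acV by (simp add: h''_def algebra_simps)
  moreover have "h'' \<in> proper_maps X V (E - {{a, c}})"
  proof (rule proper_mapsI)
    show "h'' \<in> extensional V" by (simp add: h''_def)
    show "h'' v \<in> X" if "v \<in> V" for v using lev[OF that] by blast
    show "h'' u \<noteq> h'' v" if "{u, v} \<in> E - {{a, c}}" for u v using signs[OF that] by blast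
  qed
  moreover have "order_type V (E - {{a, c}}) h'' = order_type V (E - {{a, c}}) h"
    unfolding order_type_eq_iff
  proof (intro conjI allI ballI impI)
    show "h'' u < h'' v \<longleftrightarrow> h u < h v" if "{u, v} \<in> E - {{a, c}}" for u v using signs[OF that] by simp
    show "L (h'' v) = L (h v)" if "v \<in> V" for v using lev[OF that] by simp
  qed
  ultimately show ?thesis by blast
qed

text \<open>A cell of the graph without \<open>ac\<close> is cut by the hyperplane \<open>h a = h c\<close> into two cells if it meets
  that hyperplane, and stays one cell otherwise. The cells that meet it are the types of the contracted
  graph.\<close>

lemma num_types_deletion_contraction:
  assumes g: "simple_graph V E" and ac: "{a, c} \<in> E"
  shows "num_types V E = num_types V (E - {{a, c}}) + num_types (V - {c}) (contract a c E)"
proof -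
  let ?E = "E - {{a, c}}"
  let ?S = "proper_maps X V ?E" and ?o = "order_type V (E - {{a, c}})"
  note acV = simple_graph_edge[OF g ac]
  have g0: "simple_graph V ?E" using g by (auto simp: simple_graph_def)
  define lt gt eq where "lt = {h \<in> ?S. h a < h c}" and "gt = {h \<in> ?S. h c < h a}"
    and "eq = {h \<in> ?S. h a = h c}"
  have fin: "finite (?o ` ?S)" by (rule finite_order_types[OF g0])
  have S: "?S = lt \<union> gt \<union> eq" by (auto simp: lt_def gt_def eq_def)
  have fins: "finite (?o ` lt)" "finite (?o ` gt)" by (rule finite_subset[OF _ fin], auto simp: S)+
  have inter: "?o ` lt \<inter> ?o ` gt = ?o ` eq"
  proof (intro equalityI subsetI)
    fix \<sigma> assume "\<sigma> \<in> ?o ` lt \<inter> ?o ` gt"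
    then obtain h h' where hh: "h \<in> lt" "h' \<in> gt" "\<sigma> = ?o h" "?o h = ?o h'" by auto
    obtain h'' where "h'' \<in> ?S" "h'' a = h'' c" "?o h'' = ?o h"
      using order_type_interpolate[OF g ac _ _ hh(4)] hh(1,2) by (auto simp: lt_def gt_def)
    then show "\<sigma> \<in> ?o ` eq" using hh(3) by (intro image_eqI[of _ _ h'']) (auto simp: eq_def)
  next
    fix \<sigma> assume "\<sigma> \<in> ?o ` eq"
    then obtain h where h: "h \<in> ?S" "h a = h c" "\<sigma> = ?o h" by (auto simp: eq_def)
    obtain \<epsilon> where \<epsilon>: "\<epsilon> > 0" "\<And>r. \<bar>r\<bar> < \<epsilon> \<Longrightarrow> h(a := h a + r) \<in> ?S \<and> ?o (h(a := h a + r)) = ?o h"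
      using order_type_perturb[OF g ac h(1)] by blast
    have "\<sigma> \<in> ?o ` lt"
      using \<epsilon>(1) \<epsilon>(2)[of "- \<epsilon> / 2"] h acV by (intro image_eqI[of _ _ "h(a := h a + - \<epsilon> / 2)"]) (auto simp: lt_def)
    moreover have "\<sigma> \<in> ?o ` gt"
      using \<epsilon>(1) \<epsilon>(2)[of "\<epsilon> / 2"] h acV by (intro image_eqI[of _ _ "h(a := h a + \<epsilon> / 2)"]) (auto simp: gt_def)
    ultimately show "\<sigma> \<in> ?o ` lt \<inter> ?o ` gt" by simp
  qed
  have "num_types V E = card ((\<lambda>h. (h a < h c, ?o h)) ` proper_maps X V E)"
    unfolding num_types_def
  proof (rule card_image_same_kernel)
    fix h h' assume hh: "h \<in> proper_maps X V E" "h' \<in> proper_maps X V E"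
    then have ne: "h a \<noteq> h c" "h' a \<noteq> h' c" using proper_maps_edge[OF _ ac] by blast+
    have edges_iff: "(\<forall>u v. {u, v} \<in> E \<longrightarrow> (h u < h v \<longleftrightarrow> h' u < h' v)) \<longleftrightarrow>
        (h a < h c \<longleftrightarrow> h' a < h' c) \<and> (\<forall>u v. {u, v} \<in> ?E \<longrightarrow> (h u < h v \<longleftrightarrow> h' u < h' v))" (is "?A \<longleftrightarrow> ?B")
    proof
      assume ?A then show ?B using ac by blast
    next
      assume B: ?B
      show ?A
      proof (intro allI impI)
        fix u v assume uv: "{u, v} \<in> E"
        show "h u < h v \<longleftrightarrow> h' u < h' v"
        proof (cases "{u, v} = {a, c}")
          case True
          then have "u = a \<and> v = c \<or> u = c \<and> v = a" by (simp add: doubleton_eq_iff)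
          then show ?thesis using B ne by auto
        qed (use B uv in blast)
      qed
    qed
    show "order_type V E h = order_type V E h' \<longleftrightarrow>
        (h a < h c, ?o h) = (h' a < h' c, ?o h')"
      by (simp only: order_type_eq_iff prod.inject edges_iff conj_assoc)
  qed
  also have "proper_maps X V E = lt \<union> gt"
    unfolding proper_maps_insert_edge[OF ac] by (auto simp: lt_def gt_def)
  also have "(\<lambda>h. (h a < h c, ?o h)) ` (lt \<union> gt) = Pair True ` ?o ` lt \<union> Pair False ` ?o ` gt"
    unfolding image_Un image_image by (intro arg_cong2[of _ _ _ _ "(\<union>)"] image_cong) (auto simp: lt_def gt_def)
  also have "card \<dots> = card (?o ` lt) + card (?o ` gt)"
    using fins by (subst card_Un_disjoint) (auto simp: card_image inj_on_def)
  also have "\<dots> = card (?o ` lt \<union> ?o ` gt) + card (?o ` lt \<inter> ?o ` gt)"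
    using fins by (rule card_Un_Int)
  also have "?o ` lt \<union> ?o ` gt = ?o ` ?S" unfolding S image_Un using inter by auto
  also have "card (?o ` lt \<inter> ?o ` gt) = num_types (V - {c}) (contract a c E)"
  proof -
    have bij: "(\<lambda>h. restrict h (V - {c})) ` eq = proper_maps X (V - {c}) (contract a c E)"
      using bij_betw_contract[OF g ac, of X] by (simp add: bij_betw_def eq_def)
    let ?o' = "\<lambda>h. order_type (V - {c}) (contract a c E) (restrict h (V - {c}))"
    have "card (?o ` eq) = card (?o' ` eq)"
    proof (rule card_image_same_kernel)
      fix h h' assume "h \<in> eq" "h' \<in> eq"
      then have h: "h a = h c" "h' a = h' c" by (auto simp: eq_def)
      have m: "h (merge_vertex a c w) = h w" "h' (merge_vertex a c w) = h' w" for w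
        using h by (auto simp: merge_vertex_def)
      have mV: "merge_vertex a c w \<in> V - {c}" if "w \<in> V" for w
        using that acV by (auto simp: merge_vertex_def)
      have edge: "u \<in> V" "v \<in> V" if "{u, v} \<in> ?E" for u v
        using simple_graph_edge[OF g0 that] by auto
      have "(\<forall>u v. {u, v} \<in> contract a c E \<longrightarrow>
          (restrict h (V - {c}) u < restrict h (V - {c}) v
            \<longleftrightarrow> restrict h' (V - {c}) u < restrict h' (V - {c}) v))
        \<longleftrightarrow> (\<forall>u v. {u, v} \<in> ?E \<longrightarrow> (h u < h v \<longleftrightarrow> h' u < h' v))" (is "?A \<longleftrightarrow> ?B")
      proof
        assume A: ?A
        show ?B
        proof (intro allI impI)
          fix u v assume uv: "{u, v} \<in> ?E"
          then have "{merge_vertex a c u, merge_vertex a c v} \<in> contract a c E"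
            using contract_edge_iff[OF g] by blast
          from A[rule_format, OF this] show "h u < h v \<longleftrightarrow> h' u < h' v"
            using mV edge[OF uv] by (simp add: m)
        qed
      next
        assume B: ?B
        show ?A
        proof (intro allI impI)
          fix u v assume "{u, v} \<in> contract a c E"
          then obtain p q where pq: "{p, q} \<in> ?E" "u = merge_vertex a c p" "v = merge_vertex a c q"
            using contract_edge_iff[OF g] by metis
          from B[rule_format, OF pq(1)] show "restrict h (V - {c}) u < restrict h (V - {c}) v
            \<longleftrightarrow> restrict h' (V - {c}) u < restrict h' (V - {c}) v"
            using mV edge[OF pq(1)] pq by (simp add: m)
        qed
      qed
      moreover have "(\<forall>v\<in>V - {c}. L (restrict h (V - {c}) v) = L (restrict h' (V - {c}) v))
          \<longleftrightarrow> (\<forall>v\<in>V. L (h v) = L (h' v))"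
      proof
        assume A: "\<forall>v\<in>V - {c}. L (restrict h (V - {c}) v) = L (restrict h' (V - {c}) v)"
        show "\<forall>v\<in>V. L (h v) = L (h' v)"
        proof
          fix v assume "v \<in> V"
          then show "L (h v) = L (h' v)"
            using bspec[OF A, of v] bspec[OF A, of a] h acV by (cases "v = c") simp_all
        qed
      qed simp
      ultimately show "?o h = ?o h' \<longleftrightarrow> ?o' h = ?o' h'" unfolding order_type_eq_iff by simp
    qed
    also have "?o' ` eq = order_type (V - {c}) (contract a c E) ` proper_maps X (V - {c}) (contract a c E)"
      by (simp add: bij[symmetric] image_image)
    finally show ?thesis by (simp add: inter num_types_def)
  qed
  finally show ?thesis by (simp add: num_types_def)
qed

lemma card_proper_maps_deletion_contraction:
  assumes g: "simple_graph V E" and ac: "{a, c} \<in> E" and Y: "finite Y"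
  shows "card (proper_maps Y V (E - {{a, c}}))
    = card (proper_maps Y V E) + card (proper_maps Y (V - {c}) (contract a c E))"
proof -
  have "finite V" using g by (simp add: simple_graph_def)
  then have "finite (V \<rightarrow>\<^sub>E Y)" using Y by (intro finite_PiE) auto
  then have fin: "finite (proper_maps Y V F)" for F by (simp add: proper_maps_def)
  have "proper_maps Y V (E - {{a, c}})
      = proper_maps Y V E \<union> {f \<in> proper_maps Y V (E - {{a, c}}). f a = f c}"
    unfolding proper_maps_insert_edge[OF ac] by auto
  also have "card \<dots> = card (proper_maps Y V E) + card {f \<in> proper_maps Y V (E - {{a, c}}). f a = f c}"
    by (rule card_Un_disjoint) (auto simp: fin proper_maps_insert_edge[OF ac])
  also have "card {f \<in> proper_maps Y V (E - {{a, c}}). f a = f c}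
      = card (proper_maps Y (V - {c}) (contract a c E))"
    by (rule bij_betw_same_card[OF bij_betw_contract[OF g ac]])
  finally show ?thesis .
qed

text \<open>Colourings satisfy \<open>\<chi>(E) = \<chi>(E - e) - \<chi>(E / e)\<close> and types satisfy \<open>N(E) = N(E - e) + N(E / e)\<close>.
  Contraction lowers the number of vertices by one, so the sign \<open>(-1)\<^sup>n\<close> matches the two recursions; without
  edges both sides are powers of the number of intervals. The same recursion shows that the numbers
  of colourings are the values of a polynomial.\<close>

theorem num_types_reciprocity:
  assumes "simple_graph V E"
  shows "\<exists>p :: int poly. (\<forall>q::nat. poly p (int q) = int (card (proper_colourings V E q))) \<and>
    (- 1) ^ card V * poly p (- int (card (L ` X))) = int (num_types V E)"
  using assms
proof (induction "card E" arbitrary: V E rule: less_induct)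
  case less
  have finV: "finite V" using less.prems by (simp add: simple_graph_def)
  show ?case
  proof (cases "E = {}")
    case True
    have "card (proper_colourings V {} q) = q ^ card V" for q
      using finV by (simp add: proper_colourings_def card_PiE)
    moreover have "(- 1) ^ card V * (- int (card (L ` X))) ^ card V = int (card (L ` X)) ^ card V"
      by (simp flip: power_mult_distrib)
    ultimately show ?thesis
      using finV True
      by (intro exI[of _ "monom 1 (card V)"]) (simp add: poly_monom num_types_no_edges)
  next
    case False
    then obtain a c where ac: "{a, c} \<in> E" using simple_graph_edge_obtain[OF less.prems] by blast
    note acV = simple_graph_edge[OF less.prems ac]
    have g0: "simple_graph V (E - {{a, c}})" using less.prems by (auto simp: simple_graph_def)
    have "card (E - {{a, c}}) < card E"
      using simple_graph_finite[OF less.prems] ac by (intro psubset_card_mono) auto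
    from less.hyps[OF this g0] obtain p0 :: "int poly" where
      p0: "\<And>q::nat. poly p0 (int q) = int (card (proper_colourings V (E - {{a, c}}) q))"
        "(- 1) ^ card V * poly p0 (- int (card (L ` X))) = int (num_types V (E - {{a, c}}))" by blast
    from less.hyps[OF card_contract_less[OF less.prems ac] simple_graph_contract[OF less.prems ac]]
    obtain p1 :: "int poly" where
      p1: "\<And>q::nat. poly p1 (int q) = int (card (proper_colourings (V - {c}) (contract a c E) q))"
        "(- 1) ^ card (V - {c}) * poly p1 (- int (card (L ` X))) = int (num_types (V - {c}) (contract a c E))"
      by blast
    have "card V = Suc (card (V - {c}))" using finV acV by (metis card.remove)
    then have sgn: "(- 1 :: int) ^ card V = - ((- 1) ^ card (V - {c}))" by simp
    show ?thesis
    proof (intro exI[of _ "p0 - p1"] conjI allI)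
      show "poly (p0 - p1) (int q) = int (card (proper_colourings V E q))" for q :: nat
        using card_proper_maps_deletion_contraction[OF less.prems ac, of "{..<q}"]
        by (simp add: p0 p1 proper_colourings_eq)
      show "(- 1) ^ card V * poly (p0 - p1) (- int (card (L ` X))) = int (num_types V E)"
        using p0(2) p1(2) unfolding num_types_deletion_contraction[OF less.prems ac]
        by (simp add: right_diff_distrib sgn)
    qed
  qed
qed

end

lemma chromatic_poly_eqI:
  assumes p: "\<And>q::nat. poly p (int q) = int (card (proper_colourings V E q))"
  shows "chromatic_poly V E = p"
  unfolding chromatic_poly_def
proof (rule the_equality)
  show "\<forall>q::nat. poly p (int q) = int (card (proper_colourings V E q))" using p by simp
  fix p' :: "int poly" assume p': "\<forall>q::nat. poly p' (int q) = int (card (proper_colourings V E q))"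
  have "range int \<subseteq> {y. poly (p' - p) y = 0}" using p p' by auto
  moreover have "infinite (range int)" by (simp add: finite_image_iff)
  ultimately have "infinite {y. poly (p' - p) y = 0}" using finite_subset by blast
  then show "p' = p" using poly_roots_finite[of "p' - p"] by auto
qed

context network begin

definition gap_set :: "real set" where
  "gap_set = {s. x b < s \<and> (\<exists>i\<le>k. s < x i) \<and> (\<forall>i\<le>k. s \<noteq> x i)}"

definition below :: "real \<Rightarrow> nat set" where
  "below s = {i. i \<le> k \<and> x i < s}"

sublocale gaps: level_sets gap_set below
proof
  show "r \<in> gap_set \<and> below r = below s"
    if "s \<in> gap_set" "t \<in> gap_set" "below s = below t" "s \<le> r" "r \<le> t" for s t r
  proof -
    have iff: "x i < s \<longleftrightarrow> x i < t" if "i \<le> k" for i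
      using \<open>below s = below t\<close> that by (auto simp: below_def set_eq_iff)
    have ne: "t \<noteq> x i" if "i \<le> k" for i using \<open>t \<in> gap_set\<close> that by (simp add: gap_set_def)
    have "x i < r \<longleftrightarrow> x i < s" "r \<noteq> x i" if "i \<le> k" for i
      using iff[OF that] ne[OF that] \<open>s \<le> r\<close> \<open>r \<le> t\<close> by linarith+
    moreover have "x b < r" using \<open>s \<in> gap_set\<close> \<open>s \<le> r\<close> by (simp add: gap_set_def)
    moreover have "\<exists>i\<le>k. r < x i" using \<open>t \<in> gap_set\<close> \<open>r \<le> t\<close> by (auto simp: gap_set_def)
    ultimately show ?thesis by (auto simp: gap_set_def below_def)
  qed
  show "\<exists>\<epsilon>>0. \<forall>r. \<bar>r - s\<bar> < \<epsilon> \<longrightarrow> r \<in> gap_set \<and> below r = below s" if s: "s \<in> gap_set" for s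
  proof -
    define \<epsilon> where "\<epsilon> = Min ((\<lambda>i. \<bar>x i - s\<bar>) ` {..k})"
    have "\<epsilon> > 0" using s by (auto simp: \<epsilon>_def gap_set_def)
    moreover have "\<epsilon> \<le> \<bar>x i - s\<bar>" if "i \<le> k" for i unfolding \<epsilon>_def using that by (intro Min_le) auto
    then have "r \<in> gap_set \<and> below r = below s" if r: "\<bar>r - s\<bar> < \<epsilon>" for r
    proof -
      have far: "\<bar>r - s\<bar> < \<bar>x i - s\<bar>" if "i \<le> k" for i using \<open>\<And>i. i \<le> k \<Longrightarrow> \<epsilon> \<le> \<bar>x i - s\<bar>\<close>[OF that] r by simp
      have iff: "(x i < r \<longleftrightarrow> x i < s) \<and> (r < x i \<longleftrightarrow> s < x i)" if "i \<le> k" for i using far[OF that] by auto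
      have "r \<noteq> x i" if "i \<le> k" for i using far[OF that] by auto
      then have "r \<in> gap_set" using s iff b unfolding gap_set_def by auto
      moreover have "below r = below s" using iff by (auto simp: below_def)
      ultimately show ?thesis by simp
    qed
    ultimately show ?thesis by blast
  qed
  show "finite (below ` gap_set)"
    by (rule finite_subset[of _ "Pow {..k}"]) (auto simp: below_def)
qed

text \<open>Each gap between consecutive boundary values is determined by its upper end, which can be any
  boundary value other than the least.\<close>

lemma card_below_gaps: "card (below ` gap_set) = k"
proof -
  define lower where "lower i = {j. j \<le> k \<and> x j < x i}" for i
  have "below ` gap_set = lower ` ({..k} - {b})"
  proof (intro equalityI subsetI)
    fix \<sigma> assume "\<sigma> \<in> below ` gap_set"
    then obtain s where s: "s \<in> gap_set" "\<sigma> = below s" by auto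
    \<comment> \<open>The upper end of the gap around \<open>s\<close> is the least boundary value above \<open>s\<close>.\<close>
    define A where "A = {i. i \<le> k \<and> s < x i}"
    have A: "finite A" "A \<noteq> {}" using s by (auto simp: A_def gap_set_def)
    obtain i where i: "i \<in> A" "\<And>j. j \<in> A \<Longrightarrow> x i \<le> x j"
      using ex_min_if_finite[of "x ` A"] A by (auto simp: not_less)
    have "below s = lower i"
      using i s by (auto simp: below_def lower_def A_def gap_set_def) (metis leD linorder_cases)
    moreover have "i \<noteq> b" using i(1) s(1) by (auto simp: A_def gap_set_def)
    ultimately show "\<sigma> \<in> lower ` ({..k} - {b})" using i(1) s(2) by (auto simp: A_def)
  next
    fix \<sigma> assume "\<sigma> \<in> lower ` ({..k} - {b})"
    then obtain i where i: "i \<le> k" "i \<noteq> b" "\<sigma> = lower i" by auto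
    have bl: "b \<in> lower i" using b_min[OF i(1,2)] b by (simp add: lower_def)
    have fin: "finite (lower i)" by (simp add: lower_def)
    \<comment> \<open>A point just below \<open>x i\<close> lies in the gap with upper end \<open>x i\<close>.\<close>
    define m where "m = Max (x ` lower i)"
    have m: "x j \<le> m" if "j \<in> lower i" for j using fin that by (auto simp: m_def)
    have "m \<in> x ` lower i" unfolding m_def using fin bl by (intro Max_in) auto
    then have mi: "m < x i" by (auto simp: lower_def)
    obtain s where s: "m < s" "s < x i" using dense[OF mi] by blast
    have iff: "x j < s \<longleftrightarrow> x j < x i" "x j \<noteq> s" if "j \<le> k" for j
      using m[of j] s that by (force simp: lower_def)+
    have "s \<in> gap_set" using iff i(1) s m[OF bl] unfolding gap_set_def by force
    moreover have "below s = \<sigma>" using iff i(3) by (auto simp: below_def lower_def)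
    ultimately show "\<sigma> \<in> below ` gap_set" by auto
  qed
  moreover have "inj_on lower ({..k} - {b})"
  proof (rule inj_onI)
    fix i j assume ij: "i \<in> {..k} - {b}" "j \<in> {..k} - {b}" "lower i = lower j"
    have "\<not> x i < x j" "\<not> x j < x i" using ij by (auto simp: lower_def set_eq_iff)
    then show "i = j" using inj_x ij(1,2) by (auto simp: inj_on_def)
  qed
  ultimately show ?thesis using b by (simp add: card_image)
qed

lemma finite_bounded_patterns [simp]: "finite bounded_patterns"
proof (rule finite_subset)
  show "bounded_patterns \<subseteq> Pow (V \<times> V) \<times> Pow (V \<times> {..k})"
    using nbrs_subset by (fastforce simp: bounded_patterns_def pattern_def)
qed simp

lemma card_bounded_patterns: "card bounded_patterns = gaps.num_types V E"
proof -
  have edge: "{v, u} \<in> E \<longleftrightarrow> v \<in> V \<and> u \<in> nbrs v" for v u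
    using simple_graph_edge[OF graph] by (auto simp: nbrs_def)
  have S: "{h. generic h \<and> (\<forall>v\<in>V. x b < h v \<and> (\<exists>i\<le>k. h v < x i))} = proper_maps gap_set V E"
    by (auto simp: generic_def proper_maps_def gap_set_def PiE_iff edge extensional_def)
  have "card (pattern ` proper_maps gap_set V E) = card (gaps.order_type V E ` proper_maps gap_set V E)"
  proof (rule card_image_same_kernel)
    fix h h' :: "'a \<Rightarrow> real"
    have "pattern h = pattern h' \<longleftrightarrow> (\<forall>v\<in>V. \<forall>u\<in>nbrs v. h u < h v \<longleftrightarrow> h' u < h' v) \<and>
        (\<forall>v\<in>V. \<forall>i\<le>k. x i < h v \<longleftrightarrow> x i < h' v)"
      by (auto simp: pattern_def set_eq_iff)
    also have "(\<forall>v\<in>V. \<forall>u\<in>nbrs v. h u < h v \<longleftrightarrow> h' u < h' v)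
        \<longleftrightarrow> (\<forall>u v. {u, v} \<in> E \<longrightarrow> (h u < h v \<longleftrightarrow> h' u < h' v))"
    proof -
      have "{u, v} \<in> E \<longleftrightarrow> v \<in> V \<and> u \<in> nbrs v" for u v
        using edge[of v u] by (simp add: insert_commute)
      then show ?thesis by auto
    qed
    also have "(\<forall>v\<in>V. \<forall>i\<le>k. x i < h v \<longleftrightarrow> x i < h' v) \<longleftrightarrow> (\<forall>v\<in>V. below (h v) = below (h' v))"
      by (auto simp: below_def set_eq_iff)
    finally show "pattern h = pattern h' \<longleftrightarrow> gaps.order_type V E h = gaps.order_type V E h'"
      unfolding gaps.order_type_eq_iff .
  qed
  then show ?thesis by (simp add: bounded_patterns_def S gaps.num_types_def)
qed

theorem card_bounded_patterns_chromatic: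
  "int (card bounded_patterns) = \<bar>poly (chromatic_poly V E) (- int k)\<bar>"
proof -
  obtain p :: "int poly" where
    p: "\<And>q::nat. poly p (int q) = int (card (proper_colourings V E q))"
      "(- 1) ^ card V * poly p (- int k) = int (gaps.num_types V E)"
    using gaps.num_types_reciprocity[OF graph] unfolding card_below_gaps by blast
  have "int (card bounded_patterns) = \<bar>(- 1) ^ card V * poly p (- int k)\<bar>"
    by (simp add: card_bounded_patterns p(2))
  also have "\<dots> = \<bar>poly p (- int k)\<bar>" by (simp add: abs_mult power_abs)
  finally show ?thesis by (simp add: chromatic_poly_eqI[OF p(1)])
qed

end

section \<open>From the simplex to the positive orthant\<close>

lemma nn_integral_leb_scale:
  fixes f :: "('i \<Rightarrow> real) \<Rightarrow> ennreal"
  assumes "finite I" "f \<in> borel_measurable (leb I)" "\<And>i. i \<in> I \<Longrightarrow> 0 < a i"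
  shows "(\<integral>\<^sup>+ c. f c \<partial>leb I) = (\<Prod>i\<in>I. ennreal (a i)) * (\<integral>\<^sup>+ y. f (\<lambda>i\<in>I. a i * y i) \<partial>leb I)"
  using assms
proof (induction I arbitrary: f rule: finite_induct)
  case empty
  have "(\<lambda>i\<in>{}. a i * y i) = y" if "y \<in> vecs {}" for y
    using that by auto
  then have "(\<integral>\<^sup>+ y. f (\<lambda>i\<in>{}. a i * y i) \<partial>leb {}) = (\<integral>\<^sup>+ y. f y \<partial>leb {})"
    by (intro nn_integral_cong arg_cong[where f = f]) (simp only: space_leb)
  then show ?case by (simp only: prod.empty mult_1)
next
  case (insert i I)
  note f[measurable] = insert.prems(1)
  have upd: "(\<lambda>(y, t). y(i := a i * t)) \<in> measurable (leb I \<Otimes>\<^sub>M lborel) (leb (insert i I))"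
  proof -
    have "(\<lambda>w. (fst w)(i := a i * snd w)) \<in> measurable (leb I \<Otimes>\<^sub>M lborel) (leb (insert i I))"
      by (rule measurable_fun_upd[where J = I]) auto
    then show ?thesis by (simp add: case_prod_beta)
  qed
  have upd1: "(\<lambda>t. y(i := t)) \<in> measurable borel (leb (insert i I))" if "y \<in> vecs I" for y
    using measurable_component_update[of y I "\<lambda>_. lborel" i] that insert.hyps by simp
  have F: "(\<lambda>y. \<integral>\<^sup>+ t. f (y(i := a i * t)) \<partial>lborel) \<in> borel_measurable (leb I)"
    using measurable_compose[OF upd f] by (intro lborel.borel_measurable_nn_integral) (simp add: case_prod_beta)
  have "(\<integral>\<^sup>+ c. f c \<partial>leb (insert i I)) = (\<integral>\<^sup>+ y. (\<integral>\<^sup>+ t. f (y(i := t)) \<partial>lborel) \<partial>leb I)"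
    using insert by (intro lborel_product.product_nn_integral_insert) auto
  also have "\<dots> = (\<integral>\<^sup>+ y. ennreal (a i) * (\<integral>\<^sup>+ t. f (y(i := a i * t)) \<partial>lborel) \<partial>leb I)"
  proof (rule nn_integral_cong)
    fix y assume "y \<in> space (leb I)"
    then have "(\<lambda>t. f (y(i := t))) \<in> borel_measurable borel"
      using measurable_compose[OF upd1 f] by simp
    from nn_integral_real_affine[OF this, of "a i" 0] insert.prems(2)[of i]
    show "(\<integral>\<^sup>+ t. f (y(i := t)) \<partial>lborel) = ennreal (a i) * (\<integral>\<^sup>+ t. f (y(i := a i * t)) \<partial>lborel)"
      by simp
  qed
  also have "\<dots> = ennreal (a i) * (\<integral>\<^sup>+ y. (\<integral>\<^sup>+ t. f (y(i := a i * t)) \<partial>lborel) \<partial>leb I)"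
    using F by (rule nn_integral_cmult)
  also have "(\<integral>\<^sup>+ y. (\<integral>\<^sup>+ t. f (y(i := a i * t)) \<partial>lborel) \<partial>leb I) = (\<Prod>i\<in>I. ennreal (a i)) *
      (\<integral>\<^sup>+ y. (\<integral>\<^sup>+ t. f ((\<lambda>j\<in>I. a j * y j)(i := a i * t)) \<partial>lborel) \<partial>leb I)"
    by (rule insert.IH[OF F]) (use insert.prems in auto)
  also have "(\<integral>\<^sup>+ y. (\<integral>\<^sup>+ t. f ((\<lambda>j\<in>I. a j * y j)(i := a i * t)) \<partial>lborel) \<partial>leb I)
      = (\<integral>\<^sup>+ y. (\<integral>\<^sup>+ t. f (\<lambda>j\<in>insert i I. a j * (y(i := t)) j) \<partial>lborel) \<partial>leb I)"
  proof (intro nn_integral_cong arg_cong[where f = f])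
    show "(\<lambda>j\<in>I. a j * y j)(i := a i * t) = (\<lambda>j\<in>insert i I. a j * (y(i := t)) j)" for y t
      using insert.hyps(2) by (auto simp: fun_eq_iff)
  qed
  also have "\<dots> = (\<integral>\<^sup>+ y. f (\<lambda>j\<in>insert i I. a j * y j) \<partial>leb (insert i I))"
    using insert.hyps by (intro lborel_product.product_nn_integral_insert[symmetric]) auto
  finally show ?case unfolding prod.insert[OF insert.hyps(1,2)] mult.assoc .
qed

lemma nn_integral_leb_reindex:
  assumes fin: "finite V" and inj: "inj_on s V" and f: "f \<in> borel_measurable (leb (s ` V))"
  shows "(\<integral>\<^sup>+ y. f y \<partial>leb (s ` V)) = (\<integral>\<^sup>+ z. f (\<lambda>e\<in>s ` V. z (the_inv_into V s e)) \<partial>leb V)"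
proof -
  let ?r = "\<lambda>z. \<lambda>e\<in>s ` V. z (the_inv_into V s e) :: real"
  have inv: "the_inv_into V s (s v) = v" if "v \<in> V" for v
    using the_inv_into_f_f[OF inj that] .
  have r: "?r \<in> measurable (leb V) (leb (s ` V))"
    by (intro measurable_restrict) (auto simp: inv)
  have "distr (leb V) (leb (s ` V)) ?r = leb (s ` V)"
  proof (rule lborel_product.PiM_eqI)
    fix A :: "'b \<Rightarrow> real set" assume A: "\<And>i. i \<in> s ` V \<Longrightarrow> A i \<in> sets lborel"
    have "?r -` Pi\<^sub>E (s ` V) A \<inter> space (leb V) = Pi\<^sub>E V (\<lambda>v. A (s v))"
      by (auto simp: PiE_iff inv)
    then show "emeasure (distr (leb V) (leb (s ` V)) ?r) (Pi\<^sub>E (s ` V) A) = (\<Prod>i\<in>s ` V. emeasure lborel (A i))"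
      using A fin r inj
      by (subst emeasure_distr) (auto simp: lborel_product.emeasure_PiM prod.reindex intro!: sets_PiM_I_finite)
  qed (use fin in auto)
  then have "(\<integral>\<^sup>+ y. f y \<partial>leb (s ` V)) = (\<integral>\<^sup>+ y. f y \<partial>distr (leb V) (leb (s ` V)) ?r)" by simp
  also have "\<dots> = (\<integral>\<^sup>+ z. f (?r z) \<partial>leb V)" using nn_integral_distr[OF r, of f] f by simp
  finally show ?thesis .
qed

lemma nn_integral_leb_swap:
  assumes "finite I" "finite J" "(\<lambda>w. f (fst w) (snd w)) \<in> borel_measurable (leb I \<Otimes>\<^sub>M leb J)"
  shows "(\<integral>\<^sup>+ c. (\<integral>\<^sup>+ h. f c h \<partial>leb J) \<partial>leb I) = (\<integral>\<^sup>+ h. (\<integral>\<^sup>+ c. f c h \<partial>leb I) \<partial>leb J)"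
proof -
  interpret pair_sigma_finite "leb I" "leb J"
    using assms by (intro pair_sigma_finite.intro lborel_product.sigma_finite)
  show ?thesis using Fubini'[of f] assms(3) by (simp add: case_prod_beta)
qed

lemma nn_integral_exp_positive:
  assumes I: "finite I"
  shows "(\<integral>\<^sup>+ z. ennreal (indicator {z. \<forall>i\<in>I. 0 < z i} z * exp (- (\<Sum>i\<in>I. z i))) \<partial>leb I) = 1"
proof -
  have one: "(\<integral>\<^sup>+ t. ennreal (indicator {0<..} t * exp (- t)) \<partial>lborel) = 1"
  proof -
    have "(\<integral>\<^sup>+ t. ennreal (indicator {0<..} t * exp (- t)) \<partial>lborel)
        = (\<integral>\<^sup>+ t. ennreal (t ^ 0 * exp (- t)) * indicator {0..} t \<partial>lborel)"
      by (rule nn_integral_cong_AE, rule AE_mp[OF AE_lborel_singleton[of 0]])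
        (auto simp: indicator_def)
    also have "\<dots> = 1" by (subst nn_intergal_power_times_exp_Ici) simp
    finally show ?thesis .
  qed
  have "(\<integral>\<^sup>+ z. ennreal (indicator {z. \<forall>i\<in>I. 0 < z i} z * exp (- (\<Sum>i\<in>I. z i))) \<partial>leb I)
      = (\<integral>\<^sup>+ z. (\<Prod>i\<in>I. ennreal (indicator {0<..} (z i) * exp (- z i))) \<partial>leb I)"
  proof (rule nn_integral_cong)
    fix z :: "'a \<Rightarrow> real"
    have "(\<Prod>i\<in>I. ennreal (indicator {0<..} (z i) * exp (- z i)))
        = ennreal (\<Prod>i\<in>I. indicator {0<..} (z i) * exp (- z i))"
      by (rule prod_ennreal) simp
    also have "(\<Prod>i\<in>I. indicator {0<..} (z i) * exp (- z i)) =
        (\<Prod>i\<in>I. indicator {0<..} (z i)) * exp (- (\<Sum>i\<in>I. z i))"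
      using I by (simp add: prod.distrib exp_sum sum_negf[symmetric])
    also have "(\<Prod>i\<in>I. indicator {0<..} (z i) :: real) = indicator {z. \<forall>i\<in>I. 0 < z i} z"
      using I by (auto simp: indicator_def)
    finally show "ennreal (indicator {z. \<forall>i\<in>I. 0 < z i} z * exp (- (\<Sum>i\<in>I. z i)))
        = (\<Prod>i\<in>I. ennreal (indicator {0<..} (z i) * exp (- z i)))" by simp
  qed
  also have "\<dots> = (\<Prod>i\<in>I. \<integral>\<^sup>+ t. ennreal (indicator {0<..} t * exp (- t)) \<partial>lborel)"
    using I by (intro lborel_product.product_nn_integral_prod) auto
  finally show ?thesis by (simp add: one)
qed

lemma nn_integral_power_exp:
  assumes z: "0 < z"
  shows "(\<integral>\<^sup>+ r. ennreal (indicator {0<..} r * (r ^ n * exp (- (r * z)))) \<partial>lborel) = ennreal (fact n / z ^ Suc n)"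
proof -
  have "(\<integral>\<^sup>+ r. ennreal (indicator {0<..} r * (r ^ n * exp (- (r * z)))) \<partial>lborel)
      = ennreal (1 / z) * (\<integral>\<^sup>+ s. ennreal (indicator {0<..} (s / z) * ((s / z) ^ n * exp (- s))) \<partial>lborel)"
    using z by (subst nn_integral_real_affine[of _ "1 / z" 0]) auto
  also have "(\<integral>\<^sup>+ s. ennreal (indicator {0<..} (s / z) * ((s / z) ^ n * exp (- s))) \<partial>lborel)
      = (\<integral>\<^sup>+ s. ennreal (1 / z ^ n) * (ennreal (s ^ n * exp (- s)) * indicator {0..} s) \<partial>lborel)"
    by (rule nn_integral_cong_AE, rule AE_mp[OF AE_lborel_singleton[of 0]])
      (use z in \<open>auto simp: indicator_def zero_less_divide_iff power_divide ennreal_mult[symmetric] field_simps\<close>)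
  also have "\<dots> = ennreal (1 / z ^ n) * real_of_nat (fact n)"
    by (subst nn_integral_cmult) (auto simp: nn_intergal_power_times_exp_Ici)
  finally show ?thesis
    using z by (simp add: ennreal_mult[symmetric] mult.commute)
qed

definition simplex_chart :: "'i set \<Rightarrow> 'i \<Rightarrow> ('i \<Rightarrow> real) \<Rightarrow> 'i \<Rightarrow> real" where
  "simplex_chart I i = (\<lambda>c. c(i := 1 - (\<Sum>j\<in>I - {i}. c j)))"

text \<open>Polar coordinates with respect to the sum of the coordinates: the coordinate \<open>i\<close> is replaced
  by the sum \<open>r\<close>, and the others are then divided by \<open>r\<close>.\<close>

lemma nn_integral_cone:
  fixes G :: "('i \<Rightarrow> real) \<Rightarrow> ennreal"
  assumes I: "finite I" "i \<in> I" and G: "G \<in> borel_measurable (leb I)"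
    and supp: "\<And>c. c \<in> vecs I \<Longrightarrow> \<not> (\<forall>i\<in>I. 0 < c i) \<Longrightarrow> G c = 0"
  shows "(\<integral>\<^sup>+ c. G c \<partial>leb I) = (\<integral>\<^sup>+ \<omega>. (\<integral>\<^sup>+ r.
    ennreal (indicator {0<..} r * r ^ card (I - {i})) * G (\<lambda>j\<in>I. r * simplex_chart I i \<omega> j) \<partial>lborel) \<partial>leb (I - {i}))"
proof -
  let ?J = "I - {i}"
  define u where "u r c = (\<lambda>j\<in>I. if j = i then r - (\<Sum>j\<in>?J. c j) else c j)" for r and c :: "'i \<Rightarrow> real"
  have J: "finite ?J" "i \<notin> ?J" "insert i ?J = I" using I by auto
  have u_meas: "(\<lambda>w. u (fst w) (snd w)) \<in> measurable (lborel \<Otimes>\<^sub>M leb ?J) (leb I)"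
    unfolding u_def
  proof (rule measurable_restrict)
    fix j assume "j \<in> I"
    then show "(\<lambda>w. if j = i then fst w - (\<Sum>j\<in>?J. snd w j) else snd w j) \<in> measurable (lborel \<Otimes>\<^sub>M leb ?J) lborel"
      by (cases "j = i") (auto intro!: borel_measurable_diff borel_measurable_sum
          measurable_compose[OF measurable_snd measurable_component_singleton] simp del: measurable_lborel1)
  qed
  have Gu: "(\<lambda>w. G (u (fst w) (snd w))) \<in> borel_measurable (lborel \<Otimes>\<^sub>M leb ?J)"
    by (rule measurable_compose[OF u_meas G])
  have upd: "u r c = c(i := r - (\<Sum>j\<in>?J. c j))" if "c \<in> vecs ?J" for r c
    using that I by (auto simp: u_def fun_eq_iff PiE_iff extensional_def)
  have swap: "(\<integral>\<^sup>+ c. (\<integral>\<^sup>+ r. H r c \<partial>lborel) \<partial>leb ?J) = (\<integral>\<^sup>+ r. (\<integral>\<^sup>+ c. H r c \<partial>leb ?J) \<partial>lborel)"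
    if "(\<lambda>w. H (fst w) (snd w)) \<in> borel_measurable (lborel \<Otimes>\<^sub>M leb ?J)" for H :: "real \<Rightarrow> ('i \<Rightarrow> real) \<Rightarrow> ennreal"
  proof -
    interpret pair_sigma_finite lborel "leb ?J"
      using J by (intro pair_sigma_finite.intro lborel_product.sigma_finite sigma_finite_lborel)
    show ?thesis using Fubini[of "\<lambda>w. H (fst w) (snd w)"] that by simp
  qed
  have "(\<integral>\<^sup>+ c. G c \<partial>leb I) = (\<integral>\<^sup>+ c. (\<integral>\<^sup>+ t. G (c(i := t)) \<partial>lborel) \<partial>leb ?J)"
    using lborel_product.product_nn_integral_insert[OF J(1,2), of G] G J(3) by simp
  also have "\<dots> = (\<integral>\<^sup>+ c. (\<integral>\<^sup>+ r. G (u r c) \<partial>lborel) \<partial>leb ?J)"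
  proof (rule nn_integral_cong)
    fix c assume "c \<in> space (leb ?J)"
    then have c: "c \<in> vecs ?J" by simp
    have "(\<lambda>t. c(i := t)) \<in> measurable lborel (leb (insert i ?J))"
      by (rule measurable_component_update) (use c J in auto)
    then have "(\<lambda>t. G (c(i := t))) \<in> borel_measurable borel"
      using measurable_compose[of _ lborel "leb I", OF _ G] J(3) by simp
    from nn_integral_real_affine[OF this, of 1 "- (\<Sum>j\<in>?J. c j)"]
    show "(\<integral>\<^sup>+ t. G (c(i := t)) \<partial>lborel) = (\<integral>\<^sup>+ r. G (u r c) \<partial>lborel)"
      by (simp add: upd[OF c] add.commute)
  qed
  also have "\<dots> = (\<integral>\<^sup>+ r. (\<integral>\<^sup>+ c. G (u r c) \<partial>leb ?J) \<partial>lborel)"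
    by (rule swap[OF Gu])
  also have "\<dots> = (\<integral>\<^sup>+ r. (\<integral>\<^sup>+ \<omega>. ennreal (indicator {0<..} r * r ^ card ?J) *
      G (\<lambda>j\<in>I. r * simplex_chart I i \<omega> j) \<partial>leb ?J) \<partial>lborel)"
  proof (rule nn_integral_cong)
    fix r :: real
    have Gr: "(\<lambda>c. G (u r c)) \<in> borel_measurable (leb ?J)"
      using measurable_compose[OF measurable_Pair1' Gu, of r] by simp
    have "(\<integral>\<^sup>+ c. G (u r c) \<partial>leb ?J) = ennreal (indicator {0<..} r * r ^ card ?J) *
        (\<integral>\<^sup>+ \<omega>. G (u r (\<lambda>j\<in>?J. r * \<omega> j)) \<partial>leb ?J)"
    proof (cases "0 < r")
      case True
      then show ?thesis
        using nn_integral_leb_scale[OF J(1) Gr, of "\<lambda>_. r"] by (simp add: ennreal_power)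
    next
      case False
      have "G (u r c) = 0" if c: "c \<in> vecs ?J" for c
      proof (rule supp)
        show "\<not> (\<forall>j\<in>I. 0 < u r c j)"
        proof
          assume pos: "\<forall>j\<in>I. 0 < u r c j"
          have "0 \<le> (\<Sum>j\<in>?J. c j)"
          proof (rule sum_nonneg)
            fix j assume "j \<in> ?J" then show "0 \<le> c j" using bspec[OF pos, of j] by (auto simp: u_def)
          qed
          then show False using bspec[OF pos I(2)] False I(2) by (simp add: u_def)
        qed
      qed (simp add: u_def)
      then have "(\<integral>\<^sup>+ c. G (u r c) \<partial>leb ?J) = (\<integral>\<^sup>+ c. 0 \<partial>leb ?J)"
        by (intro nn_integral_cong) simp
      then show ?thesis using False by simp
    qed
    also have "(\<integral>\<^sup>+ \<omega>. G (u r (\<lambda>j\<in>?J. r * \<omega> j)) \<partial>leb ?J) = (\<integral>\<^sup>+ \<omega>. G (\<lambda>j\<in>I. r * simplex_chart I i \<omega> j) \<partial>leb ?J)"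
    proof (intro nn_integral_cong arg_cong[where f = G])
      show "u r (\<lambda>j\<in>?J. r * \<omega> j) = (\<lambda>j\<in>I. r * simplex_chart I i \<omega> j)" for \<omega>
        by (auto simp: u_def simplex_chart_def fun_eq_iff right_diff_distrib sum_distrib_left)
    qed
    also have "ennreal (indicator {0<..} r * r ^ card ?J) * (\<integral>\<^sup>+ \<omega>. G (\<lambda>j\<in>I. r * simplex_chart I i \<omega> j) \<partial>leb ?J)
      = (\<integral>\<^sup>+ \<omega>. ennreal (indicator {0<..} r * r ^ card ?J) * G (\<lambda>j\<in>I. r * simplex_chart I i \<omega> j) \<partial>leb ?J)"
    proof (rule nn_integral_cmult[symmetric])
      have "(\<lambda>\<omega>. \<lambda>j\<in>I. r * simplex_chart I i \<omega> j) \<in> measurable (leb ?J) (leb I)"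
      proof (rule measurable_restrict)
        fix j assume "j \<in> I"
        then show "(\<lambda>\<omega>. r * simplex_chart I i \<omega> j) \<in> measurable (leb ?J) lborel"
          by (cases "j = i") (auto simp: simplex_chart_def intro!: borel_measurable_times borel_measurable_diff borel_measurable_sum)
      qed
      from measurable_compose[OF this G]
      show "(\<lambda>\<omega>. G (\<lambda>j\<in>I. r * simplex_chart I i \<omega> j)) \<in> borel_measurable (leb ?J)" .
    qed
    finally show "(\<integral>\<^sup>+ c. G (u r c) \<partial>leb ?J) = (\<integral>\<^sup>+ \<omega>. ennreal (indicator {0<..} r * r ^ card ?J) *
      G (\<lambda>j\<in>I. r * simplex_chart I i \<omega> j) \<partial>leb ?J)" .
  qed
  also have "\<dots> = (\<integral>\<^sup>+ \<omega>. (\<integral>\<^sup>+ r. ennreal (indicator {0<..} r * r ^ card ?J) *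
      G (\<lambda>j\<in>I. r * simplex_chart I i \<omega> j) \<partial>lborel) \<partial>leb ?J)"
  proof (rule swap[symmetric])
    have "(\<lambda>w. \<lambda>j\<in>I. fst w * simplex_chart I i (snd w) j) \<in> measurable (lborel \<Otimes>\<^sub>M leb ?J) (leb I)"
    proof (rule measurable_restrict)
      fix j assume "j \<in> I"
      then show "(\<lambda>w. fst w * simplex_chart I i (snd w) j) \<in> measurable (lborel \<Otimes>\<^sub>M leb ?J) lborel"
        by (cases "j = i") (auto simp: simplex_chart_def intro!: borel_measurable_times borel_measurable_diff
            borel_measurable_sum measurable_compose[OF measurable_snd measurable_component_singleton])
    qed
    note [measurable] = measurable_compose[OF this G]
    show "(\<lambda>w. ennreal (indicator {0<..} (fst w) * fst w ^ card ?J) * G (\<lambda>j\<in>I. fst w * simplex_chart I i (snd w) j))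
        \<in> borel_measurable (lborel \<Otimes>\<^sub>M leb ?J)"
      by measurable
  qed
  finally show ?thesis .
qed

abbreviation orthant :: "'i set \<Rightarrow> ('i \<Rightarrow> real) set" where
  "orthant I \<equiv> Pi\<^sub>E I (\<lambda>_. {0<..})"

lemma simplex_chart_measurable:
  assumes "finite I" "i \<in> I"
  shows "simplex_chart I i \<in> measurable (leb (I - {i})) (leb I)"
  unfolding simplex_chart_def by (rule chart_measurable[OF assms])

lemma simplex_chart_in_open_simplex_iff:
  assumes I: "finite I" "i \<in> I" and \<omega>: "\<omega> \<in> vecs (I - {i})"
  shows "simplex_chart I i \<omega> \<in> open_simplex I \<longleftrightarrow> (\<forall>j\<in>I. 0 < simplex_chart I i \<omega> j)"
    and "simplex_chart I i \<omega> \<in> vecs I"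
proof -
  have "(\<Sum>j\<in>I. simplex_chart I i \<omega> j) = simplex_chart I i \<omega> i + (\<Sum>j\<in>I - {i}. simplex_chart I i \<omega> j)"
    using I by (rule sum.remove)
  also have "(\<Sum>j\<in>I - {i}. simplex_chart I i \<omega> j) = (\<Sum>j\<in>I - {i}. \<omega> j)"
    by (rule sum.cong) (auto simp: simplex_chart_def)
  finally have "(\<Sum>j\<in>I. simplex_chart I i \<omega> j) = 1" by (simp add: simplex_chart_def)
  moreover show ext: "simplex_chart I i \<omega> \<in> vecs I"
    using \<omega> I(2) by (auto simp: simplex_chart_def PiE_iff extensional_def)
  ultimately show "simplex_chart I i \<omega> \<in> open_simplex I \<longleftrightarrow> (\<forall>j\<in>I. 0 < simplex_chart I i \<omega> j)"
    by (auto simp: open_simplex_def PiE_iff)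
qed

lemma sets_open_simplex [measurable]:
  assumes "finite I"
  shows "open_simplex I \<in> sets (leb I)"
proof -
  have "orthant I \<in> sets (leb I)" using assms by (intro sets_PiM_I_finite) auto
  moreover have "{c \<in> space (leb I). (\<Sum>i\<in>I. c i) = 1} \<in> sets (leb I)" by measurable
  ultimately have "orthant I \<inter> {c \<in> space (leb I). (\<Sum>i\<in>I. c i) = 1} \<in> sets (leb I)" by blast
  then show ?thesis by (rule back_subst[of "\<lambda>A. A \<in> sets (leb I)"]) (auto simp: open_simplex_def)
qed

lemma nn_integral_homogeneous_cone:
  fixes Q Z :: "('i \<Rightarrow> real) \<Rightarrow> real"
  assumes I: "finite I" "i \<in> I"
    and mQ: "(\<lambda>c. indicator (orthant I) c * Q c) \<in> borel_measurable (leb I)"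
    and mZ: "(\<lambda>c. indicator (orthant I) c * Z c) \<in> borel_measurable (leb I)"
    and Q_nonneg: "\<And>c. c \<in> orthant I \<Longrightarrow> 0 \<le> Q c" and Z_pos: "\<And>c. c \<in> orthant I \<Longrightarrow> 0 < Z c"
    and Q_hom: "\<And>c r. c \<in> orthant I \<Longrightarrow> 0 < r \<Longrightarrow> Q (\<lambda>j\<in>I. r * c j) = Q c"
    and Z_hom: "\<And>c r. c \<in> orthant I \<Longrightarrow> 0 < r \<Longrightarrow> Z (\<lambda>j\<in>I. r * c j) = r * Z c"
  shows "(\<integral>\<^sup>+ c. ennreal (indicator (orthant I) c * (Q c * exp (- Z c))) \<partial>leb I)
    = ennreal (fact (card I - 1)) * (\<integral>\<^sup>+ \<omega>. ennreal (indicator (open_simplex I) (simplex_chart I i \<omega>) *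
        (Q (simplex_chart I i \<omega>) / Z (simplex_chart I i \<omega>) ^ card I)) \<partial>leb (I - {i}))"
proof -
  let ?\<chi> = "simplex_chart I i" and ?n = "card (I - {i})"
  define G where "G c = ennreal (indicator (orthant I) c * (Q c * exp (- Z c)))" for c
  have card: "card I = Suc ?n" using card.remove[OF I] .
  have PI: "orthant I \<in> sets (leb I)" using I by (intro sets_PiM_I_finite) auto
  have "(\<lambda>c. indicator (orthant I) c * Q c * exp (- (indicator (orthant I) c * Z c))) \<in> borel_measurable (leb I)"
    using mQ mZ by simp
  moreover have "(\<lambda>c. indicator (orthant I) c * Q c * exp (- (indicator (orthant I) c * Z c)))
      = (\<lambda>c. indicator (orthant I) c * (Q c * exp (- Z c)))"
    by (auto simp: indicator_def)
  ultimately have G: "G \<in> borel_measurable (leb I)" unfolding G_def by simp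
  have "(\<integral>\<^sup>+ c. G c \<partial>leb I) = (\<integral>\<^sup>+ \<omega>. (\<integral>\<^sup>+ r.
      ennreal (indicator {0<..} r * r ^ ?n) * G (\<lambda>j\<in>I. r * ?\<chi> \<omega> j) \<partial>lborel) \<partial>leb (I - {i}))"
    by (rule nn_integral_cone[OF I G]) (auto simp: G_def indicator_def PiE_iff)
  also have "\<dots> = (\<integral>\<^sup>+ \<omega>. ennreal (fact ?n) * ennreal (indicator (open_simplex I) (?\<chi> \<omega>) *
        (Q (?\<chi> \<omega>) / Z (?\<chi> \<omega>) ^ card I)) \<partial>leb (I - {i}))"
  proof (rule nn_integral_cong)
    fix \<omega> assume "\<omega> \<in> space (leb (I - {i}))"
    then have \<omega>: "\<omega> \<in> vecs (I - {i})" by simp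
    note in_simplex = simplex_chart_in_open_simplex_iff[OF I \<omega>]
    show "(\<integral>\<^sup>+ r. ennreal (indicator {0<..} r * r ^ ?n) * G (\<lambda>j\<in>I. r * ?\<chi> \<omega> j) \<partial>lborel)
      = ennreal (fact ?n) * ennreal (indicator (open_simplex I) (?\<chi> \<omega>) * (Q (?\<chi> \<omega>) / Z (?\<chi> \<omega>) ^ card I))"
    proof (cases "?\<chi> \<omega> \<in> open_simplex I")
      case True
      then have c: "?\<chi> \<omega> \<in> orthant I" by (auto simp: open_simplex_def)
      have "ennreal (indicator {0<..} r * r ^ ?n) * G (\<lambda>j\<in>I. r * ?\<chi> \<omega> j)
          = ennreal (Q (?\<chi> \<omega>)) * ennreal (indicator {0<..} r * (r ^ ?n * exp (- (r * Z (?\<chi> \<omega>)))))" for r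
      proof (cases "0 < r")
        case r: True
        then have "(\<lambda>j\<in>I. r * ?\<chi> \<omega> j) \<in> orthant I" using c by (auto simp: PiE_iff)
        then show ?thesis
          using r Q_hom[OF c r] Z_hom[OF c r] Q_nonneg[OF c]
          by (simp add: G_def ennreal_mult[symmetric] mult_ac)
      qed simp
      then have "(\<integral>\<^sup>+ r. ennreal (indicator {0<..} r * r ^ ?n) * G (\<lambda>j\<in>I. r * ?\<chi> \<omega> j) \<partial>lborel)
          = ennreal (Q (?\<chi> \<omega>)) * (\<integral>\<^sup>+ r. ennreal (indicator {0<..} r * (r ^ ?n * exp (- (r * Z (?\<chi> \<omega>))))) \<partial>lborel)"
        by (simp add: nn_integral_cmult)
      also have "\<dots> = ennreal (Q (?\<chi> \<omega>)) * ennreal (fact ?n / Z (?\<chi> \<omega>) ^ Suc ?n)"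
        by (simp only: nn_integral_power_exp[OF Z_pos[OF c]])
      also have "\<dots> = ennreal (fact ?n) * ennreal (Q (?\<chi> \<omega>) / Z (?\<chi> \<omega>) ^ card I)"
        using Q_nonneg[OF c] Z_pos[OF c] by (simp add: card ennreal_mult[symmetric] mult.commute)
      finally show ?thesis using True by simp
    next
      case False
      then obtain j where j: "j \<in> I" "?\<chi> \<omega> j \<le> 0" using in_simplex by (auto simp: not_less)
      have "ennreal (indicator {0<..} r * r ^ ?n) * G (\<lambda>j\<in>I. r * ?\<chi> \<omega> j) = 0" for r
      proof (cases "0 < r")
        case True
        then have "r * ?\<chi> \<omega> j \<le> 0" using j by (simp add: mult_nonneg_nonpos)
        then have "(\<lambda>j\<in>I. r * ?\<chi> \<omega> j) \<notin> orthant I" using j(1) by (auto simp: PiE_iff not_less)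
        then show ?thesis by (simp add: G_def)
      qed simp
      then have "(\<integral>\<^sup>+ r. ennreal (indicator {0<..} r * r ^ ?n) * G (\<lambda>j\<in>I. r * ?\<chi> \<omega> j) \<partial>lborel)
          = (\<integral>\<^sup>+ r. 0 \<partial>(lborel :: real measure))"
        by (intro nn_integral_cong)
      then show ?thesis using False by simp
    qed
  qed
  also have "\<dots> = ennreal (fact ?n) * (\<integral>\<^sup>+ \<omega>. ennreal (indicator (open_simplex I) (?\<chi> \<omega>) *
        (Q (?\<chi> \<omega>) / Z (?\<chi> \<omega>) ^ card I)) \<partial>leb (I - {i}))"
  proof (rule nn_integral_cmult)
    have "(\<lambda>c. indicator (open_simplex I) c * (indicator (orthant I) c * Q c / (indicator (orthant I) c * Z c) ^ card I))
        \<in> borel_measurable (leb I)"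
      using mQ mZ sets_open_simplex[OF I(1)] by simp
    moreover have "(\<lambda>c. indicator (open_simplex I) c * (indicator (orthant I) c * Q c / (indicator (orthant I) c * Z c) ^ card I))
        = (\<lambda>c. indicator (open_simplex I) c * (Q c / Z c ^ card I))"
      by (auto simp: indicator_def open_simplex_def)
    ultimately have "(\<lambda>c. indicator (open_simplex I) c * (Q c / Z c ^ card I)) \<in> borel_measurable (leb I)"
      by simp
    from measurable_compose[OF simplex_chart_measurable[OF I] this]
    show "(\<lambda>\<omega>. ennreal (indicator (open_simplex I) (?\<chi> \<omega>) * (Q (?\<chi> \<omega>) / Z (?\<chi> \<omega>) ^ card I)))
        \<in> borel_measurable (leb (I - {i}))" by simp
  qed
  finally show ?thesis by (simp add: G_def card)
qed

text \<open>The Gamma integral along each ray gives the factor \<open>(card I - 1)!\<close>, and the surface element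
  contributes \<open>sqrt (card I)\<close>. Both occur in the volume of the simplex as well, which is the case
  \<open>Q = 1\<close> and \<open>Z = \<Sum>\<^sub>j c\<^sub>j\<close>, and cancel.\<close>

theorem simplex_average:
  fixes Q Z :: "('i \<Rightarrow> real) \<Rightarrow> real"
  assumes I: "finite I" "I \<noteq> {}"
    and mQ: "(\<lambda>c. indicator (orthant I) c * Q c) \<in> borel_measurable (leb I)"
    and mZ: "(\<lambda>c. indicator (orthant I) c * Z c) \<in> borel_measurable (leb I)"
    and Q_nonneg: "\<And>c. c \<in> orthant I \<Longrightarrow> 0 \<le> Q c" and Z_pos: "\<And>c. c \<in> orthant I \<Longrightarrow> 0 < Z c"
    and Q_hom: "\<And>c r. c \<in> orthant I \<Longrightarrow> 0 < r \<Longrightarrow> Q (\<lambda>j\<in>I. r * c j) = Q c"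
    and Z_hom: "\<And>c r. c \<in> orthant I \<Longrightarrow> 0 < r \<Longrightarrow> Z (\<lambda>j\<in>I. r * c j) = r * Z c"
    and K: "(\<integral>\<^sup>+ c. ennreal (indicator (orthant I) c * (Q c * exp (- Z c))) \<partial>leb I) = ennreal K" "0 \<le> K"
  shows "1 / measure (hyperplane_lebesgue I) (open_simplex I) *
    (LINT c:open_simplex I|hyperplane_lebesgue I. Q c / Z c ^ card I) = K"
proof -
  obtain i where i: "i \<in> I" using I(2) by auto
  let ?\<chi> = "simplex_chart I i" and ?S = "open_simplex I"
  define s where "s = sqrt (real (card I))"
  define F :: real where "F = fact (card I - 1)"
  have s: "0 < s" using I by (simp add: s_def card_gt_0_iff)
  have F: "0 < F" by (simp add: F_def)
  have HL: "hyperplane_lebesgue I = scale_measure (ennreal s) (distr (leb (I - {i})) (leb I) ?\<chi>)"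
    unfolding hyperplane_lebesgue_eq_chart[OF I(1) i] hyperplane_lebesgue_chart_def simplex_chart_def s_def ..
  have integral_HL: "(\<integral>\<^sup>+ c. f c \<partial>hyperplane_lebesgue I) = ennreal s * (\<integral>\<^sup>+ \<omega>. f (?\<chi> \<omega>) \<partial>leb (I - {i}))"
    if "f \<in> borel_measurable (leb I)" for f
    unfolding HL using that simplex_chart_measurable[OF I(1) i]
    by (subst nn_integral_scale_measure) (auto simp: nn_integral_distr)
  have sets_HL: "sets (hyperplane_lebesgue I) = sets (leb I)" by (simp add: HL)
  have cancel: "X = ennreal (a / F)" if "ennreal F * X = ennreal a" "0 \<le> a" for X a
  proof -
    have "X \<noteq> \<infinity>" using that(1) F by (auto simp: ennreal_mult_top)
    then obtain X' where X': "X = ennreal X'" "0 \<le> X'" by (cases X) auto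
    then have "F * X' = a" using that F by (simp add: ennreal_mult[symmetric])
    then have "X' = a / F" using F by (simp add: eq_divide_eq mult.commute)
    then show ?thesis using X' by simp
  qed
  define q where "q c = indicator ?S c * (Q c / Z c ^ card I)" for c
  have "(\<lambda>c. indicator ?S c * (indicator (orthant I) c * Q c / (indicator (orthant I) c * Z c) ^ card I))
      \<in> borel_measurable (leb I)"
    using mQ mZ sets_open_simplex[OF I(1)] by simp
  moreover have "(\<lambda>c. indicator ?S c * (indicator (orthant I) c * Q c / (indicator (orthant I) c * Z c) ^ card I)) = q"
    by (auto simp: indicator_def open_simplex_def q_def)
  ultimately have q: "q \<in> borel_measurable (leb I)" by simp
  have q_nonneg: "0 \<le> q c" for c
    using Q_nonneg[of c] Z_pos[of c] by (auto simp: q_def indicator_def open_simplex_def intro!: divide_nonneg_pos)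
  have "ennreal F * (\<integral>\<^sup>+ \<omega>. ennreal (q (?\<chi> \<omega>)) \<partial>leb (I - {i})) = ennreal K"
    using nn_integral_homogeneous_cone[of I i Q Z, folded, OF I(1) i mQ mZ Q_nonneg Z_pos Q_hom Z_hom] K(1)
    by (simp add: F_def q_def)
  from cancel[OF this K(2)] have "(\<integral>\<^sup>+ c. ennreal (q c) \<partial>hyperplane_lebesgue I) = ennreal s * ennreal (K / F)"
    using q by (simp add: integral_HL)
  also have "\<dots> = ennreal (s * (K / F))" using s F K(2) by (intro ennreal_mult[symmetric]) auto
  finally have int_q: "(\<integral>\<^sup>+ c. ennreal (q c) \<partial>hyperplane_lebesgue I) = ennreal (s * (K / F))" .
  have "(LINT c:?S|hyperplane_lebesgue I. Q c / Z c ^ card I) = (LINT c|hyperplane_lebesgue I. q c)"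
    by (simp add: set_lebesgue_integral_def q_def)
  also have "\<dots> = enn2real (\<integral>\<^sup>+ c. ennreal (q c) \<partial>hyperplane_lebesgue I)"
    using q q_nonneg by (intro integral_eq_nn_integral) (auto cong: measurable_cong_sets simp: measurable_cong_sets[OF sets_HL refl])
  also have "\<dots> = s * (K / F)" using s F K(2) by (simp add: int_q)
  finally have LINT: "(LINT c:?S|hyperplane_lebesgue I. Q c / Z c ^ card I) = s * (K / F)" .
  have "ennreal F * (\<integral>\<^sup>+ \<omega>. ennreal (indicator ?S (?\<chi> \<omega>) * (1 / (\<Sum>j\<in>I. ?\<chi> \<omega> j) ^ card I)) \<partial>leb (I - {i}))
      = (\<integral>\<^sup>+ c. ennreal (indicator (orthant I) c * (1 * exp (- (\<Sum>j\<in>I. c j)))) \<partial>leb I)"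
    unfolding F_def
  proof (rule nn_integral_homogeneous_cone[OF I(1) i, symmetric])
    have "orthant I \<in> sets (leb I)" using I by (intro sets_PiM_I_finite) auto
    then show "(\<lambda>c. indicator (orthant I) c * 1 :: real) \<in> borel_measurable (leb I)"
      "(\<lambda>c. indicator (orthant I) c * (\<Sum>j\<in>I. c j) :: real) \<in> borel_measurable (leb I)"
      by auto
    show "0 < (\<Sum>j\<in>I. c j)" if "c \<in> orthant I" for c :: "'i \<Rightarrow> real"
      using that I by (intro sum_pos) auto
  qed (auto simp: sum_distrib_left)
  also have "(\<integral>\<^sup>+ c. ennreal (indicator (orthant I) c * (1 * exp (- (\<Sum>j\<in>I. c j)))) \<partial>leb I)
      = (\<integral>\<^sup>+ c. ennreal (indicator {c. \<forall>j\<in>I. 0 < c j} c * exp (- (\<Sum>j\<in>I. c j))) \<partial>leb I)"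
    by (rule nn_integral_cong) (auto simp: indicator_def PiE_iff)
  also have "\<dots> = ennreal 1" using nn_integral_exp_positive[OF I(1)] by simp
  finally have "(\<integral>\<^sup>+ \<omega>. ennreal (indicator ?S (?\<chi> \<omega>) * (1 / (\<Sum>j\<in>I. ?\<chi> \<omega> j) ^ card I)) \<partial>leb (I - {i})) = ennreal (1 / F)"
    by (rule cancel) simp
  moreover have "ennreal (indicator ?S c * (1 / (\<Sum>j\<in>I. c j) ^ card I)) = indicator ?S c" for c
    by (simp add: indicator_def open_simplex_def)
  ultimately have "(\<integral>\<^sup>+ \<omega>. indicator ?S (?\<chi> \<omega>) \<partial>leb (I - {i})) = ennreal (1 / F)" by simp
  moreover have "emeasure (hyperplane_lebesgue I) ?S = (\<integral>\<^sup>+ c. indicator ?S c \<partial>hyperplane_lebesgue I)"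
    using sets_open_simplex[OF I(1)] by (simp add: sets_HL)
  ultimately have "emeasure (hyperplane_lebesgue I) ?S = ennreal (s * (1 / F))"
    using s F sets_open_simplex[OF I(1)] by (simp add: integral_HL ennreal_mult[symmetric])
  then have "measure (hyperplane_lebesgue I) ?S = s * (1 / F)" using s F by (simp add: measure_def)
  then show ?thesis unfolding LINT using s F by simp
qed

section \<open>Densities in conductance and energy coordinates\<close>

lemma pivot_prod_cong:
  assumes "\<And>a b. a \<in> set us \<Longrightarrow> b \<in> set us \<Longrightarrow> A a b = B a b"
  shows "pivot_prod A us = pivot_prod B us"
  using assms
proof (induction us arbitrary: A B)
  case (Cons u us)
  have "pivot_prod (elim_row A u) us = pivot_prod (elim_row B u) us"
    by (rule Cons.IH) (simp add: elim_row_def Cons.prems)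
  then show ?case by (simp add: Cons.prems)
qed simp

lemma AE_leb_neq:
  fixes c :: "('i \<Rightarrow> real) \<Rightarrow> real"
  assumes V: "finite V" "v \<in> V" and c: "c \<in> borel_measurable (leb V)"
    and indep: "\<And>y s. c (y(v := s)) = c y"
  shows "AE h in leb V. h v \<noteq> c h"
proof -
  have VE: "insert v (V - {v}) = V" using V by auto
  have "(\<lambda>h. h v) \<in> borel_measurable (leb V)" using V by simp
  then have N: "{h \<in> space (leb V). h v = c h} \<in> sets (leb V)" using c by (rule borel_measurable_eq)
  have "emeasure (leb V) {h \<in> space (leb V). h v = c h}
      = (\<integral>\<^sup>+ h. indicator {h \<in> space (leb V). h v = c h} h \<partial>leb (insert v (V - {v})))"
    unfolding VE using N by simp
  also have "\<dots> = (\<integral>\<^sup>+ y. (\<integral>\<^sup>+ s. indicator {h \<in> space (leb V). h v = c h} (y(v := s)) \<partial>lborel) \<partial>leb (V - {v}))"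
  proof (rule lborel_product.product_nn_integral_insert)
    show "indicator {h \<in> space (leb V). h v = c h} \<in> borel_measurable (leb (insert v (V - {v})))"
      unfolding VE using N by simp
  qed (use V in auto)
  also have "\<dots> = (\<integral>\<^sup>+ y. 0 \<partial>leb (V - {v}))"
  proof (rule nn_integral_cong)
    fix y :: "'i \<Rightarrow> real" assume y: "y \<in> space (leb (V - {v}))"
    have "(\<integral>\<^sup>+ s. indicator {h \<in> space (leb V). h v = c h} (y(v := s)) \<partial>lborel)
        = (\<integral>\<^sup>+ s. indicator {c y} s \<partial>lborel)"
      using y V by (intro nn_integral_cong) (auto simp: indicator_def indep PiE_iff extensional_def)
    then show "(\<integral>\<^sup>+ s. indicator {h \<in> space (leb V). h v = c h} (y(v := s)) \<partial>lborel) = 0"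
      by simp
  qed
  finally show ?thesis using N by (intro AE_I[where N = "{h \<in> space (leb V). h v = c h}"]) auto
qed

context network begin

definition energy_prod :: "(('a + nat) set \<Rightarrow> real) \<Rightarrow> real" where
  "energy_prod c = (\<Prod>e\<in>edges. sq_diff (vals (dirichlet_solution c)) e)"

definition energy :: "(('a + nat) set \<Rightarrow> real) \<Rightarrow> real" where
  "energy c = (\<Sum>e\<in>edges. c e * sq_diff (vals (dirichlet_solution c)) e)"

abbreviation "lin_weight \<equiv> spoke_weight (\<lambda>d. d)"

abbreviation "log_weight \<equiv> spoke_weight (\<lambda>d. - 1 / d)"

text \<open>The product of the row scalings: it divides the pivots for linear flow and multiplies them for
  reciprocal flow.\<close>

definition spoke_prod :: "('a \<Rightarrow> real) \<Rightarrow> real" where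
  "spoke_prod h = (\<Prod>v\<in>V. h v - x b)"

text \<open>The integrand in the coordinates given by the conductances \<open>c\<close> off the spokes and the potential
  \<open>h\<close>, including the Jacobian determinant.\<close>

definition lin_density :: "(('a + nat) set \<Rightarrow> real) \<Rightarrow> ('a \<Rightarrow> real) \<Rightarrow> real" where
  "lin_density c h = (if \<forall>v\<in>V. x b < h v \<and> 0 < lin_weight c h v
     then (\<Prod>e\<in>edges. sq_diff (vals h) e)
       * exp (- (\<Sum>e\<in>rest. c e * sq_diff (vals h) e) - (\<Sum>v\<in>V. lin_weight c h v * (h v - x b)\<^sup>2))
       * (pivot_prod (dirichlet_matrix (join c (lin_weight c h))) vlist / spoke_prod h)
     else 0)"

text \<open>The same density after the conductances off the spokes have been replaced by energies. The factor
  \<open>\<Prod>\<^sub>e d\<^sub>e\<^sup>2\<close> has been used up by this replacement and by the change in the power of \<open>spoke_prod\<close>.\<close>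

definition log_density :: "(('a + nat) set \<Rightarrow> real) \<Rightarrow> ('a \<Rightarrow> real) \<Rightarrow> real" where
  "log_density y h = (if (\<forall>e\<in>edges. 0 < sq_diff (vals h) e) \<and> (\<forall>v\<in>V. x b < h v \<and> 0 < log_weight y h v)
     then exp (- (\<Sum>e\<in>rest. y e) - (\<Sum>v\<in>V. log_weight y h v))
       * (pivot_prod (dirichlet_matrix (join (\<lambda>e. y e / sq_diff (vals h) e) (\<lambda>v. log_weight y h v / (h v - x b)\<^sup>2))) vlist
          * spoke_prod h)
     else 0)"

section \<open>Measurability of the densities\<close>

lemma measurable_join:
  assumes "\<And>e. e \<in> rest \<Longrightarrow> (\<lambda>w. p w e) \<in> borel_measurable M" "\<And>v. v \<in> V \<Longrightarrow> (\<lambda>w. z w v) \<in> borel_measurable M"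
    and e: "e \<in> edges"
  shows "(\<lambda>w. join (p w) (z w) e) \<in> borel_measurable M"
  using assms by (cases "e \<in> spoke ` V") auto

lemma measurable_spoke_weight:
  assumes p: "\<And>e. e \<in> rest \<Longrightarrow> (\<lambda>w. p w e) \<in> borel_measurable M"
    and h: "\<And>v. v \<in> V \<Longrightarrow> (\<lambda>w. h w v) \<in> borel_measurable M"
    and \<phi>: "\<phi> \<in> borel_measurable borel" and v: "v \<in> V"
  shows "(\<lambda>w. spoke_weight \<phi> (p w) (h w) v) \<in> borel_measurable M"
proof -
  have \<phi>': "(\<lambda>w. \<phi> (f w)) \<in> borel_measurable M" if "f \<in> borel_measurable M" for f
    using measurable_compose[OF that \<phi>] .
  have "u \<in> V" if "u \<in> nbrs v" for u using that nbrs_subset by auto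
  then show ?thesis
    unfolding spoke_weight_def outflow_def
    by (intro borel_measurable_divide borel_measurable_uminus borel_measurable_add borel_measurable_sum
        borel_measurable_times \<phi>' borel_measurable_diff borel_measurable_const h p
        interior_edge_in_rest boundary_edge_in_rest v)
qed

lemma measurable_sq_diff:
  assumes h: "\<And>v. v \<in> V \<Longrightarrow> (\<lambda>w. h w v) \<in> borel_measurable M" and e: "e \<in> edges"
  shows "(\<lambda>w. sq_diff (vals (h w)) e) \<in> borel_measurable M"
  using e
proof (rule edge_cases)
  fix v u assume a: "v \<in> V" "u \<in> nbrs v" "e = {Inl v, Inl u}"
  then have "u \<in> V" using nbrs_subset by auto
  then show ?thesis using a h by (auto simp: sq_diff_edge)
qed (use h in \<open>auto simp: sq_diff_edge\<close>)

lemma measurable_lin_density: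
  assumes c: "\<And>e. e \<in> rest \<Longrightarrow> (\<lambda>w. c w e) \<in> borel_measurable M"
    and h: "\<And>v. v \<in> V \<Longrightarrow> (\<lambda>w. h w v) \<in> borel_measurable M"
  shows "(\<lambda>w. lin_density (c w) (h w)) \<in> borel_measurable M"
proof -
  have w: "(\<lambda>w. lin_weight (c w) (h w) v) \<in> borel_measurable M" if "v \<in> V" for v
    by (rule measurable_spoke_weight[OF c h _ that]) auto
  note sq = measurable_sq_diff[OF h]
  have expm: "(\<lambda>w. exp (f w :: real)) \<in> borel_measurable M" if "f \<in> borel_measurable M" for f
    using that by simp
  have piv: "(\<lambda>w. pivot_prod (dirichlet_matrix (join (c w) (lin_weight (c w) (h w)))) vlist) \<in> borel_measurable M"
    by (intro borel_measurable_pivot_prod measurable_dirichlet_matrix measurable_join c w) (auto simp: vlist)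
  have "Measurable.pred M (\<lambda>w. \<forall>v\<in>V. x b < h w v \<and> 0 < lin_weight (c w) (h w) v)"
    by (intro pred_intros_finite pred_intros_logic borel_measurable_pred_less h w borel_measurable_const finite_V)
  then show ?thesis
    unfolding lin_density_def spoke_prod_def
    by (intro measurable_If borel_measurable_times borel_measurable_prod expm
        borel_measurable_diff borel_measurable_uminus borel_measurable_sum borel_measurable_divide
        borel_measurable_power borel_measurable_const sq h w c piv)
      (simp_all only: pred_def Diff_iff simp_thms)
qed

lemma measurable_log_density:
  assumes y: "\<And>e. e \<in> rest \<Longrightarrow> (\<lambda>w. y w e) \<in> borel_measurable M"
    and h: "\<And>v. v \<in> V \<Longrightarrow> (\<lambda>w. h w v) \<in> borel_measurable M"
  shows "(\<lambda>w. log_density (y w) (h w)) \<in> borel_measurable M"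
proof -
  have w: "(\<lambda>w. log_weight (y w) (h w) v) \<in> borel_measurable M" if "v \<in> V" for v
    by (rule measurable_spoke_weight[OF y h _ that]) auto
  note sq = measurable_sq_diff[OF h]
  have expm: "(\<lambda>w. exp (f w :: real)) \<in> borel_measurable M" if "f \<in> borel_measurable M" for f
    using that by simp
  have piv: "(\<lambda>w. pivot_prod (dirichlet_matrix (join (\<lambda>e. y w e / sq_diff (vals (h w)) e)
      (\<lambda>v. log_weight (y w) (h w) v / (h w v - x b)\<^sup>2))) vlist) \<in> borel_measurable M"
    by (intro borel_measurable_pivot_prod measurable_dirichlet_matrix measurable_join
        borel_measurable_divide borel_measurable_power borel_measurable_diff borel_measurable_const sq y w h)
      (auto simp: vlist)
  have "Measurable.pred M (\<lambda>w. (\<forall>e\<in>edges. 0 < sq_diff (vals (h w)) e) \<and>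
      (\<forall>v\<in>V. x b < h w v \<and> 0 < log_weight (y w) (h w) v))"
    by (intro pred_intros_finite pred_intros_logic borel_measurable_pred_less h w sq borel_measurable_const
        finite_V finite_edges)
  then show ?thesis
    unfolding log_density_def spoke_prod_def
    by (intro measurable_If borel_measurable_times borel_measurable_prod expm
        borel_measurable_diff borel_measurable_uminus borel_measurable_sum
        borel_measurable_const h w y piv)
      (simp_all only: pred_def Diff_iff simp_thms)
qed

lemma measurable_energy:
  assumes c: "\<And>e. e \<in> edges \<Longrightarrow> (\<lambda>w. c w e) \<in> borel_measurable M"
  shows "(\<lambda>w. energy_prod (c w)) \<in> borel_measurable M" "(\<lambda>w. energy (c w)) \<in> borel_measurable M"
proof -
  note sq = measurable_sq_diff[OF measurable_dirichlet_solution[OF c]]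
  show "(\<lambda>w. energy_prod (c w)) \<in> borel_measurable M"
    unfolding energy_prod_def by (intro borel_measurable_prod sq)
  show "(\<lambda>w. energy (c w)) \<in> borel_measurable M"
    unfolding energy_def by (intro borel_measurable_sum borel_measurable_times sq c)
qed

lemma AE_generic: "AE h in leb V. generic h"
proof -
  have "AE h in leb V. \<forall>v\<in>V. (\<forall>u\<in>nbrs v. h v \<noteq> h u) \<and> (\<forall>i\<in>{..k}. h v \<noteq> x i)"
  proof (intro AE_finite_allI finite_V AE_conjI finite_nbrs finite_atMost)
    show "AE h in leb V. h v \<noteq> h u" if v: "v \<in> V" and u: "u \<in> nbrs v" for v u
    proof -
      have "u \<in> V" "u \<noteq> v" using u nbrs_subset not_nbrs_self[of v] by auto
      then show ?thesis using v by (intro AE_leb_neq) auto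
    qed
    show "AE h in leb V. h v \<noteq> x i" if "v \<in> V" for v i
      using that by (intro AE_leb_neq) auto
  qed
  then show ?thesis by (rule AE_mp) (rule AE_I2, auto simp: generic_def)
qed

section \<open>The two changes of variables\<close>

lemma nn_integral_edges_split:
  assumes f: "f \<in> borel_measurable (leb edges)"
  shows "(\<integral>\<^sup>+ c. f c \<partial>leb edges) = (\<integral>\<^sup>+ c. (\<integral>\<^sup>+ z. f (join c z) \<partial>leb V) \<partial>leb rest)"
proof -
  have S: "spoke ` V \<subseteq> edges" using spoke_edge by auto
  then have un: "rest \<union> spoke ` V = edges" by auto
  have fin: "finite rest" "finite (spoke ` V)" "rest \<inter> spoke ` V = {}" by auto
  have "(\<integral>\<^sup>+ c. f c \<partial>leb edges)
      = (\<integral>\<^sup>+ c. (\<integral>\<^sup>+ y. f (merge rest (spoke ` V) (c, y)) \<partial>leb (spoke ` V)) \<partial>leb rest)"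
    using lborel_product.product_nn_integral_fold[OF fin(3,1,2), of f] f unfolding un by simp
  also have "\<dots> = (\<integral>\<^sup>+ c. (\<integral>\<^sup>+ z. f (join c z) \<partial>leb V) \<partial>leb rest)"
  proof (rule nn_integral_cong)
    fix c assume c: "c \<in> space (leb rest)"
    have "(\<lambda>y. merge rest (spoke ` V) (c, y)) \<in> measurable (leb (spoke ` V)) (leb edges)"
      using measurable_compose[OF measurable_Pair1'[OF c] measurable_merge, of "spoke ` V"] unfolding un by simp
    then have "(\<lambda>y. f (merge rest (spoke ` V) (c, y))) \<in> borel_measurable (leb (spoke ` V))"
      using f by (rule measurable_compose)
    from nn_integral_leb_reindex[OF finite_V inj_spoke this]
    have "(\<integral>\<^sup>+ y. f (merge rest (spoke ` V) (c, y)) \<partial>leb (spoke ` V))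
        = (\<integral>\<^sup>+ z. f (merge rest (spoke ` V) (c, \<lambda>e\<in>spoke ` V. z (the_inv_into V spoke e))) \<partial>leb V)" .
    also have "\<dots> = (\<integral>\<^sup>+ z. f (join c z) \<partial>leb V)"
    proof (intro nn_integral_cong arg_cong[where f = f])
      show "merge rest (spoke ` V) (c, \<lambda>e\<in>spoke ` V. z (the_inv_into V spoke e)) = join c z" for z
        using S by (auto simp: merge_def join_def fun_eq_iff)
    qed
    finally show "(\<integral>\<^sup>+ y. f (merge rest (spoke ` V) (c, y)) \<partial>leb (spoke ` V)) = (\<integral>\<^sup>+ z. f (join c z) \<partial>leb V)" .
  qed
  finally show ?thesis .
qed

lemma sum_edges_split: "(\<Sum>e\<in>edges. f e) = (\<Sum>e\<in>rest. f e) + (\<Sum>v\<in>V. f (spoke v) :: real)"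
  and prod_edges_split: "(\<Prod>e\<in>edges. f e) = (\<Prod>e\<in>rest. f e) * (\<Prod>v\<in>V. f (spoke v))"
proof -
  have S: "spoke ` V \<subseteq> edges" using spoke_edge by auto
  show "(\<Sum>e\<in>edges. f e) = (\<Sum>e\<in>rest. f e) + (\<Sum>v\<in>V. f (spoke v))"
    using sum.subset_diff[OF S finite_edges, of f] by (simp add: sum.reindex[OF inj_spoke])
  show "(\<Prod>e\<in>edges. f e) = (\<Prod>e\<in>rest. f e) * (\<Prod>v\<in>V. f (spoke v))"
    using prod.subset_diff[OF S finite_edges, of f] by (simp add: prod.reindex[OF inj_spoke])
qed

lemma join_restrict [simp]: "join p (restrict z V) = join p z"
  by (auto simp: join_def fun_eq_iff the_inv_into_f_f[OF inj_spoke])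

lemma join_cong:
  assumes "\<And>e. e \<in> rest \<Longrightarrow> p e = p' e" "\<And>v. v \<in> V \<Longrightarrow> z v = z' v"
  shows "join p z = join p' z'"
  using assms by (auto simp: join_def fun_eq_iff the_inv_into_f_f[OF inj_spoke])

lemma sq_diff_spoke: "sq_diff (vals h) (spoke v) = (h v - x b)\<^sup>2"
  by (simp add: spoke_def sq_diff_edge)

lemma dirichlet_matrix_join:
  assumes a: "a \<in> V"
    and "\<And>u. u \<in> nbrs a \<Longrightarrow> c {Inl a, Inl u} = p a u"
    and "\<And>i. i \<in> {..k} - {b} \<Longrightarrow> c {Inl a, Inr i} = p' a i"
  shows "dirichlet_matrix (join c z) a u
    = laplacian (\<lambda>v. (\<Sum>u\<in>nbrs v. p v u) + (\<Sum>i\<in>{..k} - {b}. p' v i) + z v) p a u"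
proof -
  have j: "join c z {Inl a, Inl u} = p a u" if "u \<in> nbrs a" for u
    using assms(2)[OF that] join_rest[OF interior_edge_in_rest[OF a that]] by simp
  have "join c z {Inl a, Inr i} = p' a i" if "i \<in> {..k} - {b}" for i
    using assms(3)[OF that] join_rest[OF boundary_edge_in_rest[OF a that]] by simp
  moreover have "join c z {Inl a, Inr b} = z a"
    using join_spoke[OF a] by (simp add: spoke_def)
  ultimately show ?thesis
    unfolding dirichlet_matrix_def laplacian_def split_spoke using j by simp
qed

lemma prod_list_vlist: "(\<Prod>u\<leftarrow>vlist. f u) = (\<Prod>v\<in>V. f v :: real)"
  using prod.distinct_set_conv_list[OF vlist(1), of f] by (simp add: vlist)

text \<open>For given conductances off the spokes, the potential determines the spoke conductances.\<close>

lemma linear_change_of_variables: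
  assumes c: "\<And>e. e \<in> rest \<Longrightarrow> 0 < c e"
  shows "(\<integral>\<^sup>+ z. ennreal (indicator positive_vecs z * (energy_prod (join c z) * exp (- energy (join c z)))) \<partial>leb V)
    = (\<integral>\<^sup>+ h. ennreal (lin_density c h) \<partial>leb V)"
proof -
  interpret flow_map V E k x b "\<lambda>d. d" "\<lambda>_ _. 1" "\<lambda>_ _. True" above_min c
    by (rule flow_map_linear[OF c])
  define \<Gamma> where "\<Gamma> z = energy_prod (join c z) * exp (- energy (join c z))" for z
  have jm: "(\<lambda>z. join c z e) \<in> borel_measurable (leb V)" if "e \<in> edges" for e
    by (rule measurable_join[OF _ _ that]) auto
  have \<Gamma>: "\<Gamma> \<in> borel_measurable (leb V)"
    unfolding \<Gamma>_def using measurable_energy[of "join c", OF jm] by simp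
  have \<Gamma>_nonneg: "0 \<le> \<Gamma> z" for z
    unfolding \<Gamma>_def energy_prod_def by (intro mult_nonneg_nonneg prod_nonneg) (auto simp: sq_diff_nonneg)
  have U_iff: "h \<in> U \<longleftrightarrow> (\<forall>v\<in>V. x b < h v \<and> 0 < lin_weight c h v)" if "h \<in> vecs V" for h
    unfolding U_def using that by (auto simp: above_min_def)
  have "(\<lambda>h. restrict (lin_weight c h) V) ` U = positive_vecs"
    unfolding U_def using linear_image[of c, OF c] .
  then have "(\<integral>\<^sup>+ z. ennreal (indicator positive_vecs z * \<Gamma> z) \<partial>leb V)
      = (\<integral>\<^sup>+ h. ennreal (indicator U h * (\<Gamma> (restrict (lin_weight c h) V) * jac vlist h)) \<partial>leb V)"
    using change_of_variables[OF vlist \<Gamma> \<Gamma>_nonneg] by simp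
  also have "\<dots> = (\<integral>\<^sup>+ h. ennreal (lin_density c h) \<partial>leb V)"
  proof (rule nn_integral_cong)
    fix h assume "h \<in> space (leb V)"
    then have hV: "h \<in> vecs V" by simp
    show "ennreal (indicator U h * (\<Gamma> (restrict (lin_weight c h) V) * jac vlist h)) = ennreal (lin_density c h)"
    proof (cases "h \<in> U")
      case True
      then have hU: "h \<in> above_min" "\<And>v. v \<in> V \<Longrightarrow> 0 < lin_weight c h v" by (auto simp: U_def)
      then have above: "x b < h v" if "v \<in> V" for v using that by (simp add: above_min_def)
      have sol: "dirichlet_solution (join c (lin_weight c h)) = h"
        by (rule dirichlet_solution_join[of c h, OF c hU]) simp_all
      have e: "energy (join c (lin_weight c h))
          = (\<Sum>e\<in>rest. c e * sq_diff (vals h) e) + (\<Sum>v\<in>V. lin_weight c h v * (h v - x b)\<^sup>2)"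
        unfolding energy_def sol sum_edges_split by (simp add: sq_diff_spoke)
      have piv: "pivot_prod (secant_matrix h h) vlist = pivot_prod (dirichlet_matrix (join c (lin_weight c h))) vlist"
        unfolding secant_matrix_def
        by (rule pivot_prod_cong, subst dirichlet_matrix_join[of _ c "\<lambda>v u. c {Inl v, Inl u}" "\<lambda>v i. c {Inl v, Inr i}"])
          (auto simp: vlist)
      have "(\<Prod>v\<in>V. \<bar>- 1 / (h v - x b)\<bar>) = (\<Prod>v\<in>V. 1 / (h v - x b))"
        by (rule prod.cong) (use above in \<open>auto simp: abs_of_pos\<close>)
      then have "jac vlist h = pivot_prod (dirichlet_matrix (join c (lin_weight c h))) vlist / spoke_prod h"
        unfolding jac_def piv prod_list_vlist spoke_prod_def by (simp add: prod_dividef)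
      then show ?thesis
        using True U_iff[OF hV] by (simp add: lin_density_def \<Gamma>_def e energy_prod_def sol)
    qed (auto simp: lin_density_def U_iff[OF hV])
  qed
  finally show ?thesis by (simp add: \<Gamma>_def)
qed

text \<open>The right-hand side does not depend on the cell: the spoke energies are independent
  exponential variables of total mass 1.\<close>

lemma log_change_of_variables:
  assumes y: "\<And>e. e \<in> rest \<Longrightarrow> 0 < y e" and \<sigma>: "\<sigma> \<in> bounded_patterns"
  shows "(\<integral>\<^sup>+ h. ennreal (indicator (cell \<sigma>) h * log_density y h) \<partial>leb V) = ennreal (exp (- (\<Sum>e\<in>rest. y e)))"
proof -
  interpret flow_map V E k x b "\<lambda>d. - 1 / d" "\<lambda>d' d. 1 / (d' * d)" "\<lambda>d' d. 0 < d' * d" "cell \<sigma>" y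
    by (rule flow_map_log[OF y \<sigma>])
  define \<Gamma> where "\<Gamma> z = exp (- (\<Sum>e\<in>rest. y e)) * exp (- (\<Sum>v\<in>V. z v))" for z
  have \<Gamma>: "\<Gamma> \<in> borel_measurable (leb V)" unfolding \<Gamma>_def by simp
  have "(\<lambda>h. restrict (log_weight y h) V) ` U = positive_vecs"
    unfolding U_def using log_image[of y, OF y \<sigma>] .
  then have "(\<integral>\<^sup>+ h. ennreal (indicator U h * (\<Gamma> (restrict (log_weight y h) V) * jac vlist h)) \<partial>leb V)
      = (\<integral>\<^sup>+ z. ennreal (indicator positive_vecs z * \<Gamma> z) \<partial>leb V)"
    using change_of_variables[OF vlist \<Gamma>] by (simp add: \<Gamma>_def)
  also have "\<dots> = (\<integral>\<^sup>+ z. ennreal (exp (- (\<Sum>e\<in>rest. y e))) *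
      ennreal (indicator {z. \<forall>v\<in>V. 0 < z v} z * exp (- (\<Sum>v\<in>V. z v))) \<partial>leb V)"
    by (rule nn_integral_cong) (auto simp: \<Gamma>_def indicator_def ennreal_mult[symmetric])
  also have "\<dots> = ennreal (exp (- (\<Sum>e\<in>rest. y e)))"
  proof (subst nn_integral_cmult)
    have "{z \<in> space (leb V). \<forall>v\<in>V. 0 < z v} \<in> sets (leb V)" by measurable
    from borel_measurable_indicator[OF this]
    have "(\<lambda>z. indicator {z \<in> space (leb V). \<forall>v\<in>V. 0 < z v} z * exp (- (\<Sum>v\<in>V. z v)) :: real)
        \<in> borel_measurable (leb V)" by simp
    then show "(\<lambda>z. ennreal (indicator {z. \<forall>v\<in>V. 0 < z v} z * exp (- (\<Sum>v\<in>V. z v)))) \<in> borel_measurable (leb V)"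
      by (intro measurable_compose[OF _ measurable_ennreal])
        (auto simp: indicator_def cong: measurable_cong)
  qed (simp add: nn_integral_exp_positive)
  finally have "(\<integral>\<^sup>+ h. ennreal (indicator U h * (\<Gamma> (restrict (log_weight y h) V) * jac vlist h)) \<partial>leb V)
      = ennreal (exp (- (\<Sum>e\<in>rest. y e)))" .
  moreover have "indicator U h * (\<Gamma> (restrict (log_weight y h) V) * jac vlist h) = indicator (cell \<sigma>) h * log_density y h" for h
  proof (cases "h \<in> cell \<sigma>")
    case cell: True
    have above: "x b < h v" if "v \<in> V" for v using bounded_cell(1)[OF \<sigma> cell that] .
    have gen: "\<forall>e\<in>edges. 0 < sq_diff (vals h) e" using cell by (simp add: cell_def generic_iff_sq_diff)
    have U: "h \<in> U \<longleftrightarrow> (\<forall>v\<in>V. x b < h v \<and> 0 < log_weight y h v)"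
      unfolding U_def using cell above by blast
    have piv: "pivot_prod (secant_matrix h h) vlist = pivot_prod (dirichlet_matrix
        (join (\<lambda>e. y e / sq_diff (vals h) e) (\<lambda>v. log_weight y h v / (h v - x b)\<^sup>2))) vlist"
      unfolding secant_matrix_def
      by (rule pivot_prod_cong, subst dirichlet_matrix_join[of _ _ "\<lambda>v u. y {Inl v, Inl u} * (1 / ((h v - h u) * (h v - h u)))"
            "\<lambda>v i. y {Inl v, Inr i} * (1 / ((h v - x i) * (h v - x i)))"])
        (auto simp: vlist sq_diff_edge power2_eq_square)
    have pr: "(\<Prod>v\<in>V. \<bar>- 1 / (- 1 / (h v - x b))\<bar>) = spoke_prod h"
      unfolding spoke_prod_def by (rule prod.cong) (use above in \<open>auto simp: abs_of_pos\<close>)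
    have "jac vlist h = pivot_prod (dirichlet_matrix
        (join (\<lambda>e. y e / sq_diff (vals h) e) (\<lambda>v. log_weight y h v / (h v - x b)\<^sup>2))) vlist * spoke_prod h"
      unfolding jac_def piv prod_list_vlist pr by (rule mult.commute)
    then show ?thesis
      using cell gen U by (auto simp: log_density_def \<Gamma>_def exp_add[symmetric] indicator_def simp del: divide_minus_left)
  next
    case False
    then show ?thesis unfolding U_def by simp
  qed
  ultimately show ?thesis by simp
qed

section \<open>The integral over the orthant\<close>

lemma lin_weight_scaled:
  assumes h: "generic h" and v: "v \<in> V" and c: "\<And>e. e \<in> rest \<Longrightarrow> c e = y e / sq_diff (vals h) e"
  shows "lin_weight c h v = log_weight y h v / (h v - x b)\<^sup>2"
proof -
  have nz: "h v - x b \<noteq> 0" using h v b by (simp add: generic_def)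
  have "outflow (\<lambda>d. d) c h v = (\<Sum>u\<in>nbrs v. y {Inl v, Inl u} / (h v - h u))
      + (\<Sum>i\<in>{..k} - {b}. y {Inl v, Inr i} / (h v - x i))"
  proof -
    have "a / w\<^sup>2 * w = a / w" for a w :: real by (simp add: power2_eq_square)
    then have "c {Inl v, Inl u} * (h v - h u) = y {Inl v, Inl u} / (h v - h u)" if "u \<in> nbrs v" for u
      by (simp add: c[OF interior_edge_in_rest[OF v that]] sq_diff_edge)
    moreover have "c {Inl v, Inr i} * (h v - x i) = y {Inl v, Inr i} / (h v - x i)" if "i \<in> {..k} - {b}" for i
      using \<open>\<And>a w :: real. a / w\<^sup>2 * w = a / w\<close>
      by (simp add: c[OF boundary_edge_in_rest[OF v that]] sq_diff_edge)
    ultimately show ?thesis unfolding outflow_def by simp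
  qed
  moreover have "outflow (\<lambda>d. - 1 / d) y h v = - ((\<Sum>u\<in>nbrs v. y {Inl v, Inl u} / (h v - h u))
      + (\<Sum>i\<in>{..k} - {b}. y {Inl v, Inr i} / (h v - x i)))"
    unfolding outflow_def by (simp add: sum_negf)
  ultimately have "outflow (\<lambda>d. d) c h v = - outflow (\<lambda>d. - 1 / d) y h v" by simp
  then show ?thesis using nz by (simp add: spoke_weight_def power2_eq_square)
qed

text \<open>For a fixed potential without ties, \<open>c\<^sub>e = y\<^sub>e / d\<^sub>e\<^sup>2\<close> is a diagonal substitution. It takes away the
  factors \<open>d\<^sub>e\<^sup>2\<close> off the spokes. The spokes contribute \<open>spoke_prod\<close> squared, which turns the division by
  \<open>spoke_prod\<close> into a multiplication.\<close>

lemma density_scaling: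
  assumes h: "generic h"
  shows "(\<integral>\<^sup>+ c. ennreal (indicator (orthant rest) c * lin_density c h) \<partial>leb rest)
    = (\<integral>\<^sup>+ y. ennreal (indicator (orthant rest) y * log_density y h) \<partial>leb rest)"
proof -
  define d where "d e = sq_diff (vals h) e" for e
  have d: "0 < d e" if "e \<in> edges" for e using h that by (simp add: generic_iff_sq_diff d_def)
  have O: "orthant rest \<in> sets (leb rest)" by (intro sets_PiM_I_finite) auto
  have m: "(\<lambda>c. ennreal (indicator (orthant rest) c * lin_density c h)) \<in> borel_measurable (leb rest)"
    by (intro measurable_compose[OF _ measurable_ennreal] borel_measurable_times borel_measurable_indicator O
        measurable_lin_density) auto
  have fin: "finite rest" by auto
  have ms: "(\<lambda>y. ennreal (indicator (orthant rest) (\<lambda>e\<in>rest. 1 / d e * y e) * lin_density (\<lambda>e\<in>rest. 1 / d e * y e) h))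
      \<in> borel_measurable (leb rest)"
    by (rule measurable_compose[OF _ m], intro measurable_restrict) auto
  have "(\<integral>\<^sup>+ c. ennreal (indicator (orthant rest) c * lin_density c h) \<partial>leb rest)
      = (\<Prod>e\<in>rest. ennreal (1 / d e)) * (\<integral>\<^sup>+ y. ennreal (indicator (orthant rest) (\<lambda>e\<in>rest. 1 / d e * y e)
          * lin_density (\<lambda>e\<in>rest. 1 / d e * y e) h) \<partial>leb rest)"
    by (rule nn_integral_leb_scale[OF fin m]) (simp add: d)
  also have "\<dots> = (\<integral>\<^sup>+ y. (\<Prod>e\<in>rest. ennreal (1 / d e)) * ennreal (indicator (orthant rest) (\<lambda>e\<in>rest. 1 / d e * y e)
          * lin_density (\<lambda>e\<in>rest. 1 / d e * y e) h) \<partial>leb rest)"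
    using ms by (rule nn_integral_cmult[symmetric])
  also have "\<dots> = (\<integral>\<^sup>+ y. ennreal (indicator (orthant rest) y * log_density y h) \<partial>leb rest)"
  proof (rule nn_integral_cong)
    fix y assume "y \<in> space (leb rest)"
    then have y: "y \<in> vecs rest" by simp
    let ?c = "\<lambda>e\<in>rest. 1 / d e * y e"
    have c: "?c e = y e / sq_diff (vals h) e" if "e \<in> rest" for e using that by (simp add: d_def)
    have w: "lin_weight ?c h v = log_weight y h v / (h v - x b)\<^sup>2" if "v \<in> V" for v
      by (rule lin_weight_scaled[OF h that]) (rule c)
    have w_pos: "0 < lin_weight ?c h v \<longleftrightarrow> 0 < log_weight y h v" if "v \<in> V" "x b < h v" for v
    proof -
      have "0 < (h v - x b)\<^sup>2" using that(2) by simp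
      then show ?thesis unfolding w[OF that(1)] by (auto simp: zero_less_divide_iff simp del: divide_minus_left)
    qed
    have orth: "?c \<in> orthant rest \<longleftrightarrow> y \<in> orthant rest"
    proof -
      have "0 < 1 / d e * y e \<longleftrightarrow> 0 < y e" if "e \<in> rest" for e
        using d[of e] that by (auto simp: zero_less_divide_iff)
      then show ?thesis using y by (simp add: PiE_iff)
    qed
    have "(\<Prod>e\<in>rest. 1 / d e) * lin_density ?c h = log_density y h"
    proof (cases "\<forall>v\<in>V. x b < h v \<and> 0 < lin_weight ?c h v")
      case True
      have gap: "h v - x b \<noteq> 0" if "v \<in> V" for v using True that by force
      have "(\<Prod>e\<in>rest. 1 / d e) * (\<Prod>e\<in>edges. d e) = (\<Prod>v\<in>V. (h v - x b)\<^sup>2)"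
      proof -
        have "(\<Prod>e\<in>rest. d e) \<noteq> 0" using d by (fastforce simp: prod_zero_iff)
        then show ?thesis unfolding prod_edges_split by (simp add: d_def sq_diff_spoke prod_dividef)
      qed
      also have "\<dots> = spoke_prod h * spoke_prod h"
        by (simp add: spoke_prod_def power2_eq_square prod.distrib)
      finally have W: "(\<Prod>e\<in>rest. 1 / d e) * (\<Prod>e\<in>edges. sq_diff (vals h) e) = spoke_prod h * spoke_prod h"
        by (simp add: d_def)
      have sp: "spoke_prod h \<noteq> 0" using gap by (simp add: spoke_prod_def)
      have s1: "(\<Sum>e\<in>rest. ?c e * sq_diff (vals h) e) = (\<Sum>e\<in>rest. y e)"
      proof (intro sum.cong refl)
        fix e assume "e \<in> rest"
        then show "?c e * sq_diff (vals h) e = y e" using d[of e] by (simp add: d_def)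
      qed
      have s2: "(\<Sum>v\<in>V. lin_weight ?c h v * (h v - x b)\<^sup>2) = (\<Sum>v\<in>V. log_weight y h v)"
      proof (intro sum.cong refl)
        fix v assume v: "v \<in> V"
        show "lin_weight ?c h v * (h v - x b)\<^sup>2 = log_weight y h v"
          unfolding w[OF v] using gap[OF v] by (simp del: divide_minus_left)
      qed
      have j: "join ?c (lin_weight ?c h) = join (\<lambda>e. y e / sq_diff (vals h) e) (\<lambda>v. log_weight y h v / (h v - x b)\<^sup>2)"
        using c w by (rule join_cong)
      have cond: "(\<forall>e\<in>edges. 0 < sq_diff (vals h) e) \<and> (\<forall>v\<in>V. x b < h v \<and> 0 < log_weight y h v)"
        using True w_pos d unfolding d_def by blast
      define X where "X = exp (- (\<Sum>e\<in>rest. y e) - (\<Sum>v\<in>V. log_weight y h v))"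
      define p where "p = pivot_prod (dirichlet_matrix (join (\<lambda>e. y e / sq_diff (vals h) e) (\<lambda>v. log_weight y h v / (h v - x b)\<^sup>2))) vlist"
      have "(\<Prod>e\<in>rest. 1 / d e) * lin_density ?c h
          = ((\<Prod>e\<in>rest. 1 / d e) * (\<Prod>e\<in>edges. sq_diff (vals h) e)) * X * (p / spoke_prod h)"
        unfolding lin_density_def if_P[OF True] s1 s2 j X_def p_def by (simp only: mult.assoc)
      also have "\<dots> = X * (p * spoke_prod h)" unfolding W using sp by simp
      also have "\<dots> = log_density y h" unfolding log_density_def if_P[OF cond] X_def p_def ..
      finally show ?thesis .
    next
      case False
      then have "\<not> (\<forall>v\<in>V. x b < h v \<and> 0 < log_weight y h v)"
        using w_pos by blast
      then have "log_density y h = 0" unfolding log_density_def by (intro if_not_P) blast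
      moreover have "lin_density ?c h = 0" unfolding lin_density_def if_not_P[OF False] ..
      ultimately show ?thesis by simp
    qed
    moreover have "(\<Prod>e\<in>rest. ennreal (1 / d e)) = ennreal (\<Prod>e\<in>rest. 1 / d e)"
      using d by (intro prod_ennreal) (auto intro: less_imp_le)
    moreover have "0 \<le> (\<Prod>e\<in>rest. 1 / d e)" using d by (intro prod_nonneg) (auto intro: less_imp_le)
    ultimately show "(\<Prod>e\<in>rest. ennreal (1 / d e)) * ennreal (indicator (orthant rest) ?c * lin_density ?c h)
        = ennreal (indicator (orthant rest) y * log_density y h)"
      using orth by (simp add: ennreal_mult'[symmetric] indicator_def)
  qed
  finally show ?thesis .
qed

text \<open>If the greatest interior value were above all boundary values, all flow out of that vertex would
  have one sign, and no positive spoke energy could balance it.\<close>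

lemma log_weight_pos_bounded:
  assumes y: "\<And>e. e \<in> rest \<Longrightarrow> 0 < y e" and h: "generic h"
    and pos: "\<And>v. v \<in> V \<Longrightarrow> x b < h v \<and> 0 < log_weight y h v" and v: "v \<in> V"
  shows "\<exists>i\<le>k. h v < x i"
proof (rule ccontr)
  assume "\<not> (\<exists>i\<le>k. h v < x i)"
  then have top: "x i \<le> h v" if "i \<le> k" for i using that by (auto simp: not_less)
  obtain w where w: "w \<in> V" "\<And>u. u \<in> V \<Longrightarrow> h u \<le> h w"
  proof -
    have "Max (h ` V) \<in> h ` V" using v by (intro Max_in) auto
    then obtain w where "w \<in> V" "h w = Max (h ` V)" by auto
    then show ?thesis using that[of w] by simp
  qed
  have below: "h u < h w" if "u \<in> nbrs w" for u
    using w(2)[of u] that nbrs_subset h w(1) by (fastforce simp: generic_def less_le)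
  have below': "x i < h w" if "i \<le> k" for i
    using top[OF that] w(2)[OF v] h w(1) that by (fastforce simp: generic_def less_le)
  have "outflow (\<lambda>d. - 1 / d) y h w \<le> 0"
    unfolding outflow_def
  proof (intro add_nonpos_nonpos sum_nonpos)
    show "y {Inl w, Inl u} * (- 1 / (h w - h u)) \<le> 0" if "u \<in> nbrs w" for u
      using y[OF interior_edge_in_rest[OF w(1) that]] below[OF that] by (simp add: mult_nonneg_nonpos)
    show "y {Inl w, Inr i} * (- 1 / (h w - x i)) \<le> 0" if "i \<in> {..k} - {b}" for i
      using y[OF boundary_edge_in_rest[OF w(1) that]] below'[of i] that by (simp add: mult_nonneg_nonpos)
  qed
  then have "log_weight y h w \<le> 0"
    using below'[OF b] by (simp add: spoke_weight_def mult_nonpos_nonneg)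
  then show False using pos[OF w(1)] by simp
qed

text \<open>Each cell of a bounded pattern contributes the same amount, and the density vanishes elsewhere.\<close>

lemma log_density_total:
  assumes y: "\<And>e. e \<in> rest \<Longrightarrow> 0 < y e"
  shows "(\<integral>\<^sup>+ h. ennreal (log_density y h) \<partial>leb V)
    = ennreal (real (card bounded_patterns) * exp (- (\<Sum>e\<in>rest. y e)))"
proof -
  have nonneg: "0 \<le> log_density y h" for h
  proof (cases "(\<forall>e\<in>edges. 0 < sq_diff (vals h) e) \<and> (\<forall>v\<in>V. x b < h v \<and> 0 < log_weight y h v)")
    case True
    have "0 < pivot_prod (dirichlet_matrix (join (\<lambda>e. y e / sq_diff (vals h) e)
        (\<lambda>v. log_weight y h v / (h v - x b)\<^sup>2))) vlist"
      by (rule pivot_prod_pos[OF finite_V strict_M_dirichlet_matrix vlist(1)], rule join_pos)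
        (use True y vlist in \<open>force simp: zero_less_divide_iff\<close>)+
    moreover have "0 < spoke_prod h" unfolding spoke_prod_def using True by (intro prod_pos) auto
    ultimately show ?thesis unfolding log_density_def if_P[OF True] by (simp del: divide_minus_left)
  next
    case False
    then show ?thesis unfolding log_density_def if_not_P[OF False] by simp
  qed
  have "(\<integral>\<^sup>+ h. ennreal (log_density y h) \<partial>leb V)
      = (\<integral>\<^sup>+ h. (\<Sum>\<sigma>\<in>bounded_patterns. ennreal (indicator (cell \<sigma>) h * log_density y h)) \<partial>leb V)"
  proof (rule nn_integral_cong)
    fix h assume "h \<in> space (leb V)"
    then have hV: "h \<in> vecs V" by simp
    have "log_density y h = (\<Sum>\<sigma>\<in>bounded_patterns. indicator (cell \<sigma>) h * log_density y h)"
    proof (cases "(\<forall>e\<in>edges. 0 < sq_diff (vals h) e) \<and> (\<forall>v\<in>V. x b < h v \<and> 0 < log_weight y h v)")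
      case True
      then have g: "generic h" using hV by (simp add: generic_iff_sq_diff)
      have "\<exists>i\<le>k. h v < x i" if "v \<in> V" for v
        by (rule log_weight_pos_bounded[of y h v]) (use y g True that in blast)+
      then have bp: "pattern h \<in> bounded_patterns" using g True unfolding bounded_patterns_def by blast
      have "(\<Sum>\<sigma>\<in>bounded_patterns. indicator (cell \<sigma>) h * log_density y h)
          = (\<Sum>\<sigma>\<in>{pattern h}. indicator (cell \<sigma>) h * log_density y h)"
        using bp by (intro sum.mono_neutral_right) (auto simp: cell_def indicator_def)
      then show ?thesis using g by (simp add: cell_def)
    next
      case False
      then have "log_density y h = 0" unfolding log_density_def by (rule if_not_P)
      then show ?thesis by simp
    qed
    then show "ennreal (log_density y h)
        = (\<Sum>\<sigma>\<in>bounded_patterns. ennreal (indicator (cell \<sigma>) h * log_density y h))"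
      using nonneg by (subst sum_ennreal) auto
  qed
  also have "\<dots> = (\<Sum>\<sigma>\<in>bounded_patterns. \<integral>\<^sup>+ h. ennreal (indicator (cell \<sigma>) h * log_density y h) \<partial>leb V)"
    by (intro nn_integral_sum measurable_compose[OF _ measurable_ennreal] borel_measurable_times
        borel_measurable_indicator rel_open_sets[OF finite_V rel_open_cell] measurable_log_density) auto
  also have "\<dots> = (\<Sum>\<sigma>\<in>bounded_patterns. ennreal (exp (- (\<Sum>e\<in>rest. y e))))"
    by (intro sum.cong refl log_change_of_variables y) auto
  also have "\<dots> = ennreal (real (card bounded_patterns) * exp (- (\<Sum>e\<in>rest. y e)))"
    by (simp add: ennreal_mult ennreal_of_nat_eq_real_of_nat)
  finally show ?thesis .
qed

text \<open>Conductances are exchanged for potentials, then for a fixed potential the remaining conductances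
  for energies, and finally for fixed energies the potentials for spoke energies.\<close>

theorem energy_integral:
  "(\<integral>\<^sup>+ c. ennreal (indicator (orthant edges) c * (energy_prod c * exp (- energy c))) \<partial>leb edges)
    = ennreal (real (card bounded_patterns))"
proof -
  let ?N = "real (card bounded_patterns)"
  have fin: "finite rest" by auto
  have O: "orthant rest \<in> sets (leb rest)" "orthant edges \<in> sets (leb edges)"
    by (auto intro!: sets_PiM_I_finite)
  have fst_m: "(\<lambda>w. fst w e) \<in> borel_measurable (leb rest \<Otimes>\<^sub>M leb V)" if "e \<in> rest" for e
  proof -
    have "(\<lambda>c. c e) \<in> borel_measurable (leb rest)" using that by simp
    then show ?thesis by (rule measurable_compose[OF measurable_fst])
  qed
  have snd_m: "(\<lambda>w. snd w v) \<in> borel_measurable (leb rest \<Otimes>\<^sub>M leb V)" if "v \<in> V" for v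
  proof -
    have "(\<lambda>h. h v) \<in> borel_measurable (leb V)" using that by simp
    then show ?thesis by (rule measurable_compose[OF measurable_snd])
  qed
  have ind_m: "(\<lambda>w. indicator (orthant rest) (fst w) :: real) \<in> borel_measurable (leb rest \<Otimes>\<^sub>M leb V)"
    using measurable_compose[OF measurable_fst borel_measurable_indicator[OF O(1)]] .
  have "(\<integral>\<^sup>+ c. ennreal (indicator (orthant edges) c * (energy_prod c * exp (- energy c))) \<partial>leb edges)
      = (\<integral>\<^sup>+ c. (\<integral>\<^sup>+ z. ennreal (indicator (orthant edges) (join c z)
          * (energy_prod (join c z) * exp (- energy (join c z)))) \<partial>leb V) \<partial>leb rest)"
  proof (rule nn_integral_edges_split)
    have "(\<lambda>c. energy_prod c) \<in> borel_measurable (leb edges)" "(\<lambda>c. energy c) \<in> borel_measurable (leb edges)"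
      by (rule measurable_energy; simp)+
    then show "(\<lambda>c. ennreal (indicator (orthant edges) c * (energy_prod c * exp (- energy c))))
        \<in> borel_measurable (leb edges)"
      using O(2) by simp
  qed
  also have "\<dots> = (\<integral>\<^sup>+ c. (\<integral>\<^sup>+ h. ennreal (indicator (orthant rest) c * lin_density c h) \<partial>leb V) \<partial>leb rest)"
  proof (rule nn_integral_cong)
    fix c assume "c \<in> space (leb rest)"
    then have cV: "c \<in> vecs rest" by simp
    have orth: "join c z \<in> orthant edges \<longleftrightarrow> c \<in> orthant rest \<and> z \<in> positive_vecs" if z: "z \<in> vecs V" for z
    proof
      assume j: "join c z \<in> orthant edges"
      have "0 < c e" if "e \<in> rest" for e using PiE_mem[OF j, of e] that by simp
      moreover have "0 < z v" if "v \<in> V" for v using PiE_mem[OF j spoke_edge[OF that]] that by simp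
      ultimately show "c \<in> orthant rest \<and> z \<in> positive_vecs" using cV z by (auto simp: PiE_iff)
    next
      assume "c \<in> orthant rest \<and> z \<in> positive_vecs"
      then have "0 < join c z e" if "e \<in> edges" for e using that by (intro join_pos) (auto simp: PiE_iff)
      then show "join c z \<in> orthant edges" by (simp add: PiE_iff join_def)
    qed
    show "(\<integral>\<^sup>+ z. ennreal (indicator (orthant edges) (join c z)
          * (energy_prod (join c z) * exp (- energy (join c z)))) \<partial>leb V)
      = (\<integral>\<^sup>+ h. ennreal (indicator (orthant rest) c * lin_density c h) \<partial>leb V)"
    proof (cases "c \<in> orthant rest")
      case True
      then have c: "0 < c e" if "e \<in> rest" for e using that by (auto simp: PiE_iff)
      have "(\<integral>\<^sup>+ z. ennreal (indicator (orthant edges) (join c z)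
          * (energy_prod (join c z) * exp (- energy (join c z)))) \<partial>leb V)
        = (\<integral>\<^sup>+ z. ennreal (indicator positive_vecs z * (energy_prod (join c z) * exp (- energy (join c z)))) \<partial>leb V)"
        by (intro nn_integral_cong) (use True orth in \<open>simp add: indicator_def\<close>)
      also have "\<dots> = (\<integral>\<^sup>+ h. ennreal (lin_density c h) \<partial>leb V)"
        by (rule linear_change_of_variables[of c, OF c])
      finally show ?thesis using True by simp
    next
      case False
      then have "(\<integral>\<^sup>+ z. ennreal (indicator (orthant edges) (join c z)
          * (energy_prod (join c z) * exp (- energy (join c z)))) \<partial>leb V) = (\<integral>\<^sup>+ z. 0 \<partial>leb V)"
        by (intro nn_integral_cong) (use orth in \<open>simp add: indicator_def\<close>)
      then show ?thesis using False by simp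
    qed
  qed
  also have "\<dots> = (\<integral>\<^sup>+ h. (\<integral>\<^sup>+ c. ennreal (indicator (orthant rest) c * lin_density c h) \<partial>leb rest) \<partial>leb V)"
    by (rule nn_integral_leb_swap[OF fin finite_V])
      (intro measurable_compose[OF _ measurable_ennreal] borel_measurable_times ind_m
        measurable_lin_density fst_m snd_m)
  also have "\<dots> = (\<integral>\<^sup>+ h. (\<integral>\<^sup>+ y. ennreal (indicator (orthant rest) y * log_density y h) \<partial>leb rest) \<partial>leb V)"
    by (rule nn_integral_cong_AE, rule AE_mp[OF AE_generic]) (rule AE_I2, simp add: density_scaling)
  also have "\<dots> = (\<integral>\<^sup>+ y. (\<integral>\<^sup>+ h. ennreal (indicator (orthant rest) y * log_density y h) \<partial>leb V) \<partial>leb rest)"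
    by (rule nn_integral_leb_swap[OF fin finite_V, symmetric])
      (intro measurable_compose[OF _ measurable_ennreal] borel_measurable_times ind_m
        measurable_log_density fst_m snd_m)
  also have "\<dots> = (\<integral>\<^sup>+ y. ennreal ?N * ennreal (indicator {y. \<forall>e\<in>rest. 0 < y e} y * exp (- (\<Sum>e\<in>rest. y e))) \<partial>leb rest)"
  proof (rule nn_integral_cong)
    fix y assume "y \<in> space (leb rest)"
    then have y: "y \<in> orthant rest \<longleftrightarrow> (\<forall>e\<in>rest. 0 < y e)" by (auto simp: PiE_iff)
    show "(\<integral>\<^sup>+ h. ennreal (indicator (orthant rest) y * log_density y h) \<partial>leb V)
        = ennreal ?N * ennreal (indicator {y. \<forall>e\<in>rest. 0 < y e} y * exp (- (\<Sum>e\<in>rest. y e)))"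
    proof (cases "\<forall>e\<in>rest. 0 < y e")
      case True
      then have "(\<integral>\<^sup>+ h. ennreal (log_density y h) \<partial>leb V) = ennreal (?N * exp (- (\<Sum>e\<in>rest. y e)))"
        by (intro log_density_total) blast
      then show ?thesis using True y by (simp add: ennreal_mult)
    qed (use y in simp)
  qed
  also have "\<dots> = ennreal ?N * (\<integral>\<^sup>+ y. ennreal (indicator {y. \<forall>e\<in>rest. 0 < y e} y * exp (- (\<Sum>e\<in>rest. y e))) \<partial>leb rest)"
  proof (rule nn_integral_cmult)
    have "(\<lambda>y. indicator (orthant rest) y * exp (- (\<Sum>e\<in>rest. y e)) :: real) \<in> borel_measurable (leb rest)"
      using O(1) by simp
    then have "(\<lambda>y. ennreal (indicator (orthant rest) y * exp (- (\<Sum>e\<in>rest. y e)))) \<in> borel_measurable (leb rest)"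
      by (rule measurable_compose[OF _ measurable_ennreal])
    then show "(\<lambda>y. ennreal (indicator {y. \<forall>e\<in>rest. 0 < y e} y * exp (- (\<Sum>e\<in>rest. y e)))) \<in> borel_measurable (leb rest)"
      by (rule measurable_cong[THEN iffD1, rotated]) (auto simp: indicator_def PiE_iff)
  qed
  finally show ?thesis using nn_integral_exp_positive[OF fin] by simp
qed

section \<open>The average over the simplex\<close>

text \<open>This connects the Dirichlet problem on all vertices, boundary included, with the linear system for
  the interior values.\<close>

lemma harmonic_extension_eq:
  assumes c: "\<And>e. e \<in> edges \<Longrightarrow> 0 < c e"
  shows "harmonic_extension V E k x c = restrict (vals (dirichlet_solution c)) (ext_verts V k)"
proof -
  have flow: "(\<Sum>u | u \<in> ext_verts V k \<and> {Inl v, u} \<in> edges. c {Inl v, u} * (h (Inl v) - h u))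
      = outflow (\<lambda>d. d) c (\<lambda>v. h (Inl v)) v + c (spoke v) * (h (Inl v) - x b)"
    if v: "v \<in> V" and bd: "\<And>i. i \<le> k \<Longrightarrow> h (Inr i) = x i" for h v
  proof -
    have nb: "{u. u \<in> ext_verts V k \<and> {Inl v, u} \<in> edges} = Inl ` nbrs v \<union> Inr ` {..k}"
    proof (intro equalityI subsetI)
      fix u assume "u \<in> {u. u \<in> ext_verts V k \<and> {Inl v, u} \<in> edges}"
      then have u: "u \<in> ext_verts V k" "{Inl v, u} \<in> edges" by auto
      from u(2) show "u \<in> Inl ` nbrs v \<union> Inr ` {..k}"
      proof (rule edge_cases)
        fix v' u' assume a: "v' \<in> V" "u' \<in> nbrs v'" "{Inl v, u} = {Inl v', Inl u'}"
        then show ?thesis using nbrs_sym[OF a(1,2)] by (auto simp: doubleton_eq_iff)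
      qed (auto simp: doubleton_eq_iff)
    next
      fix u assume "u \<in> Inl ` nbrs v \<union> (Inr ` {..k} :: ('a + nat) set)"
      then show "u \<in> {u. u \<in> ext_verts V k \<and> {Inl v, u} \<in> edges}"
        using interior_edge[OF v] boundary_edge[OF v] nbrs_subset[of v] by (auto simp: ext_verts_def)
    qed
    have "(\<Sum>u\<in>Inl ` nbrs v \<union> Inr ` {..k}. c {Inl v, u} * (h (Inl v) - h u))
        = (\<Sum>u\<in>nbrs v. c {Inl v, Inl u} * (h (Inl v) - h (Inl u))) + (\<Sum>i\<le>k. c {Inl v, Inr i} * (h (Inl v) - x i))"
      by (subst sum.union_disjoint) (auto simp: sum.reindex inj_on_def bd)
    then show ?thesis unfolding nb split_spoke by (simp add: outflow_def spoke_def)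
  qed
  let ?h = "restrict (vals (dirichlet_solution c)) (ext_verts V k)"
  have hv: "?h (Inl v) = dirichlet_solution c v" if "v \<in> V" for v using that by (simp add: ext_verts_def)
  have hb: "?h (Inr i) = x i" if "i \<le> k" for i using that by (simp add: ext_verts_def)
  have outflow_eq: "outflow (\<lambda>d. d) c (\<lambda>v. g (Inl v)) v = outflow (\<lambda>d. d) c f v"
    if "v \<in> V" "\<And>v. v \<in> V \<Longrightarrow> g (Inl v) = f v" for v g and f :: "'a \<Rightarrow> real"
    unfolding outflow_def using that nbrs_subset[of v] by (auto intro!: arg_cong2[of _ _ _ _ "(+)"] sum.cong)
  have kirchhoff: "outflow (\<lambda>d. d) c (dirichlet_solution c) v
      + c (spoke v) * (dirichlet_solution c v - x b) = 0" if "v \<in> V" for v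
    by (rule dirichlet_solution(3)[OF c that])
  show ?thesis
    unfolding harmonic_extension_def
  proof (rule the_equality)
    show "?h \<in> extensional (ext_verts V k) \<and> is_harmonic_extension V E k x c ?h"
    proof
      show "is_harmonic_extension V E k x c ?h"
        unfolding is_harmonic_extension_def
      proof (intro conjI allI impI ballI)
        fix u :: "'a + nat" assume "u \<in> Inl ` V"
        then obtain v where v: "u = Inl v" "v \<in> V" by auto
        have out: "outflow (\<lambda>d. d) c (\<lambda>v. ?h (Inl v)) v = outflow (\<lambda>d. d) c (dirichlet_solution c) v"
          by (rule outflow_eq[OF v(2)]) (rule hv)
        show "(\<Sum>w | w \<in> ext_verts V k \<and> {u, w} \<in> edges. c {u, w} * (?h u - ?h w)) = 0"
          unfolding v(1)
        proof (rule trans[OF flow[of v ?h, OF v(2) hb] trans])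
          show "outflow (\<lambda>d. d) c (\<lambda>v. ?h (Inl v)) v + c (spoke v) * (?h (Inl v) - x b)
              = outflow (\<lambda>d. d) c (dirichlet_solution c) v + c (spoke v) * (dirichlet_solution c v - x b)"
            by (rule arg_cong2[where f = "(+)", OF out]) (rule arg_cong[OF hv[OF v(2)]])
        qed (assumption, rule kirchhoff[OF v(2)])
      qed (rule hb)
    qed simp
    fix g assume "g \<in> extensional (ext_verts V k) \<and> is_harmonic_extension V E k x c g"
    then have g: "g \<in> extensional (ext_verts V k)" "\<And>i. i \<le> k \<Longrightarrow> g (Inr i) = x i"
      "\<And>v. v \<in> V \<Longrightarrow> (\<Sum>w | w \<in> ext_verts V k \<and> {Inl v, w} \<in> edges. c {Inl v, w} * (g (Inl v) - g w)) = 0"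
      by (auto simp: is_harmonic_extension_def)
    define f where "f = (\<lambda>v\<in>V. g (Inl v))"
    have gf: "g (Inl v) = f v" if "v \<in> V" for v using that by (simp add: f_def)
    have "f = dirichlet_solution c"
    proof (rule dirichlet_unique[of c f, OF c])
      show "f \<in> vecs V" by (simp add: f_def)
      fix v assume v: "v \<in> V"
      have out: "outflow (\<lambda>d. d) c (\<lambda>v. g (Inl v)) v = outflow (\<lambda>d. d) c f v"
        by (rule outflow_eq[OF v]) (rule gf)
      show "outflow (\<lambda>d. d) c f v + c (spoke v) * (f v - x b) = 0"
      proof -
        have "outflow (\<lambda>d. d) c (\<lambda>v. g (Inl v)) v + c (spoke v) * (g (Inl v) - x b) = 0"
          by (rule trans[OF flow[of v g, symmetric] g(3)[OF v]]) (use v g(2) in auto)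
        then show ?thesis unfolding out gf[OF v] .
      qed
    qed
    then have gd: "g (Inl v) = dirichlet_solution c v" if "v \<in> V" for v using gf[OF that] by simp
    show "g = ?h"
    proof (rule extensionalityI[of _ "ext_verts V k"])
      fix u assume "u \<in> ext_verts V k"
      then show "g u = ?h u" using gd g(2) hv hb by (auto simp: ext_verts_def)
    qed (use g in auto)
  qed
qed

lemma sq_diff_harmonic_extension:
  assumes c: "\<And>e. e \<in> edges \<Longrightarrow> 0 < c e" and e: "e \<in> edges"
  shows "sq_diff (harmonic_extension V E k x c) e = sq_diff (vals (dirichlet_solution c)) e"
proof -
  have h: "harmonic_extension V E k x c = restrict (vals (dirichlet_solution c)) (ext_verts V k)"
    by (rule harmonic_extension_eq[of c, OF c])
  from e show ?thesis
  proof (rule edge_cases)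
    fix v u assume "v \<in> V" "u \<in> nbrs v" "e = {Inl v, Inl u}"
    then show ?thesis
      using nbrs_subset[of v] by (auto simp: h sq_diff_edge ext_verts_def)
  qed (auto simp: h sq_diff_edge ext_verts_def)
qed

lemma dirichlet_solution_scale:
  assumes c: "\<And>e. e \<in> edges \<Longrightarrow> 0 < c e" and r: "0 < r"
  shows "dirichlet_solution (\<lambda>e\<in>edges. r * c e) = dirichlet_solution c"
proof (rule dirichlet_unique[of "\<lambda>e\<in>edges. r * c e" "dirichlet_solution c", symmetric])
  show "dirichlet_solution c \<in> vecs V" by (rule dirichlet_solution(1)[of c, OF c])
  fix v assume v: "v \<in> V"
  let ?h = "dirichlet_solution c"
  have "outflow (\<lambda>d. d) (\<lambda>e\<in>edges. r * c e) ?h v = r * outflow (\<lambda>d. d) c ?h v"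
    unfolding outflow_def using interior_edge[OF v] boundary_edge[OF v]
    by (simp add: distrib_left sum_distrib_left mult.assoc)
  then have "outflow (\<lambda>d. d) (\<lambda>e\<in>edges. r * c e) ?h v + (\<lambda>e\<in>edges. r * c e) (spoke v) * (?h v - x b)
      = r * (outflow (\<lambda>d. d) c ?h v + c (spoke v) * (?h v - x b))"
    using spoke_edge[OF v] by (simp add: distrib_left mult.assoc)
  then show "outflow (\<lambda>d. d) (\<lambda>e\<in>edges. r * c e) ?h v + (\<lambda>e\<in>edges. r * c e) (spoke v) * (?h v - x b) = 0"
    using dirichlet_solution(3)[of c, OF c v] by simp
qed (use c r in simp)

theorem average_energy_product:
  assumes V: "V \<noteq> {}"
  shows "1 / measure (hyperplane_lebesgue edges) (open_simplex edges) *
    (LINT c:open_simplex edges|hyperplane_lebesgue edges.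
       (let h = harmonic_extension V E k x c; Z = dirichlet_energy edges c h
        in \<Prod>e\<in>edges. sq_diff h e / Z)) = real (card bounded_patterns)"
proof -
  obtain v where v: "v \<in> V" using V by auto
  have "(LINT c:open_simplex edges|hyperplane_lebesgue edges.
       (let h = harmonic_extension V E k x c; Z = dirichlet_energy edges c h
        in \<Prod>e\<in>edges. sq_diff h e / Z))
    = (LINT c:open_simplex edges|hyperplane_lebesgue edges. energy_prod c / energy c ^ card edges)"
    unfolding set_lebesgue_integral_def
  proof (intro Bochner_Integration.integral_cong refl)
    fix c :: "('a + nat) set \<Rightarrow> real"
    show "indicator (open_simplex edges) c *\<^sub>R (let h = harmonic_extension V E k x c; Z = dirichlet_energy edges c h
        in \<Prod>e\<in>edges. sq_diff h e / Z)
      = indicator (open_simplex edges) c *\<^sub>R (energy_prod c / energy c ^ card edges)"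
    proof (cases "c \<in> open_simplex edges")
      case True
      then have c: "0 < c e" if "e \<in> edges" for e using that by (auto simp: open_simplex_def)
      note sq = sq_diff_harmonic_extension[of c, OF c]
      have "dirichlet_energy edges c (harmonic_extension V E k x c) = energy c"
        unfolding dirichlet_energy_def energy_def by (intro sum.cong refl) (simp add: sq)
      moreover have "(\<Prod>e\<in>edges. sq_diff (harmonic_extension V E k x c) e) = energy_prod c"
        unfolding energy_prod_def by (intro prod.cong refl) (simp add: sq)
      ultimately show ?thesis by (simp add: Let_def prod_dividef)
    qed simp
  qed
  moreover have "1 / measure (hyperplane_lebesgue edges) (open_simplex edges) *
    (LINT c:open_simplex edges|hyperplane_lebesgue edges. energy_prod c / energy c ^ card edges)
      = real (card bounded_patterns)"
  proof (rule simplex_average)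
    have O: "orthant edges \<in> sets (leb edges)" by (auto intro!: sets_PiM_I_finite)
    have "(\<lambda>c. energy_prod c) \<in> borel_measurable (leb edges)" "(\<lambda>c. energy c) \<in> borel_measurable (leb edges)"
      by (rule measurable_energy; simp)+
    then show "(\<lambda>c. indicator (orthant edges) c * energy_prod c) \<in> borel_measurable (leb edges)"
      "(\<lambda>c. indicator (orthant edges) c * energy c) \<in> borel_measurable (leb edges)"
      using O by simp_all
    show "edges \<noteq> {}" using spoke_edge[OF v] by auto
    fix c assume "c \<in> orthant edges"
    then have c: "0 < c e" if "e \<in> edges" for e using that by auto
    show "0 \<le> energy_prod c" unfolding energy_prod_def by (intro prod_nonneg) (simp add: sq_diff_nonneg)
    have "0 < c (spoke v) * sq_diff (vals (dirichlet_solution c)) (spoke v)"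
      using c[OF spoke_edge[OF v]] dirichlet_solution(2)[of c, OF c v] by (simp add: sq_diff_spoke)
    moreover have "0 \<le> c e * sq_diff (vals (dirichlet_solution c)) e" if "e \<in> edges" for e
      using c[OF that] sq_diff_nonneg[OF that] by (simp add: less_imp_le)
    ultimately show "0 < energy c"
      unfolding energy_def using spoke_edge[OF v] by (intro sum_pos2[of _ "spoke v"]) auto
    fix r :: real assume r: "0 < r"
    have s: "dirichlet_solution (\<lambda>e\<in>edges. r * c e) = dirichlet_solution c"
      by (rule dirichlet_solution_scale[of c, OF c r])
    show "energy_prod (\<lambda>e\<in>edges. r * c e) = energy_prod c" unfolding energy_prod_def s ..
    show "energy (\<lambda>e\<in>edges. r * c e) = r * energy c"
      unfolding energy_def s sum_distrib_left by (intro sum.cong) (auto simp: mult.assoc)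
  qed (use energy_integral in auto)
  ultimately show ?thesis by simp
qed

end

theorem theorem9:
  fixes V :: "'a set" and E :: "'a set set" and k :: nat and x :: "nat \<Rightarrow> real"
  assumes "simple_graph V E" and "V \<noteq> {}"
    and "k \<ge> 1"
    and "inj_on x {..k}"
  shows "real_of_int \<bar>poly (chromatic_poly V E) (- int k)\<bar> =
    1 / measure (hyperplane_lebesgue (ext_edges V E k)) (open_simplex (ext_edges V E k)) *
    (LINT c:open_simplex (ext_edges V E k)|hyperplane_lebesgue (ext_edges V E k).
       (let h = harmonic_extension V E k x c;
            Z = dirichlet_energy (ext_edges V E k) c h
        in \<Prod>e\<in>ext_edges V E k. sq_diff h e / Z))"
proof -
  obtain b where b: "b \<in> {..k}" "\<And>i. i \<in> {..k} \<Longrightarrow> x b \<le> x i"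
    using ex_is_arg_min_if_finite[of "{..k}" x] by (auto simp: is_arg_min_def not_less)
  have min: "x b < x i" if "i \<le> k" "i \<noteq> b" for i
    using b(2)[of i] inj_onD[OF assms(4), of b i] b(1) that by fastforce
  interpret network V E k x b
    by standard (use assms b(1) min in auto)
  show ?thesis
    unfolding average_energy_product[OF assms(2)] card_bounded_patterns_chromatic[symmetric] by simp
qed

end
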